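(* Let $(M,J,g,\omega)$ be an almost Hermitian manifold of real dimension $2n$. The Bott-Chern Laplacian $$\tilde\Delta_{BC}=\partial\bar\partial\bar\partial^*\partial^*+\bar\partial^*\partial^*\partial\bar\partial+\partial^*\bar\partial\bar\partial^*\partial+\bar\partial^*\partial\partial^*\bar\partial+\partial^*\partial+\bar\partial^*\bar\partial,$$ acting on the spaces $A^{p,q}$ of smooth $(p,q)$-forms, is elliptic.
   Context: Manifolds are smooth, connected and without boundary. An almost Hermitian manifold $(M,J,g,\omega)$ of real dimension $2n$ is a manifold with an almost complex structure $J$ (not necessarily integrable), a Riemannian metric $g$ for which $J$ is an isometry, and the fundamental form $\omega(u,v)=g(Ju,v)$. $A^{p,q}$ is the space of smooth complex $(p,q)$-forms with respect to $J$. The exterior differential decomposes on $A^{p,q}$ as $d=\mu+\partial+\bar\partial+\bar\mu$, with components of bidegree $(2,-1),(1,0),(0,1),(-1,2)$ respectively. The volume form is $\mathrm{Vol}=\omega^n/n!$, and $*:A^{p,q}\to A^{n-q,n-p}$ is the $\mathbb{C}$-linear Hodge star, $\alpha\wedge *\bar\beta=\langle\alpha,\beta\rangle\mathrm{Vol}$, where $\langle\cdot,\cdot\rangle$ is the Hermitian inner product on forms induced by $g$. Set $\partial^*=-*\bar\partial*$ and $\bar\partial^*=-*\partial*$. A linear differential operator $P:\Gamma(M,E)\to\Gamma(M,F)$ of order $l$, locally $Pu=\sum_{|\alpha|\le l}a_\alpha D^\alpha u$, is elliptic if its principal symbol $\sigma_P(x,\xi)=\sum_{|\alpha|=l}a_\alpha(x)\xi^\alpha\in\mathrm{Hom}(E_x,F_x)$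 is an isomorphism for every $x\in M$ and every $0\neq\xi\in T_x^*M$. *)

theory Defs
  imports "HOL-Analysis.Analysis" "HOL-Library.Multiset"
begin

section \<open>Smooth functions on open subsets of coordinate space\<close>

text \<open>Unlike \<open>real^'d\<close>, the notation \<open>(real, 'd) vec\<close> does not force the sort of \<open>'d\<close> to be just
  \<open>finite\<close>; below the coordinate directions are often linearly ordered as well.\<close>
type_synonym 'd rvec = "(real, 'd) vec"
type_synonym 'd cvec = "(complex, 'd) vec"
type_synonym 'd rmat = "((real, 'd) vec, 'd) vec"

definition partial :: "'d \<Rightarrow> ('d rvec \<Rightarrow> 'b) \<Rightarrow> ('d::finite) rvec \<Rightarrow> 'b::real_normed_vector" where
  "partial i f x = frechet_derivative f (at x) (axis i 1)"

text \<open>For open \<open>S\<close> this is \<open>C\<^sup>\<infinity>\<close>: all iterated partial derivatives exist and are (Frechet)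
  differentiable, hence continuous, on \<open>S\<close>.\<close>
definition smooth_on :: "(('d::finite) rvec) set \<Rightarrow> ('d rvec \<Rightarrow> 'b::real_normed_vector) \<Rightarrow> bool" where
  "smooth_on S f \<longleftrightarrow> (\<forall>is. \<forall>x\<in>S. (foldr partial is f) differentiable (at x))"

text \<open>A multi-index over the coordinate directions \<open>'d\<close> is a finite multiset \<open>\<alpha>\<close> over \<open>'d\<close>, with
  \<open>|\<alpha>| = size \<alpha>\<close>.\<close>
definition mpartial ::
    "'d multiset \<Rightarrow> ('d rvec \<Rightarrow> 'b) \<Rightarrow> ('d::{finite,linorder}) rvec \<Rightarrow> 'b::real_normed_vector" where
  "mpartial \<alpha> f = foldr partial (sorted_list_of_multiset \<alpha>) f"

definition mpower :: "('d::finite) rvec \<Rightarrow> 'd multiset \<Rightarrow> real" where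
  "mpower \<xi> \<alpha> = (\<Prod>i\<in>#\<alpha>. \<xi> $ i)"


section \<open>The complexified exterior algebra of a coordinate space\<close>

text \<open>\<open>v :: complex^('d set)\<close> stands for \<open>\<Sum>\<^sub>I v\<^sub>I dx\<^sup>I\<close>, where \<open>dx\<^sup>I = dx\<^sup>i\<^sup>1 \<and> \<dots> \<and> dx\<^sup>i\<^sup>k\<close> if
  \<open>I = {i1 < \<dots> < ik}\<close>.\<close>
type_synonym 'd ext = "(complex, 'd set) vec"

definition ext_degree :: "nat \<Rightarrow> ('d::finite) ext set" where
  "ext_degree k = {v. \<forall>I. card I \<noteq> k \<longrightarrow> v $ I = 0}"

text \<open>\<open>dx\<^sup>I \<and> dx\<^sup>J = shuffle_sign I J dx\<^bsup>I \<union> J\<^esup>\<close> for disjoint \<open>I\<close>, \<open>J\<close>.\<close>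
definition shuffle_sign :: "('d::{finite,linorder}) set \<Rightarrow> 'd set \<Rightarrow> complex" where
  "shuffle_sign I J = (- 1) ^ card {(i, j). i \<in> I \<and> j \<in> J \<and> j < i}"

definition wedge :: "('d::{finite,linorder}) ext \<Rightarrow> 'd ext \<Rightarrow> 'd ext" where
  "wedge v w = (\<chi> K. \<Sum>I\<in>Pow K. shuffle_sign I (K - I) * v $ I * w $ (K - I))"

definition wedge_list :: "('d::{finite,linorder}) ext list \<Rightarrow> 'd ext" where
  "wedge_list vs = foldr wedge vs (axis {} 1)"

definition covec :: "('d::finite) cvec \<Rightarrow> 'd ext" where
  "covec \<xi> = (\<Sum>i\<in>UNIV. \<xi> $ i *s axis {i} 1)"

definition conj_ext :: "('d::finite) ext \<Rightarrow> 'd ext" where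
  "conj_ext v = (\<chi> I. cnj (v $ I))"

text \<open>The algebra homomorphism with \<open>dx\<^sup>i \<mapsto> \<Sum>\<^sub>j D\<^sub>i\<^sub>j dx\<^sup>j\<close>.\<close>
definition pullback :: "'d rmat \<Rightarrow> ('d::{finite,linorder}) ext \<Rightarrow> 'd ext" where
  "pullback D v = (\<Sum>I\<in>UNIV. v $ I *s
     wedge_list (map (\<lambda>i. covec (\<chi> j. of_real (D $ i $ j))) (sorted_list_of_set I)))"

definition ext_d :: "('d rvec \<Rightarrow> 'd ext) \<Rightarrow> 'd rvec \<Rightarrow> ('d::{finite,linorder}) ext" where
  "ext_d f y = (\<Sum>i\<in>UNIV. wedge (covec (axis i 1)) (partial i f y))"


section \<open>Pointwise Hermitian linear algebra\<close>

text \<open>A bilinear form on tangent vectors has a matrix \<open>g\<close> with \<open>g(u,v) = u \<bullet> (g *v v)\<close>; an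
  endomorphism has a matrix \<open>J\<close> acting by \<open>J *v u\<close>.\<close>

text \<open>Complex covectors \<open>\<xi>\<close> with \<open>\<xi> \<circ> J = \<lambda>\<xi>\<close>: type \<open>(1,0)\<close> for \<open>\<lambda> = \<i>\<close> and type \<open>(0,1)\<close> for \<open>\<lambda> = -\<i>\<close>.\<close>
definition eigen_covectors :: "complex \<Rightarrow> 'd rmat \<Rightarrow> (('d::finite) cvec) set" where
  "eigen_covectors l J = {\<xi>. \<xi> v* (\<chi> i j. of_real (J $ i $ j)) = l *s \<xi>}"

definition pq_space :: "'d rmat \<Rightarrow> nat \<Rightarrow> nat \<Rightarrow> ('d::{finite,linorder}) ext set" where
  "pq_space J p q = vec.span {wedge_list (map covec (as @ bs)) | as bs.
     length as = p \<and> set as \<subseteq> eigen_covectors \<i> J \<and>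
     length bs = q \<and> set bs \<subseteq> eigen_covectors (- \<i>) J}"

text \<open>The component in bidegree \<open>(p,q)\<close> for the decomposition of the exterior algebra into the
  direct sum of the \<open>pq_space J r s\<close>.\<close>
definition pq_comp :: "'d rmat \<Rightarrow> nat \<Rightarrow> nat \<Rightarrow> 'd ext \<Rightarrow> ('d::{finite,linorder}) ext" where
  "pq_comp J p q v = (THE w. w \<in> pq_space J p q \<and>
     v - w \<in> vec.span (\<Union>{pq_space J r s | r s. (r, s) \<noteq> (p, q)}))"

text \<open>\<open>\<omega> = \<Sum>\<^sub>i\<^sub><\<^sub>j \<omega>(e\<^sub>i,e\<^sub>j) dx\<^sup>i \<and> dx\<^sup>j\<close> with \<open>\<omega>(u,v) = g(Ju,v)\<close>.\<close>
definition fund_form :: "'d rmat \<Rightarrow> 'd rmat \<Rightarrow> ('d::{finite,linorder}) ext" where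
  "fund_form J g = (\<Sum>i\<in>UNIV. \<Sum>j\<in>{i<..}.
     of_real ((J *v axis i 1) \<bullet> (g *v axis j 1)) *s
       wedge (covec (axis i 1)) (covec (axis j 1)))"

definition vol_form :: "nat \<Rightarrow> 'd rmat \<Rightarrow> 'd rmat \<Rightarrow> ('d::{finite,linorder}) ext" where
  "vol_form n J g = (1 / fact n) *s wedge_list (replicate n (fund_form J g))"

text \<open>The determinant of the submatrix of \<open>M\<close> with rows \<open>I\<close> and columns \<open>J\<close>, for \<open>card I = card J\<close>.\<close>
definition minor :: "'d rmat \<Rightarrow> 'd set \<Rightarrow> ('d::{finite,linorder}) set \<Rightarrow> real" where
  "minor M I J = (\<Sum>p | p permutes {..<card I}. of_int (sign p) *
     (\<Prod>a<card I. M $ (sorted_list_of_set I ! a) $ (sorted_list_of_set J ! p a)))"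

text \<open>The Hermitian inner product on forms induced by \<open>g\<close>: decomposable forms satisfy
  \<open>\<langle>\<alpha>\<^sub>1 \<and> \<dots> \<and> \<alpha>\<^sub>k, \<beta>\<^sub>1 \<and> \<dots> \<and> \<beta>\<^sub>k\<rangle> = det \<langle>\<alpha>\<^sub>a, \<beta>\<^sub>b\<rangle>\<close>, where \<open>\<langle>dx\<^sup>i, dx\<^sup>j\<rangle>\<close> are the entries of the inverse of \<open>g\<close>.\<close>
definition ext_inner :: "'d rmat \<Rightarrow> 'd ext \<Rightarrow> ('d::{finite,linorder}) ext \<Rightarrow> complex" where
  "ext_inner g v w = (\<Sum>I\<in>UNIV. \<Sum>J\<in>{J. card J = card I}.
     of_real (minor (matrix_inv g) I J) * v $ I * cnj (w $ J))"

text \<open>The degree condition pins down the operator uniquely: a component of \<open>*(conj \<beta>)\<close> of degree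
  above \<open>2n - k\<close> would be invisible to \<open>\<alpha> \<and> *(conj \<beta>)\<close>.\<close>
definition hodge_star :: "nat \<Rightarrow> 'd rmat \<Rightarrow> 'd rmat \<Rightarrow> 'd ext \<Rightarrow> ('d::{finite,linorder}) ext" where
  "hodge_star n J g = (THE S. Vector_Spaces.linear (*s) (*s) S \<and>
     (\<forall>k\<le>2 * n. \<forall>\<alpha>\<in>ext_degree k. \<forall>\<beta>\<in>ext_degree k.
        S (conj_ext \<beta>) \<in> ext_degree (2 * n - k) \<and>
        wedge \<alpha> (S (conj_ext \<beta>)) = ext_inner g \<alpha> \<beta> *s vol_form n J g))"


section \<open>Operators on forms in a coordinate domain\<close>

text \<open>Here \<open>J\<close>, \<open>g\<close> and the form \<open>f\<close> are functions of the coordinates. On a form of pure bidegree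
  \<open>(p,q)\<close>, \<open>del\<close> and \<open>delbar\<close> are the components of \<open>d\<close> in bidegrees \<open>(p+1,q)\<close> and \<open>(p,q+1)\<close>; they
  are extended additively to forms of mixed bidegree. (Bidegrees beyond the dimension contribute
  nothing.)\<close>
definition del ::
    "('d rvec \<Rightarrow> 'd rmat) \<Rightarrow> ('d rvec \<Rightarrow> 'd ext) \<Rightarrow> 'd rvec \<Rightarrow> ('d::{finite,linorder}) ext" where
  "del J f y = (\<Sum>p\<le>CARD('d). \<Sum>q\<le>CARD('d).
     pq_comp (J y) (p + 1) q (ext_d (\<lambda>z. pq_comp (J z) p q (f z)) y))"

definition delbar ::
    "('d rvec \<Rightarrow> 'd rmat) \<Rightarrow> ('d rvec \<Rightarrow> 'd ext) \<Rightarrow> 'd rvec \<Rightarrow> ('d::{finite,linorder}) ext" where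
  "delbar J f y = (\<Sum>p\<le>CARD('d). \<Sum>q\<le>CARD('d).
     pq_comp (J y) p (q + 1) (ext_d (\<lambda>z. pq_comp (J z) p q (f z)) y))"

definition star_field ::
    "nat \<Rightarrow> ('d rvec \<Rightarrow> 'd rmat) \<Rightarrow> ('d rvec \<Rightarrow> 'd rmat) \<Rightarrow>
     ('d rvec \<Rightarrow> 'd ext) \<Rightarrow> 'd rvec \<Rightarrow> ('d::{finite,linorder}) ext" where
  "star_field n J g f y = hodge_star n (J y) (g y) (f y)"

definition del_adj ::
    "nat \<Rightarrow> ('d rvec \<Rightarrow> 'd rmat) \<Rightarrow> ('d rvec \<Rightarrow> 'd rmat) \<Rightarrow>
     ('d rvec \<Rightarrow> 'd ext) \<Rightarrow> 'd rvec \<Rightarrow> ('d::{finite,linorder}) ext" where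
  "del_adj n J g f y = - star_field n J g (delbar J (star_field n J g f)) y"

definition delbar_adj ::
    "nat \<Rightarrow> ('d rvec \<Rightarrow> 'd rmat) \<Rightarrow> ('d rvec \<Rightarrow> 'd rmat) \<Rightarrow>
     ('d rvec \<Rightarrow> 'd ext) \<Rightarrow> 'd rvec \<Rightarrow> ('d::{finite,linorder}) ext" where
  "delbar_adj n J g f y = - star_field n J g (del J (star_field n J g f)) y"

definition bott_chern_local ::
    "nat \<Rightarrow> ('d rvec \<Rightarrow> 'd rmat) \<Rightarrow> ('d rvec \<Rightarrow> 'd rmat) \<Rightarrow>
     ('d rvec \<Rightarrow> 'd ext) \<Rightarrow> 'd rvec \<Rightarrow> ('d::{finite,linorder}) ext" where
  "bott_chern_local n J g f y =
    (let D = del J; Db = delbar J; Da = del_adj n J g; Dba = delbar_adj n J g in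
       D (Db (Dba (Da f))) y + Dba (Da (D (Db f))) y + Da (Db (Dba (D f))) y
       + Dba (D (Da (Db f))) y + Da (D f) y + Dba (Db f) y)"


section \<open>Manifolds and tensor fields\<close>

text \<open>The manifold is a whole type \<open>'m\<close>, and its smooth structure is given by an atlas (not
  necessarily maximal) of charts, i.e. pairs of a domain and a coordinate map.\<close>
type_synonym ('m, 'd) chart = "'m set \<times> ('m \<Rightarrow> 'd rvec)"

definition chart_image :: "('m, 'd::finite) chart \<Rightarrow> ('d rvec) set" where
  "chart_image c = snd c ` fst c"

definition chart_overlap :: "('m, 'd::finite) chart \<Rightarrow> ('m, 'd) chart \<Rightarrow> ('d rvec) set" where
  "chart_overlap c c' = snd c ` (fst c \<inter> fst c')"

definition transition :: "('m, 'd::finite) chart \<Rightarrow> ('m, 'd) chart \<Rightarrow> 'd rvec \<Rightarrow> 'd rvec" where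
  "transition c c' = snd c' \<circ> inv_into (fst c) (snd c)"

abbreviation transition_jacobian ::
    "('m, 'd::finite) chart \<Rightarrow> ('m, 'd) chart \<Rightarrow> 'd rvec \<Rightarrow> 'd rmat" where
  "transition_jacobian c c' y \<equiv> jacobian (transition c c') (at y)"

definition smooth_atlas :: "('m::topological_space, 'd::finite) chart set \<Rightarrow> bool" where
  "smooth_atlas A \<longleftrightarrow>
     (\<forall>c\<in>A. open (fst c) \<and> open (chart_image c) \<and>
        homeomorphism (fst c) (chart_image c) (snd c) (inv_into (fst c) (snd c))) \<and>
     (\<Union>c\<in>A. fst c) = UNIV \<and>
     (\<forall>c\<in>A. \<forall>c'\<in>A. smooth_on (chart_overlap c c') (transition c c'))"

text \<open>A tensor field \<open>T\<close> is given by its components \<open>T c y\<close> in each chart \<open>c\<close> at the point with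
  coordinates \<open>y \<in> chart_image c\<close>, subject to the transformation law of its type. Values at
  \<open>y \<notin> chart_image c\<close> are irrelevant.\<close>

definition almost_complex_structure ::
    "('m, 'd::finite) chart set \<Rightarrow> (('m, 'd) chart \<Rightarrow> 'd rvec \<Rightarrow> 'd rmat) \<Rightarrow> bool" where
  "almost_complex_structure A J \<longleftrightarrow>
     (\<forall>c\<in>A. smooth_on (chart_image c) (J c) \<and>
        (\<forall>y\<in>chart_image c. J c y ** J c y = - mat 1)) \<and>
     (\<forall>c\<in>A. \<forall>c'\<in>A. \<forall>y\<in>chart_overlap c c'.
        J c' (transition c c' y) ** transition_jacobian c c' y
          = transition_jacobian c c' y ** J c y)"

definition riemannian_metric ::
    "('m, 'd::finite) chart set \<Rightarrow> (('m, 'd) chart \<Rightarrow> 'd rvec \<Rightarrow> 'd rmat) \<Rightarrow> bool" where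
  "riemannian_metric A g \<longleftrightarrow>
     (\<forall>c\<in>A. smooth_on (chart_image c) (g c) \<and>
        (\<forall>y\<in>chart_image c. transpose (g c y) = g c y \<and>
           (\<forall>v. v \<noteq> 0 \<longrightarrow> v \<bullet> (g c y *v v) > 0))) \<and>
     (\<forall>c\<in>A. \<forall>c'\<in>A. \<forall>y\<in>chart_overlap c c'.
        g c y = transpose (transition_jacobian c c' y) ** g c' (transition c c' y)
                  ** transition_jacobian c c' y)"

definition almost_hermitian_manifold ::
    "nat \<Rightarrow> ('m::{t2_space,second_countable_topology}, 'd::finite) chart set \<Rightarrow>
     (('m, 'd) chart \<Rightarrow> 'd rvec \<Rightarrow> 'd rmat) \<Rightarrow>
     (('m, 'd) chart \<Rightarrow> 'd rvec \<Rightarrow> 'd rmat) \<Rightarrow> bool" where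
  "almost_hermitian_manifold n A J g \<longleftrightarrow>
     CARD('d) = 2 * n \<and> connected (UNIV :: 'm set) \<and> smooth_atlas A \<and>
     almost_complex_structure A J \<and> riemannian_metric A g \<and>
     (\<forall>c\<in>A. \<forall>y\<in>chart_image c. \<forall>u v.
        (J c y *v u) \<bullet> (g c y *v (J c y *v v)) = u \<bullet> (g c y *v v))"


section \<open>Differential operators on bundles of forms\<close>

text \<open>\<open>E c y\<close> is the fibre, in the components of the chart \<open>c\<close>, of a subbundle \<open>E\<close> of the
  complexified exterior bundle.\<close>
type_synonym ('m, 'd) form_bundle = "('m, 'd) chart \<Rightarrow> 'd rvec \<Rightarrow> 'd ext set"
type_synonym ('m, 'd) form_field = "('m, 'd) chart \<Rightarrow> 'd rvec \<Rightarrow> 'd ext"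

definition pq_bundle ::
    "(('m, 'd) chart \<Rightarrow> 'd rvec \<Rightarrow> 'd rmat) \<Rightarrow> nat \<Rightarrow> nat \<Rightarrow> ('m, 'd::{finite,linorder}) form_bundle"
  where "pq_bundle J p q c y = pq_space (J c y) p q"

definition sections ::
    "('m, 'd::{finite,linorder}) chart set \<Rightarrow> ('m, 'd) form_bundle \<Rightarrow> ('m, 'd) form_field set" where
  "sections A E = {u.
     (\<forall>c\<in>A. smooth_on (chart_image c) (u c) \<and> (\<forall>y\<in>chart_image c. u c y \<in> E c y)) \<and>
     (\<forall>c\<in>A. \<forall>c'\<in>A. \<forall>y\<in>chart_overlap c c'.
        u c y = pullback (transition_jacobian c c' y) (u c' (transition c c' y)))}"

definition local_frame ::
    "('m, 'd::finite) form_bundle \<Rightarrow> ('m, 'd) chart \<Rightarrow> ('d rvec) set \<Rightarrow> nat \<Rightarrow>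
     (nat \<Rightarrow> 'd rvec \<Rightarrow> 'd ext) \<Rightarrow> bool" where
  "local_frame E c V r e \<longleftrightarrow>
     open V \<and> V \<subseteq> chart_image c \<and> (\<forall>i<r. smooth_on V (e i)) \<and>
     (\<forall>y\<in>V. inj_on (\<lambda>i. e i y) {..<r} \<and>
        vec.independent ((\<lambda>i. e i y) ` {..<r}) \<and>
        vec.span ((\<lambda>i. e i y) ` {..<r}) = E c y)"

text \<open>\<open>P u = \<Sum>\<^bsub>|\<alpha>| \<le> l\<^esub> a\<^sub>\<alpha> D\<^sup>\<alpha> u\<close> over \<open>V\<close>, for smooth \<open>a\<^sub>\<alpha>(y) \<in> Hom(E\<^sub>y, F\<^sub>y)\<close>; here \<open>D\<^sup>\<alpha>\<close> acts in the
  trivialization of \<open>E\<close> by the frame \<open>e\<close>, i.e. on the coefficients \<open>w\<close> of \<open>u = \<Sum>\<^sub>i w\<^sub>i e\<^sub>i\<close>. As \<open>e\<close> is a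
  frame, smoothness of \<open>a\<^sub>\<alpha>\<close> means smoothness of all \<open>a\<^sub>\<alpha> e\<^sub>i\<close>.\<close>
definition local_expression ::
    "('m, 'd::{finite,linorder}) chart set \<Rightarrow> ('m, 'd) form_bundle \<Rightarrow> ('m, 'd) form_bundle \<Rightarrow>
     nat \<Rightarrow> (('m, 'd) form_field \<Rightarrow> ('m, 'd) form_field) \<Rightarrow>
     ('m, 'd) chart \<Rightarrow> ('d rvec) set \<Rightarrow> nat \<Rightarrow> (nat \<Rightarrow> 'd rvec \<Rightarrow> 'd ext) \<Rightarrow>
     ('d multiset \<Rightarrow> 'd rvec \<Rightarrow> 'd ext \<Rightarrow> 'd ext) \<Rightarrow> bool" where
  "local_expression A E F l P c V r e a \<longleftrightarrow>
     local_frame E c V r e \<and>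
     (\<forall>\<alpha>. size \<alpha> \<le> l \<longrightarrow>
        (\<forall>y\<in>V. (\<forall>v\<in>E c y. a \<alpha> y v \<in> F c y) \<and>
           (\<forall>v\<in>E c y. \<forall>w\<in>E c y. a \<alpha> y (v + w) = a \<alpha> y v + a \<alpha> y w) \<and>
           (\<forall>s. \<forall>v\<in>E c y. a \<alpha> y (s *s v) = s *s a \<alpha> y v)) \<and>
        (\<forall>i<r. smooth_on V (\<lambda>y. a \<alpha> y (e i y)))) \<and>
     (\<forall>u\<in>sections A E. \<forall>w :: nat \<Rightarrow> 'd rvec \<Rightarrow> complex.
        (\<forall>i<r. smooth_on V (w i)) \<longrightarrow> (\<forall>y\<in>V. u c y = (\<Sum>i<r. w i y *s e i y)) \<longrightarrow>
        (\<forall>y\<in>V. P u c y =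
           (\<Sum>\<alpha> | size \<alpha> \<le> l. a \<alpha> y (\<Sum>i<r. mpartial \<alpha> (w i) y *s e i y))))"

definition linear_on_sections ::
    "('m, 'd::{finite,linorder}) chart set \<Rightarrow> ('m, 'd) form_bundle \<Rightarrow> ('m, 'd) form_bundle \<Rightarrow>
     (('m, 'd) form_field \<Rightarrow> ('m, 'd) form_field) \<Rightarrow> bool" where
  "linear_on_sections A E F P \<longleftrightarrow>
     (\<forall>u\<in>sections A E. P u \<in> sections A F) \<and>
     (\<forall>u\<in>sections A E. \<forall>v\<in>sections A E. \<forall>c\<in>A. \<forall>y\<in>chart_image c.
        P (\<lambda>c y. u c y + v c y) c y = P u c y + P v c y) \<and>
     (\<forall>s. \<forall>u\<in>sections A E. \<forall>c\<in>A. \<forall>y\<in>chart_image c.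
        P (\<lambda>c y. s *s u c y) c y = s *s P u c y)"

definition differential_operator ::
    "('m, 'd::{finite,linorder}) chart set \<Rightarrow> ('m, 'd) form_bundle \<Rightarrow> ('m, 'd) form_bundle \<Rightarrow>
     nat \<Rightarrow> (('m, 'd) form_field \<Rightarrow> ('m, 'd) form_field) \<Rightarrow> bool" where
  "differential_operator A E F l P \<longleftrightarrow>
     linear_on_sections A E F P \<and>
     (\<forall>c\<in>A. \<forall>y\<in>chart_image c. \<exists>V r e a. y \<in> V \<and> local_expression A E F l P c V r e a)"

definition symbol ::
    "nat \<Rightarrow> ('d multiset \<Rightarrow> 'd rvec \<Rightarrow> 'd ext \<Rightarrow> 'd ext) \<Rightarrow>
     'd rvec \<Rightarrow> 'd rvec \<Rightarrow> 'd ext \<Rightarrow> ('d::finite) ext" where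
  "symbol l a y \<xi> v = (\<Sum>\<alpha> | size \<alpha> = l. of_real (mpower \<xi> \<alpha>) *s a \<alpha> y v)"

text \<open>\<open>\<xi>\<close> lists the components of a real covector in the chart \<open>c\<close>. The symbol is linear on \<open>E c y\<close>
  with values in \<open>F c y\<close>, so bijectivity means that it is an isomorphism.\<close>
definition elliptic ::
    "('m, 'd::{finite,linorder}) chart set \<Rightarrow> ('m, 'd) form_bundle \<Rightarrow> ('m, 'd) form_bundle \<Rightarrow>
     nat \<Rightarrow> (('m, 'd) form_field \<Rightarrow> ('m, 'd) form_field) \<Rightarrow> bool" where
  "elliptic A E F l P \<longleftrightarrow>
     differential_operator A E F l P \<and>
     (\<forall>c\<in>A. \<forall>V r e a. local_expression A E F l P c V r e a \<longrightarrow>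
        (\<forall>y\<in>V. \<forall>\<xi>. \<xi> \<noteq> 0 \<longrightarrow> bij_betw (symbol l a y \<xi>) (E c y) (F c y)))"

text \<open>The operators are local and natural, so on a manifold they are computed chart by chart.\<close>
definition bott_chern_laplacian ::
    "nat \<Rightarrow> (('m, 'd) chart \<Rightarrow> 'd rvec \<Rightarrow> 'd rmat) \<Rightarrow>
     (('m, 'd) chart \<Rightarrow> 'd rvec \<Rightarrow> 'd rmat) \<Rightarrow>
     ('m, 'd::{finite,linorder}) form_field \<Rightarrow> ('m, 'd) form_field" where
  "bott_chern_laplacian n J g u c = bott_chern_local n (J c) (g c) (u c)"

end

theory Submission
  imports Defs
begin

text \<open>Ellipticity is a statement about principal symbols. At a real covector \<open>\<xi> \<noteq> 0\<close> the symbol of \<open>\<partial>\<close> is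
  \<open>a = \<xi>\<^sup>1\<^sup>0 \<and> _\<close>, that of its conjugate is \<open>b = \<xi>\<^sup>0\<^sup>1 \<and> _\<close>, and those of the formal adjoints are multiples
  \<open>a'\<close>, \<open>b'\<close> of contractions with the metric duals. The Clifford relations give \<open>a a' + a' a = c\<close> and
  \<open>b b' + b' b = c\<close> with the same scalar \<open>c \<noteq> 0\<close>, a multiple of \<open>|\<xi>|\<^sup>2\<close>, and all other pairs anticommute
  because \<open>\<xi>\<^sup>1\<^sup>0\<close> and \<open>\<xi>\<^sup>0\<^sup>1\<close> are isotropic for the complex bilinear metric. The two terms of order 2 of the
  Laplacian do not contribute to the symbol of order 4, and the four terms of order 4 add up to
  \<open>(a a' + a' a) (b b' + b' b) = c\<^sup>2\<close>. So the symbol is a nonzero multiple of the identity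
  (\<open>bott_chern_symbol\<close>). Non-integrability of \<open>J\<close> only affects terms of lower order.

  Three facts of linear algebra stand behind this. The Hodge star is, up to a scalar, the composite of
  the algebra map induced by the inverse metric with passage to complementary indices, so that
  conjugating a wedge multiplication with it yields a contraction (\<open>star_emult_star\<close>). That the star
  exists at all rests on \<open>\<omega>\<^sup>n \<noteq> 0\<close> (\<open>two_form_power_nonzero\<close>). Bidegrees are read off from one linear
  map, the algebra map \<open>X\<close> induced by the matrix acting as 2 on covectors of type \<open>(1,0)\<close> and as 3 on
  those of type \<open>(0,1)\<close>: it acts on bidegree \<open>(p,q)\<close> as \<open>2\<^sup>p 3\<^sup>q\<close>, so by unique factorization the
  bidegree components are its spectral projections. They are Lagrange polynomials in \<open>X\<close>
  (\<open>pq_comp_eq\<close>), hence smooth in \<open>J\<close> and natural.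

  The passage from operators to symbols is made by a calculus of differential operators acting on
  families of coefficient functions (\<open>diffop\<close>): applying a smooth family of linear maps keeps the order
  and acts on the symbol, a partial derivative raises the order by one and multiplies the symbol by
  \<open>\<xi>\<^sub>j\<close>. Following the Laplacian through this calculus gives its order, its symbol and its smooth
  coefficients at the same time (\<open>diffop_bott_chern\<close>). On a manifold, naturality of \<open>d\<close>, of the bidegree
  projections and of the star makes the chartwise operator act on sections (\<open>bott_chern_related\<close>), a
  frame moving with \<open>J\<close> gives local expressions (\<open>local_frame_exists\<close>, \<open>local_expression_exists\<close>), and
  cutoff functions provide enough global sections to determine the symbol of an arbitrary local
  expression (\<open>symbol_scalar\<close>).\<close>

section \<open>Calculus of smooth functions\<close>

text \<open>Smoothness in stages: all iterated partial derivatives of order at most \<open>k\<close> are differentiable.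
  The product and chain rules express a partial derivative of a composite by composites of partial
  derivatives, so closure properties follow by induction on \<open>k\<close>.\<close>

primrec diffk :: "nat \<Rightarrow> (('d::finite) rvec) set \<Rightarrow> ('d rvec \<Rightarrow> 'b::real_normed_vector) \<Rightarrow> bool" where
  "diffk 0 S f \<longleftrightarrow> (\<forall>x\<in>S. f differentiable (at x))"
| "diffk (Suc k) S f \<longleftrightarrow> (\<forall>x\<in>S. f differentiable (at x)) \<and> (\<forall>i. diffk k S (partial i f))"

lemma diffk_iff_foldr:
  "diffk k S f \<longleftrightarrow> (\<forall>is. length is \<le> k \<longrightarrow> (\<forall>x\<in>S. (foldr partial is f) differentiable (at x)))"
proof (induction k arbitrary: f)
  case 0
  then show ?case by simp
next
  case (Suc k)
  have "(\<forall>is. length is \<le> Suc k \<longrightarrow> P is) \<longleftrightarrow> P [] \<and> (\<forall>i js. length js \<le> k \<longrightarrow> P (js @ [i]))" for P :: "'a list \<Rightarrow> bool"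
    apply (rule iffI)
     apply simp
    apply (intro allI)
    subgoal for xs by (cases xs rule: rev_cases) auto
    done
  from this[of "\<lambda>is. \<forall>x\<in>S. (foldr partial is f) differentiable (at x)"] show ?case
    by (simp add: Suc.IH)
qed

lemma smooth_on_iff_diffk: "smooth_on S f \<longleftrightarrow> (\<forall>k. diffk k S f)"
  unfolding smooth_on_def diffk_iff_foldr by auto

lemma diffk_Suc_imp: "diffk (Suc k) S f \<Longrightarrow> diffk k S f"
  by (simp add: diffk_iff_foldr)

lemma diffk_differentiable: "diffk k S f \<Longrightarrow> x \<in> S \<Longrightarrow> f differentiable (at x)"
  by (cases k) auto

lemma smooth_on_differentiable: "smooth_on S f \<Longrightarrow> x \<in> S \<Longrightarrow> f differentiable (at x)"
  by (meson diffk_differentiable smooth_on_iff_diffk)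

lemma smooth_on_partial: "smooth_on S f \<Longrightarrow> smooth_on S (partial i f)"
  using smooth_on_iff_diffk diffk.simps(2) by metis

lemma smooth_on_foldr_partial: "smooth_on S f \<Longrightarrow> smooth_on S (foldr partial is f)"
  by (induction "is") (auto intro: smooth_on_partial)

lemma smooth_on_subset: "smooth_on S f \<Longrightarrow> T \<subseteq> S \<Longrightarrow> smooth_on T f"
  unfolding smooth_on_def by blast

lemma smooth_on_local:
  assumes "\<And>x. x \<in> S \<Longrightarrow> \<exists>T. x \<in> T \<and> smooth_on T f" shows "smooth_on S f"
  using assms unfolding smooth_on_def by blast

lemma partial_eqI: "(f has_derivative f') (at x) \<Longrightarrow> partial i f x = f' (axis i 1)"
  unfolding partial_def using frechet_derivative_at by metis

lemma partial_cong:
  assumes "open S" "x \<in> S" "\<And>z. z \<in> S \<Longrightarrow> f z = g z"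
  shows "partial i f x = partial i g x"
proof -
  have "(f has_derivative D) (at x) \<longleftrightarrow> (g has_derivative D) (at x)" for D
    using assms has_derivative_transform_within_open by (metis (no_types, lifting))
  then show ?thesis by (simp add: partial_def frechet_derivative_def)
qed

lemma foldr_partial_cong:
  assumes "open S" "\<And>z. z \<in> S \<Longrightarrow> f z = g z"
  shows "x \<in> S \<Longrightarrow> foldr partial is f x = foldr partial is g x"
proof (induction "is" arbitrary: x)
  case (Cons i "is")
  then show ?case using partial_cong[OF assms(1) Cons.prems, of "foldr partial is f" "foldr partial is g"] by simp
qed (use assms in auto)

lemma differentiable_cong:
  assumes "open S" "x \<in> S" "\<And>z. z \<in> S \<Longrightarrow> f z = g z" "f differentiable (at x)"
  shows "g differentiable (at x)"
  using assms has_derivative_transform_within_open unfolding differentiable_def by metis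

lemma smooth_on_cong:
  assumes "open S" "\<And>z. z \<in> S \<Longrightarrow> f z = g z" "smooth_on S f"
  shows "smooth_on S g"
  unfolding smooth_on_def
proof (intro allI ballI)
  fix "is" x assume x: "x \<in> S"
  show "foldr partial is g differentiable (at x)"
    by (rule differentiable_cong[OF assms(1) x, of "foldr partial is f"])
       (use assms x foldr_partial_cong[OF assms(1,2)] in \<open>auto simp: smooth_on_def\<close>)
qed

lemma diffk_cong:
  assumes "open S" "\<And>z. z \<in> S \<Longrightarrow> f z = g z" "diffk k S f"
  shows "diffk k S g"
  unfolding diffk_iff_foldr
proof (intro allI impI ballI)
  fix "is" :: "'a list" and x assume x: "length is \<le> k" "x \<in> S"
  show "foldr partial is g differentiable (at x)"
    by (rule differentiable_cong[OF assms(1) x(2), of "foldr partial is f"])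
       (use assms x foldr_partial_cong[OF assms(1,2)] in \<open>auto simp: diffk_iff_foldr\<close>)
qed

lemma diffk_SucI:
  assumes "open S" "\<And>x. x \<in> S \<Longrightarrow> f differentiable (at x)"
    and "\<And>i. \<exists>h. diffk k S h \<and> (\<forall>x\<in>S. partial i f x = h x)"
  shows "diffk (Suc k) S f"
  using assms diffk_cong[OF assms(1)] by (metis diffk.simps(2))

lemma has_derivative_frechet:
  "f differentiable (at x) \<Longrightarrow> (f has_derivative frechet_derivative f (at x)) (at x)"
  using frechet_derivative_works by blast

lemma partial_add:
  assumes "f differentiable (at x)" "g differentiable (at x)"
  shows "partial i (\<lambda>x. f x + g x) x = partial i f x + partial i g x"
  using has_derivative_add[OF assms[THEN has_derivative_frechet]]
  by (subst partial_eqI) (auto simp: partial_def)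

lemma partial_bounded_linear:
  assumes "bounded_linear L" "f differentiable (at x)"
  shows "partial i (\<lambda>x. L (f x)) x = L (partial i f x)"
  using bounded_linear.has_derivative[OF assms(1) has_derivative_frechet[OF assms(2)]]
  by (subst partial_eqI) (auto simp: partial_def)

lemma partial_bounded_bilinear:
  assumes "bounded_bilinear h" "f differentiable (at x)" "g differentiable (at x)"
  shows "partial i (\<lambda>x. h (f x) (g x)) x = h (f x) (partial i g x) + h (partial i f x) (g x)"
  using bounded_bilinear.FDERIV[OF assms(1) assms(2,3)[THEN has_derivative_frechet]]
  by (subst partial_eqI) (auto simp: partial_def)

lemma differentiable_bounded_linear:
  "bounded_linear L \<Longrightarrow> f differentiable (at x) \<Longrightarrow> (\<lambda>x. L (f x)) differentiable (at x)"
  using bounded_linear.has_derivative unfolding differentiable_def by blast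

lemma differentiable_bounded_bilinear:
  "bounded_bilinear h \<Longrightarrow> f differentiable (at x) \<Longrightarrow> g differentiable (at x) \<Longrightarrow>
    (\<lambda>x. h (f x) (g x)) differentiable (at x)"
  using bounded_bilinear.FDERIV unfolding differentiable_def by blast

lemma partial_const [simp]: "partial i (\<lambda>x. c) = (\<lambda>x. 0)"
  by (rule ext, subst partial_eqI[OF has_derivative_const]) simp

lemma diffk_const: "diffk k S (\<lambda>x. c)"
proof (induction k arbitrary: c)
qed (auto simp: differentiable_const)

lemma diffk_add:
  assumes "open S" "diffk k S f" "diffk k S g" shows "diffk k S (\<lambda>x. f x + g x)"
  using assms(2,3)
proof (induction k arbitrary: f g)
  case (Suc k)
  show ?case
  proof (rule diffk_SucI[OF assms(1)])
    show "\<exists>h. diffk k S h \<and> (\<forall>x\<in>S. partial i (\<lambda>x. f x + g x) x = h x)" for i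
      using Suc by (intro exI[of _ "\<lambda>x. partial i f x + partial i g x"]) (auto simp: partial_add)
  qed (use Suc in auto)
qed auto

lemma diffk_bounded_linear:
  assumes "open S" "bounded_linear L" "diffk k S f" shows "diffk k S (\<lambda>x. L (f x))"
  using assms(3)
proof (induction k arbitrary: f)
  case (Suc k)
  show ?case
  proof (rule diffk_SucI[OF assms(1)])
    show "\<exists>h. diffk k S h \<and> (\<forall>x\<in>S. partial i (\<lambda>x. L (f x)) x = h x)" for i
      using Suc partial_bounded_linear[OF assms(2), of f]
      by (intro exI[of _ "\<lambda>x. L (partial i f x)"]) auto
  qed (use Suc differentiable_bounded_linear[OF assms(2)] in auto)
qed (use differentiable_bounded_linear[OF assms(2)] in auto)

lemma diffk_bounded_bilinear:
  assumes "open S" "bounded_bilinear h" "diffk k S f" "diffk k S g"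
  shows "diffk k S (\<lambda>x. h (f x) (g x))"
  using assms(3,4)
proof (induction k arbitrary: f g)
  case 0
  then show ?case using differentiable_bounded_bilinear[OF assms(2), of f _ g] by auto
next
  case (Suc k)
  show ?case
  proof (rule diffk_SucI[OF assms(1)])
    show "\<exists>H. diffk k S H \<and> (\<forall>x\<in>S. partial i (\<lambda>x. h (f x) (g x)) x = H x)" for i
      using Suc partial_bounded_bilinear[OF assms(2), of f _ g] diffk_Suc_imp[of k S f] diffk_Suc_imp[of k S g]
      by (intro exI[of _ "\<lambda>x. h (f x) (partial i g x) + h (partial i f x) (g x)"])
         (auto intro!: diffk_add assms(1))
  qed (use Suc differentiable_bounded_bilinear[OF assms(2), of f _ g] in auto)
qed

lemma diffk_sum:
  assumes "open S" "\<And>a. a \<in> A \<Longrightarrow> diffk k S (f a)" shows "diffk k S (\<lambda>x. \<Sum>a\<in>A. f a x)"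
  using assms(2) by (induction A rule: infinite_finite_induct) (auto intro: diffk_const diffk_add assms(1))

lemma rvec_sum_axis: "(v::('d::finite) rvec) = (\<Sum>j\<in>UNIV. v $ j *\<^sub>R axis j 1)"
  by (simp add: vec_eq_iff axis_def if_distrib sum.delta cong: if_cong)

lemma frechet_derivative_partial:
  assumes "f differentiable (at x)"
  shows "frechet_derivative f (at x) v = (\<Sum>j\<in>UNIV. v $ j *\<^sub>R partial j f x)"
proof -
  interpret linear "frechet_derivative f (at x)" by (rule linear_frechet_derivative[OF assms])
  show ?thesis by (subst rvec_sum_axis[of v]) (simp add: sum scaleR partial_def)
qed

lemma partial_compose:
  fixes f :: "('d::finite) rvec \<Rightarrow> 'b::real_normed_vector" and \<phi> :: "('e::finite) rvec \<Rightarrow> 'd rvec"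
  assumes "\<phi> differentiable (at x)" "f differentiable (at (\<phi> x))"
  shows "partial i (\<lambda>x. f (\<phi> x)) x = (\<Sum>j\<in>UNIV. partial i \<phi> x $ j *\<^sub>R partial j f (\<phi> x))"
  using has_derivative_compose[OF assms[THEN has_derivative_frechet]]
  by (subst partial_eqI, assumption)
     (simp only: frechet_derivative_partial[OF assms(2)] partial_def[of _ \<phi>, symmetric])

lemma differentiable_compose_at:
  assumes "\<phi> differentiable (at x)" "f differentiable (at (\<phi> x))"
  shows "(\<lambda>x. f (\<phi> x)) differentiable (at x)"
  using has_derivative_compose[OF assms[THEN has_derivative_frechet]] unfolding differentiable_def by blast

lemma diffk_compose:
  fixes f :: "('d::finite) rvec \<Rightarrow> 'b::real_normed_vector" and \<phi> :: "('e::finite) rvec \<Rightarrow> 'd rvec"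
  assumes "open S" "diffk k S \<phi>" "diffk k T f" "\<phi> ` S \<subseteq> T"
  shows "diffk k S (\<lambda>x. f (\<phi> x))"
  using assms(2,3)
proof (induction k arbitrary: f)
  case 0
  then show ?case using assms(4) differentiable_compose_at[of \<phi> _ f] by auto
next
  case (Suc k)
  note d = Suc.prems[THEN diffk_differentiable]
  show ?case
  proof (rule diffk_SucI[OF assms(1)])
    show "(\<lambda>x. f (\<phi> x)) differentiable at x" if "x \<in> S" for x
      using that assms(4) d differentiable_compose_at[of \<phi> _ f] by auto
    show "\<exists>h. diffk k S h \<and> (\<forall>x\<in>S. partial i (\<lambda>x. f (\<phi> x)) x = h x)" for i
    proof (intro exI conjI ballI)
      show "diffk k S (\<lambda>x. \<Sum>j\<in>UNIV. partial i \<phi> x $ j *\<^sub>R partial j f (\<phi> x))"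
        using Suc.prems Suc.IH[OF diffk_Suc_imp]
        by (intro diffk_sum assms(1) diffk_bounded_bilinear[OF assms(1) bounded_bilinear_scaleR]
             diffk_bounded_linear[OF assms(1) bounded_linear_vec_nth]) auto
      show "x \<in> S \<Longrightarrow> partial i (\<lambda>x. f (\<phi> x)) x = (\<Sum>j\<in>UNIV. partial i \<phi> x $ j *\<^sub>R partial j f (\<phi> x))" for x
        using assms(4) d by (intro partial_compose) auto
    qed
  qed
qed

lemma diffk_inverse:
  fixes f :: "('d::finite) rvec \<Rightarrow> 'b::real_normed_field"
  assumes "open S" "diffk k S f" "\<And>x. x \<in> S \<Longrightarrow> f x \<noteq> 0"
  shows "diffk k S (\<lambda>x. inverse (f x))"
  using assms(2)
proof (induction k)
  case 0
  then show ?case using assms(3) by (auto intro: differentiable_inverse)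
next
  case (Suc k)
  note d = Suc.prems[THEN diffk_differentiable]
  show ?case
  proof (rule diffk_SucI[OF assms(1)])
    show "\<exists>h. diffk k S h \<and> (\<forall>x\<in>S. partial i (\<lambda>x. inverse (f x)) x = h x)" for i
    proof (intro exI conjI ballI)
      show "diffk k S (\<lambda>x. - (inverse (f x) * partial i f x * inverse (f x)))"
        using Suc diffk_Suc_imp[OF Suc.prems]
        by (intro diffk_bounded_linear[OF assms(1) bounded_linear_minus[OF bounded_linear_ident]]
              diffk_bounded_bilinear[OF assms(1) bounded_bilinear_mult]) auto
      show "partial i (\<lambda>x. inverse (f x)) x = - (inverse (f x) * partial i f x * inverse (f x))" if "x \<in> S" for x
        using Deriv.has_derivative_inverse[OF assms(3)[OF that] has_derivative_frechet[OF d[OF that]]]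
        by (subst partial_eqI) (auto simp: partial_def)
    qed
  qed (use assms(3) d in \<open>auto intro: differentiable_inverse\<close>)
qed

context
  fixes S :: "(('d::finite) rvec) set" assumes S: "open S"
begin

lemma smooth_on_const [intro]: "smooth_on S (\<lambda>x. c)"
  by (simp add: smooth_on_iff_diffk diffk_const)

lemma smooth_on_add [intro]: "smooth_on S f \<Longrightarrow> smooth_on S g \<Longrightarrow> smooth_on S (\<lambda>x. f x + g x)"
  by (simp add: smooth_on_iff_diffk diffk_add S)

lemma smooth_on_bounded_linear: "bounded_linear L \<Longrightarrow> smooth_on S f \<Longrightarrow> smooth_on S (\<lambda>x. L (f x))"
  by (simp add: smooth_on_iff_diffk diffk_bounded_linear S)

lemma smooth_on_minus [intro]: "smooth_on S f \<Longrightarrow> smooth_on S (\<lambda>x. - f x)"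
  by (rule smooth_on_bounded_linear[OF bounded_linear_minus[OF bounded_linear_ident]])

lemma smooth_on_diff [intro]: "smooth_on S f \<Longrightarrow> smooth_on S g \<Longrightarrow> smooth_on S (\<lambda>x. f x - g x)"
  using smooth_on_add[of f "\<lambda>x. - g x"] by auto

lemma smooth_on_sum [intro]: "(\<And>a. a \<in> A \<Longrightarrow> smooth_on S (f a)) \<Longrightarrow> smooth_on S (\<lambda>x. \<Sum>a\<in>A. f a x)"
  by (simp add: smooth_on_iff_diffk diffk_sum S)

lemma smooth_on_bilinear:
  "bounded_bilinear h \<Longrightarrow> smooth_on S f \<Longrightarrow> smooth_on S g \<Longrightarrow> smooth_on S (\<lambda>x. h (f x) (g x))"
  by (simp add: smooth_on_iff_diffk diffk_bounded_bilinear S)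

lemma smooth_on_scaleR [intro]: "smooth_on S f \<Longrightarrow> smooth_on S g \<Longrightarrow> smooth_on S (\<lambda>x. f x *\<^sub>R g x)"
  by (rule smooth_on_bilinear[OF bounded_bilinear_scaleR])

lemma smooth_on_mult [intro]:
  fixes f g :: "'d rvec \<Rightarrow> 'b::real_normed_algebra"
  shows "smooth_on S f \<Longrightarrow> smooth_on S g \<Longrightarrow> smooth_on S (\<lambda>x. f x * g x)"
  by (rule smooth_on_bilinear[OF bounded_bilinear_mult])

lemma smooth_on_prod [intro]:
  fixes f :: "'a \<Rightarrow> 'd rvec \<Rightarrow> 'b::{real_normed_algebra,comm_ring_1}"
  shows "(\<And>a. a \<in> A \<Longrightarrow> smooth_on S (f a)) \<Longrightarrow> smooth_on S (\<lambda>x. \<Prod>a\<in>A. f a x)"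
  by (induction A rule: infinite_finite_induct) auto

lemma smooth_on_power [intro]:
  fixes f :: "'d rvec \<Rightarrow> 'b::{real_normed_algebra_1}"
  shows "smooth_on S f \<Longrightarrow> smooth_on S (\<lambda>x. f x ^ n)"
  by (induction n) auto

lemma smooth_on_inverse [intro]:
  fixes f :: "'d rvec \<Rightarrow> 'b::real_normed_field"
  shows "smooth_on S f \<Longrightarrow> (\<And>x. x \<in> S \<Longrightarrow> f x \<noteq> 0) \<Longrightarrow> smooth_on S (\<lambda>x. inverse (f x))"
  by (simp add: smooth_on_iff_diffk diffk_inverse S)

lemma smooth_on_divide [intro]:
  fixes f :: "'d rvec \<Rightarrow> 'b::real_normed_field"
  shows "smooth_on S f \<Longrightarrow> smooth_on S g \<Longrightarrow> (\<And>x. x \<in> S \<Longrightarrow> g x \<noteq> 0) \<Longrightarrow> smooth_on S (\<lambda>x. f x / g x)"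
  unfolding divide_inverse by (intro smooth_on_mult smooth_on_inverse)

lemma smooth_on_of_real [intro]:
  "smooth_on S f \<Longrightarrow> smooth_on S (\<lambda>x. of_real (f x) :: 'b::real_normed_algebra_1)"
  by (rule smooth_on_bounded_linear[OF bounded_linear_of_real])

lemma smooth_on_compose:
  assumes "smooth_on S \<phi>" "smooth_on T f" "\<phi> ` S \<subseteq> T"
  shows "smooth_on S (\<lambda>x. f (\<phi> x))"
  using assms diffk_compose[OF S] unfolding smooth_on_iff_diffk by blast

lemma smooth_on_vec_nth [intro]: "smooth_on S f \<Longrightarrow> smooth_on S (\<lambda>x. f x $ i)"
  by (rule smooth_on_bounded_linear[OF bounded_linear_vec_nth])

lemma smooth_on_ident [intro]: "smooth_on S (\<lambda>x. x)"
proof -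
  have "diffk k S (\<lambda>x. x)" for k
  proof (cases k)
    case (Suc m)
    have "partial i (\<lambda>x. x) = (\<lambda>x::'d rvec. axis i 1)" for i
      by (rule ext, subst partial_eqI[OF has_derivative_ident]) simp
    then show ?thesis using Suc by (auto intro: diffk_const)
  qed auto
  then show ?thesis by (simp add: smooth_on_iff_diffk)
qed

lemma smooth_on_vecI:
  fixes f :: "'d rvec \<Rightarrow> ('b::euclidean_space, 'n::finite) vec"
  assumes "\<And>i. smooth_on S (\<lambda>x. f x $ i)" shows "smooth_on S f"
proof -
  have ax: "bounded_linear (axis i :: 'b \<Rightarrow> ('b, 'n) vec)" for i
    by (rule linear_conv_bounded_linear[THEN iffD1], rule linearI) (auto simp: axis_def vec_eq_iff)
  have "f = (\<lambda>x. \<Sum>i\<in>UNIV. axis i (f x $ i))"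
    by (auto simp: fun_eq_iff vec_eq_iff axis_def if_distrib sum.delta cong: if_cong)
  moreover have "smooth_on S (\<lambda>x. \<Sum>i\<in>UNIV. axis i (f x $ i))"
    by (intro smooth_on_sum smooth_on_bounded_linear[OF ax] assms)
  ultimately show ?thesis by simp
qed

end

lemma smooth_on_vec_lambda:
  fixes f :: "('n::finite) \<Rightarrow> ('d::finite) rvec \<Rightarrow> 'b::euclidean_space"
  assumes "open S" "\<And>i. smooth_on S (f i)" shows "smooth_on S (\<lambda>x. \<chi> i. f i x)"
  by (rule smooth_on_vecI[OF assms(1)]) (simp add: assms(2))

lemma smooth_on_scale [intro]:
  fixes f :: "('d::finite) rvec \<Rightarrow> complex"
  assumes "open S" "smooth_on S f" "smooth_on S g"
  shows "smooth_on S (\<lambda>x. f x *s (g x :: (complex, 'n::finite) vec))"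
  by (rule smooth_on_vecI[OF assms(1)]) (auto intro!: assms smooth_on_mult smooth_on_vec_nth)

lemma smooth_on_det:
  fixes M :: "('d::finite) rvec \<Rightarrow> ((real, 'n::finite) vec, 'n) vec"
  assumes "open S" "smooth_on S M" shows "smooth_on S (\<lambda>x. det (M x))"
  unfolding det_def using assms by (intro smooth_on_sum smooth_on_mult smooth_on_prod smooth_on_vec_nth smooth_on_const)

lemma matrix_inv:
  assumes "invertible A" shows matrix_inv_right: "A ** matrix_inv A = mat 1"
    and matrix_inv_left: "matrix_inv A ** A = mat 1"
  using someI_ex[OF assms[unfolded invertible_def]] by (auto simp: matrix_inv_def)

text \<open>Cramer's rule writes the entries of the inverse as quotients of determinants.\<close>

lemma smooth_on_matrix_inv:
  fixes M :: "('d::finite) rvec \<Rightarrow> ((real, 'n::finite) vec, 'n) vec"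
  assumes "open S" "smooth_on S M" "\<And>x. x \<in> S \<Longrightarrow> invertible (M x)"
  shows "smooth_on S (\<lambda>x. matrix_inv (M x))"
proof -
  define N where "N x = (\<chi> k l. det (\<chi> i j. if j = k then axis l 1 $ i else M x $ i $ j) / det (M x))" for x
  have "smooth_on S N"
  proof -
    have *: "smooth_on S (\<lambda>x. (\<chi> i j. if j = k then axis l 1 $ i else M x $ i $ j) :: real^'n^'n)" for k l
      apply (intro smooth_on_vecI[OF assms(1)])
      subgoal for i j by (cases "j = k") (auto intro!: assms smooth_on_vec_nth smooth_on_const)
      done
    show ?thesis unfolding N_def
      by (intro smooth_on_vec_lambda smooth_on_divide smooth_on_det assms * )
        (use assms(3) invertible_det_nz in blast)
  qed
  moreover have "N x = matrix_inv (M x)" if "x \<in> S" for x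
  proof -
    have inv: "invertible (M x)" and d: "det (M x) \<noteq> 0"
      using assms(3)[OF that] by (auto simp: invertible_det_nz)
    have "M x *v (matrix_inv (M x) *v axis l 1) = axis l 1" for l
      by (simp add: matrix_vector_mul_assoc matrix_inv_right[OF inv])
    then have "matrix_inv (M x) *v axis l 1 = (\<chi> k. N x $ k $ l)" for l
      using cramer[OF d] unfolding N_def by (simp only: vec_lambda_beta)
    then have "column l (matrix_inv (M x)) = (\<chi> k. N x $ k $ l)" for l
      by (simp only: matrix_vector_mult_basis)
    then show ?thesis by (simp add: vec_eq_iff column_def)
  qed
  ultimately show ?thesis using smooth_on_cong[OF assms(1), of N "\<lambda>x. matrix_inv (M x)"] by simp
qed

subsection \<open>Symmetry of second partial derivatives\<close>

lemma has_real_derivative_along_axis: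
  fixes f :: "('d::finite) rvec \<Rightarrow> real"
  assumes "f differentiable (at (z + t *\<^sub>R axis i 1))"
  shows "((\<lambda>t. f (z + t *\<^sub>R axis i 1)) has_real_derivative partial i f (z + t *\<^sub>R axis i 1)) (at t)"
proof -
  have "((\<lambda>t. z + t *\<^sub>R axis i 1) has_derivative (\<lambda>t. t *\<^sub>R axis i 1)) (at t)"
    by (auto intro!: derivative_eq_intros)
  from has_derivative_compose[OF this has_derivative_frechet[OF assms]]
  have "((\<lambda>t. f (z + t *\<^sub>R axis i 1)) has_derivative
          (\<lambda>s. frechet_derivative f (at (z + t *\<^sub>R axis i 1)) (s *\<^sub>R axis i 1))) (at t)" .
  moreover have "frechet_derivative f (at (z + t *\<^sub>R axis i 1)) (s *\<^sub>R axis i 1)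
      = s * partial i f (z + t *\<^sub>R axis i 1)" for s
    using linear_frechet_derivative[OF assms] by (simp add: linear_cmul partial_def)
  ultimately show ?thesis by (simp add: has_field_derivative_def mult.commute[of _ "partial i f _"])
qed

text \<open>The mean value theorem in direction \<open>i\<close>, followed by the differentiability of \<open>\<partial>\<^sub>i f\<close> at \<open>x\<close>,
  shows that the second difference quotient of \<open>f\<close> at \<open>x\<close> tends to \<open>\<partial>\<^sub>j \<partial>\<^sub>i f\<close>; but this quotient is
  symmetric in \<open>i\<close> and \<open>j\<close>.\<close>

lemma second_difference_estimate:
  fixes f :: "('d::finite) rvec \<Rightarrow> real"
  assumes S: "open S" "x \<in> S" and f: "\<And>z. z \<in> S \<Longrightarrow> f differentiable (at z)"
    and pf: "partial i f differentiable (at x)" and e: "\<epsilon> > 0"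
  shows "\<exists>\<delta>>0. \<forall>h. 0 < h \<longrightarrow> h < \<delta> \<longrightarrow>
    \<bar>f (x + h *\<^sub>R axis i 1 + h *\<^sub>R axis j 1) - f (x + h *\<^sub>R axis i 1) - f (x + h *\<^sub>R axis j 1) + f x
       - h\<^sup>2 * partial j (partial i f) x\<bar> \<le> \<epsilon> * h\<^sup>2"
proof -
  define D where "D = frechet_derivative (partial i f) (at x)"
  have D: "(partial i f has_derivative D) (at x)"
    unfolding D_def by (rule has_derivative_frechet[OF pf])
  then interpret D: bounded_linear D by (rule has_derivative_bounded_linear)
  have Dj: "D (axis j 1) = partial j (partial i f) x" by (simp add: D_def partial_def)
  obtain r where r: "r > 0" "ball x r \<subseteq> S" using S openE by blast
  obtain d where d: "d > 0" "\<And>y. norm (y - x) < d \<Longrightarrow>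
      \<bar>partial i f y - partial i f x - D (y - x)\<bar> \<le> (\<epsilon> / 3) * norm (y - x)"
    using has_derivative_at_alt[THEN iffD1, OF D] e
    by (metis real_norm_def zero_less_divide_iff zero_less_numeral)
  define \<delta> where "\<delta> = min r d / 2"
  have "\<delta> > 0" using r d by (simp add: \<delta>_def)
  moreover have "\<bar>f (x + h *\<^sub>R axis i 1 + h *\<^sub>R axis j 1) - f (x + h *\<^sub>R axis i 1) - f (x + h *\<^sub>R axis j 1) + f x
       - h\<^sup>2 * partial j (partial i f) x\<bar> \<le> \<epsilon> * h\<^sup>2" if h: "0 < h" "h < \<delta>" for h
  proof -
    have n1: "norm (t *\<^sub>R axis i 1 + h *\<^sub>R axis j 1 :: 'd rvec) \<le> 2 * h" if "0 \<le> t" "t \<le> h" for t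
      using norm_triangle_ineq[of "t *\<^sub>R axis i 1 :: 'd rvec" "h *\<^sub>R axis j 1"] that h by simp
    have n2: "norm (t *\<^sub>R axis i 1 :: 'd rvec) \<le> h" if "0 \<le> t" "t \<le> h" for t
      using that h by simp
    have hr: "2 * h < r" "2 * h < d" using h by (auto simp: \<delta>_def)
    define \<phi> where "\<phi> t = f ((x + h *\<^sub>R axis j 1) + t *\<^sub>R axis i 1) - f (x + t *\<^sub>R axis i 1)" for t
    have in1: "(x + h *\<^sub>R axis j 1) + t *\<^sub>R axis i 1 \<in> S" if "0 \<le> t" "t \<le> h" for t
      using n1[OF that] hr r by (auto simp: subset_eq dist_norm algebra_simps norm_minus_commute)
    have in2: "x + t *\<^sub>R axis i 1 \<in> S" if "0 \<le> t" "t \<le> h" for t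
      using n2[OF that] hr r h that by (auto simp: subset_eq dist_norm algebra_simps)
    have deriv: "(\<phi> has_real_derivative
         (partial i f ((x + h *\<^sub>R axis j 1) + t *\<^sub>R axis i 1) - partial i f (x + t *\<^sub>R axis i 1))) (at t)"
      if "0 \<le> t" "t \<le> h" for t
      unfolding \<phi>_def
      by (intro DERIV_diff has_real_derivative_along_axis f in1 in2 that)
    obtain t where t: "0 < t" "t < h" "\<phi> h - \<phi> 0 = (h - 0) *
        (partial i f ((x + h *\<^sub>R axis j 1) + t *\<^sub>R axis i 1) - partial i f (x + t *\<^sub>R axis i 1))"
      using MVT2[OF h(1), of \<phi>, OF deriv] by auto
    let ?y = "(x + h *\<^sub>R axis j 1) + t *\<^sub>R axis i 1" and ?z = "x + t *\<^sub>R axis i 1"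
    have a1: "\<bar>partial i f ?y - partial i f x - D (?y - x)\<bar> \<le> (\<epsilon> / 3) * (2 * h)"
    proof -
      have "norm (?y - x) \<le> 2 * h" using n1[of t] t by (simp add: algebra_simps)
      then show ?thesis using d(2)[of ?y] hr e
        by (smt (verit, best) divide_pos_pos mult_left_mono)
    qed
    have a2: "\<bar>partial i f ?z - partial i f x - D (?z - x)\<bar> \<le> (\<epsilon> / 3) * h"
    proof -
      have "norm (?z - x) \<le> h" using n2[of t] t by (simp add: algebra_simps)
      then show ?thesis using d(2)[of ?z] hr e h
        by (smt (verit, best) divide_pos_pos mult_left_mono)
    qed
    have "D (?y - x) - D (?z - x) = h * D (axis j 1)"
      by (simp add: D.diff[symmetric] D.scaleR[symmetric] del: real_scaleR_def) (simp add: D.scaleR)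
    then have "\<bar>(partial i f ?y - partial i f ?z) - h * D (axis j 1)\<bar> \<le> \<epsilon> * h"
    proof -
      have "\<bar>A - B - c\<bar> \<le> a + b" if "\<bar>A - P - U\<bar> \<le> a" "\<bar>B - P - W\<bar> \<le> b" "U - W = c"
        for A B P U W a b c :: real using that by linarith
      from this[OF a1 a2] \<open>D (?y - x) - D (?z - x) = h * D (axis j 1)\<close> show ?thesis by fastforce
    qed
    then have "h * \<bar>(partial i f ?y - partial i f ?z) - h * D (axis j 1)\<bar> \<le> h * (\<epsilon> * h)"
      using h by (intro mult_left_mono) auto
    then have "\<bar>\<phi> h - \<phi> 0 - h\<^sup>2 * D (axis j 1)\<bar> \<le> \<epsilon> * h\<^sup>2"
      using t(3) h by (simp add: abs_mult_pos' power2_eq_square algebra_simps)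
    then show ?thesis by (simp add: \<phi>_def Dj algebra_simps)
  qed
  ultimately show ?thesis by blast
qed

lemma partial_commute_real:
  fixes f :: "('d::finite) rvec \<Rightarrow> real"
  assumes S: "open S" "x \<in> S" and f: "diffk 1 S f"
  shows "partial i (partial j f) x = partial j (partial i f) x"
proof (rule ccontr)
  let ?a = "partial i (partial j f) x" and ?b = "partial j (partial i f) x"
  assume ne: "?a \<noteq> ?b"
  \<comment> \<open>The two estimates allow a deviation of twice this value, which is less than the distance.\<close>
  define \<epsilon> where "\<epsilon> = \<bar>?a - ?b\<bar> / 3"
  have e: "\<epsilon> > 0" using ne by (simp add: \<epsilon>_def)
  have df: "\<And>z. z \<in> S \<Longrightarrow> f differentiable (at z)" "\<And>i. partial i f differentiable (at x)"
    using f S by auto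
  obtain d1 where d1: "d1 > 0" "\<And>h. 0 < h \<Longrightarrow> h < d1 \<Longrightarrow>
    \<bar>f (x + h *\<^sub>R axis i 1 + h *\<^sub>R axis j 1) - f (x + h *\<^sub>R axis i 1) - f (x + h *\<^sub>R axis j 1) + f x - h\<^sup>2 * ?b\<bar> \<le> \<epsilon> * h\<^sup>2"
    using second_difference_estimate[OF S df e, of i j] by blast
  obtain d2 where d2: "d2 > 0" "\<And>h. 0 < h \<Longrightarrow> h < d2 \<Longrightarrow>
    \<bar>f (x + h *\<^sub>R axis j 1 + h *\<^sub>R axis i 1) - f (x + h *\<^sub>R axis j 1) - f (x + h *\<^sub>R axis i 1) + f x - h\<^sup>2 * ?a\<bar> \<le> \<epsilon> * h\<^sup>2"
    using second_difference_estimate[OF S df e, of j i] by blast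
  define h where "h = min d1 d2 / 2"
  have h: "0 < h" "h < d1" "h < d2" using d1(1) d2(1) by (auto simp: h_def)
  have "\<bar>h\<^sup>2 * ?a - h\<^sup>2 * ?b\<bar> \<le> 2 * (\<epsilon> * h\<^sup>2)"
    using d1(2)[OF h(1,2)] d2(2)[OF h(1,3)] by (simp add: algebra_simps abs_le_iff)
  then have "h\<^sup>2 * \<bar>?a - ?b\<bar> \<le> h\<^sup>2 * (2 * \<epsilon>)"
    by (simp add: abs_mult right_diff_distrib[symmetric] mult_ac)
  then have "\<bar>?a - ?b\<bar> \<le> 2 * \<epsilon>" using h by (simp add: mult_le_cancel_left)
  then show False using e by (simp add: \<epsilon>_def)
qed

lemma partial_commute:
  fixes f :: "('d::finite) rvec \<Rightarrow> 'b::euclidean_space"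
  assumes S: "open S" "x \<in> S" and f: "smooth_on S f"
  shows "partial i (partial j f) x = partial j (partial i f) x"
proof (rule euclidean_eqI)
  fix b :: 'b
  have bl: "bounded_linear (\<lambda>v. v \<bullet> b)" by (rule bounded_linear_inner_left)
  have inner: "partial i (\<lambda>x. g x \<bullet> b) z = partial i g z \<bullet> b" if "smooth_on S g" "z \<in> S" for g i z
    by (rule partial_bounded_linear[OF bl smooth_on_differentiable[OF that]])
  have "partial i (partial j f) x \<bullet> b = partial i (partial j (\<lambda>x. f x \<bullet> b)) x" for i j
    using partial_cong[OF S, of "partial j (\<lambda>x. f x \<bullet> b)" "\<lambda>z. partial j f z \<bullet> b" i]
      inner[OF f] inner[OF smooth_on_partial[OF f] S(2)] by simp
  moreover have "diffk 1 S (\<lambda>x. f x \<bullet> b)"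
    using smooth_on_bounded_linear[OF S(1) bl f] by (simp add: smooth_on_iff_diffk)
  ultimately show "partial i (partial j f) x \<bullet> b = partial j (partial i f) x \<bullet> b"
    using partial_commute_real[OF S] by metis
qed

subsection \<open>Iterated partial derivatives\<close>

text \<open>Partial derivatives along a multi-index are taken in increasing order of the coordinates; by
  symmetry a further derivative may be sorted into its place.\<close>

lemma foldr_partial_insort:
  fixes w :: "('d::{finite,linorder}) rvec \<Rightarrow> 'b::euclidean_space"
  assumes S: "open S" and w: "smooth_on S w"
  shows "x \<in> S \<Longrightarrow> foldr partial (insort j is) w x = partial j (foldr partial is w) x"
proof (induction "is" arbitrary: x)
  case (Cons i "is")
  show ?case
  proof (cases "j \<le> i")
    case False
    then have "foldr partial (insort j (i # is)) w x = partial i (foldr partial (insort j is) w) x"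
      by simp
    also have "\<dots> = partial i (partial j (foldr partial is w)) x"
      by (rule partial_cong[OF S Cons.prems]) (rule Cons.IH)
    also have "\<dots> = partial j (partial i (foldr partial is w)) x"
      by (rule partial_commute[OF S Cons.prems smooth_on_foldr_partial[OF w]])
    finally show ?thesis by simp
  qed simp
qed simp

lemma mpartial_add_mset:
  fixes w :: "('d::{finite,linorder}) rvec \<Rightarrow> 'b::euclidean_space"
  assumes "open S" "smooth_on S w" "x \<in> S"
  shows "mpartial (add_mset j \<alpha>) w x = partial j (mpartial \<alpha> w) x"
  using foldr_partial_insort[OF assms] by (simp add: mpartial_def)

lemma mpartial_empty [simp]: "mpartial {#} w = w"
  by (simp add: mpartial_def)

lemma smooth_on_mpartial: "smooth_on S w \<Longrightarrow> smooth_on S (mpartial \<alpha> w)"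
  unfolding mpartial_def by (rule smooth_on_foldr_partial)

lemma mpartial_cong:
  "open S \<Longrightarrow> (\<And>z. z \<in> S \<Longrightarrow> f z = g z) \<Longrightarrow> x \<in> S \<Longrightarrow> mpartial \<alpha> f x = mpartial \<alpha> g x"
  unfolding mpartial_def by (rule foldr_partial_cong)

lemma mpartial_add:
  assumes S: "open S" "smooth_on S f" "smooth_on S g" and x: "x \<in> S"
  shows "mpartial \<alpha> (\<lambda>x. f x + g x) x = mpartial \<alpha> f x + mpartial \<alpha> g x"
proof -
  have "foldr partial is (\<lambda>x. f x + g x) x = foldr partial is f x + foldr partial is g x" for "is"
    using x
  proof (induction "is" arbitrary: x)
    case (Cons i "is")
    have "foldr partial (i # is) (\<lambda>x. f x + g x) x = partial i (\<lambda>x. foldr partial is f x + foldr partial is g x) x"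
      using partial_cong[OF S(1) Cons.prems, of "foldr partial is (\<lambda>x. f x + g x)"] Cons.IH by simp
    then show ?case
      using partial_add[OF S(2,3)[THEN smooth_on_foldr_partial, THEN smooth_on_differentiable, OF Cons.prems], of _ "is" "is"]
      by simp
  qed simp
  then show ?thesis by (simp add: mpartial_def)
qed

lemma foldr_partial_bounded_linear:
  assumes L: "bounded_linear L" and S: "open S" "smooth_on S f"
  shows "x \<in> S \<Longrightarrow> foldr partial is (\<lambda>x. L (f x)) x = L (foldr partial is f x)"
proof (induction "is" arbitrary: x)
  case (Cons i "is")
  have "foldr partial (i # is) (\<lambda>x. L (f x)) x = partial i (\<lambda>x. L (foldr partial is f x)) x"
    using partial_cong[OF S(1) Cons.prems, of "foldr partial is (\<lambda>x. L (f x))"] Cons.IH by simp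
  then show ?case
    using partial_bounded_linear[OF L S(2)[THEN smooth_on_foldr_partial, THEN smooth_on_differentiable, OF Cons.prems], of _ "is"]
    by simp
qed simp

lemma mpartial_bounded_linear:
  "bounded_linear L \<Longrightarrow> open S \<Longrightarrow> smooth_on S f \<Longrightarrow> x \<in> S \<Longrightarrow>
    mpartial \<alpha> (\<lambda>x. L (f x)) x = L (mpartial \<alpha> f x)"
  unfolding mpartial_def by (rule foldr_partial_bounded_linear)

lemma foldr_partial_linear_power:
  fixes \<xi> :: "('d::finite) rvec"
  assumes "length is \<le> k"
  shows "foldr partial is (\<lambda>z. (\<xi> \<bullet> (z - y)) ^ k / fact k) =
     (\<lambda>z. prod_list (map (($) \<xi>) is) * ((\<xi> \<bullet> (z - y)) ^ (k - length is) / fact (k - length is)))"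
  using assms
proof (induction "is")
  case (Cons i "is")
  obtain m where m: "k - length is = Suc m" "k - length (i # is) = m"
    using Cons.prems by (metis Suc_diff_Suc Suc_le_lessD length_Cons)
  have "((\<lambda>z. prod_list (map (($) \<xi>) is) * ((\<xi> \<bullet> (z - y)) ^ Suc m / fact (Suc m))) has_derivative
      (\<lambda>h. prod_list (map (($) \<xi>) is) * ((\<xi> \<bullet> h) * (\<xi> \<bullet> (z - y)) ^ m / fact m))) (at z)" for z
  proof -
    have "((\<lambda>z. (\<xi> \<bullet> (z - y)) ^ Suc m) has_derivative
        (\<lambda>h. of_nat (Suc m) * (\<xi> \<bullet> h) * (\<xi> \<bullet> (z - y)) ^ (Suc m - 1))) (at z)"
      by (rule has_derivative_power) (auto intro!: derivative_eq_intros)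
    from has_derivative_mult_right[OF this, of "prod_list (map (($) \<xi>) is) / fact (Suc m)"]
    show ?thesis by (simp add: fact_Suc mult_ac del: power_Suc of_nat_Suc)
  qed
  from partial_eqI[OF this, of i] have
    "partial i (\<lambda>z. prod_list (map (($) \<xi>) is) * ((\<xi> \<bullet> (z - y)) ^ Suc m / fact (Suc m))) =
      (\<lambda>z. prod_list (map (($) \<xi>) is) * ((\<xi> \<bullet> axis i 1) * (\<xi> \<bullet> (z - y)) ^ m / fact m))"
    by (rule ext)
  then show ?case
    using Cons m by (simp only: foldr.simps o_def list.map prod_list.Cons m inner_axis) (simp add: m mult_ac)
qed simp

text \<open>Powers of a linear form are test functions for symbols: all derivatives at \<open>y\<close> of order less
  than \<open>k\<close> vanish, and those of order \<open>k\<close> are the monomials in \<open>\<xi>\<close>.\<close>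

lemma mpartial_linear_power:
  fixes \<xi> :: "('d::{finite,linorder}) rvec"
  assumes "size \<alpha> \<le> k"
  shows "mpartial \<alpha> (\<lambda>z. (\<xi> \<bullet> (z - y)) ^ k / fact k) y = (if size \<alpha> = k then mpower \<xi> \<alpha> else 0)"
proof -
  have len: "length (sorted_list_of_multiset \<alpha>) = size \<alpha>"
    by (metis mset_sorted_list_of_multiset size_mset)
  have pr: "prod_list (map (($) \<xi>) (sorted_list_of_multiset \<alpha>)) = mpower \<xi> \<alpha>"
    unfolding mpower_def by (metis mset_map mset_sorted_list_of_multiset prod_mset_prod_list)
  show ?thesis
    using foldr_partial_linear_power[of "sorted_list_of_multiset \<alpha>" k \<xi> y] assms
    by (auto simp: mpartial_def len pr power_0_left)
qed

subsection \<open>Cutoff functions\<close>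

text \<open>The functions \<open>x\<^sup>-\<^sup>k exp (-1/x)\<close>, extended by zero to \<open>x \<le> 0\<close>, are closed under taking
  derivatives up to linear combinations; this makes them smooth.\<close>

definition flat :: "nat \<Rightarrow> real \<Rightarrow> real" where
  "flat k x = (if x > 0 then exp (- 1 / x) / x ^ k else 0)"

text \<open>The exponential dominates the term of degree \<open>k + 2\<close> of its series at \<open>1/x\<close>. A quadratic bound is
  what the derivative at 0 needs.\<close>

lemma flat_le: assumes "x > 0" shows "flat k x \<le> fact (k + 2) * x\<^sup>2"
proof -
  have "(1 / x) ^ (k + 2) / fact (k + 2) \<le> exp (1 / x)"
  proof -
    obtain t where "exp (1 / x) = (\<Sum>m<k + 3. (1 / x) ^ m / fact m) + (exp t / fact (k + 3)) * (1 / x) ^ (k + 3)"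
      using Maclaurin_exp_le[of "1 / x" "k + 3"] by blast
    moreover have "(1 / x) ^ (k + 2) / fact (k + 2) \<le> (\<Sum>m<k + 3. (1 / x) ^ m / fact m)"
      using assms by (intro member_le_sum[of "k + 2"]) auto
    moreover have "0 \<le> (exp t / fact (k + 3)) * (1 / x) ^ (k + 3)" using assms by simp
    ultimately show ?thesis by linarith
  qed
  moreover have "(0::real) < fact (k + 2)" by (simp only: fact_gt_zero)
  ultimately obtain F :: real where F: "F = fact (k + 2)" "F > 0" "(1 / x) ^ (k + 2) / F \<le> exp (1 / x)"
    by blast
  have "1 \<le> F * x ^ (k + 2) * exp (1 / x)"
  proof -
    have "(1 / x) ^ (k + 2) * (F * x ^ (k + 2)) / F \<le> exp (1 / x) * (F * x ^ (k + 2))"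
      using mult_right_mono[OF F(3), of "F * x ^ (k + 2)"] F(2) assms by simp
    moreover have "(1 / x) ^ (k + 2) * (F * x ^ (k + 2)) / F = 1"
      using F(2) assms by (simp add: power_divide)
    ultimately show ?thesis by (simp add: mult_ac)
  qed
  then have "1 / exp (1 / x) \<le> F * x ^ (k + 2)"
    by (subst pos_divide_le_eq) auto
  then have "exp (- 1 / x) \<le> F * x ^ (k + 2)"
    by (simp add: exp_minus inverse_eq_divide)
  then have "exp (- 1 / x) / x ^ k \<le> F * x\<^sup>2"
    using assms by (simp add: power_add power2_eq_square divide_le_eq mult_ac)
  then show ?thesis using assms by (simp only: flat_def F(1) if_True)
qed

lemma flat_nonneg: "flat k x \<ge> 0" by (simp add: flat_def)

lemma flat_pos_iff: "flat k x > 0 \<longleftrightarrow> x > 0" by (simp add: flat_def)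

lemma flat_has_derivative: "(flat k has_real_derivative (flat (k + 2) x - real k * flat (k + 1) x)) (at x)"
proof (cases "x = 0")
  case True
  define F :: real where "F = fact (k + 2)"
  have F: "F > 0" by (simp only: F_def fact_gt_zero)
  have "((\<lambda>h. flat k h / h) \<longlongrightarrow> 0) (at 0)"
  proof (rule Lim_null_comparison)
    show "\<forall>\<^sub>F h in at 0. norm (flat k h / h) \<le> F * \<bar>h\<bar>"
    proof (rule eventually_mono[OF eventually_True])
      fix h :: real
      show "norm (flat k h / h) \<le> F * \<bar>h\<bar>"
      proof (cases "h > 0")
        case True
        then show ?thesis using flat_le[OF True, of k, folded F_def] flat_nonneg[of k h]
          by (simp add: divide_simps power2_eq_square mult_ac)
      qed (use F in \<open>auto simp: flat_def intro!: mult_nonneg_nonpos\<close>)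
    qed
    show "((\<lambda>h. F * \<bar>h\<bar>) \<longlongrightarrow> 0) (at 0)"
      by (auto intro!: tendsto_eq_intros)
  qed
  then show ?thesis using True by (simp add: DERIV_def flat_def)
next
  case False
  show ?thesis
  proof (cases "x > 0")
    case True
    have "((\<lambda>x. exp (- 1 / x) / x ^ k) has_real_derivative (flat (k + 2) x - real k * flat (k + 1) x)) (at x)"
    proof -
      have e: "((\<lambda>x. exp (- 1 / x)) has_real_derivative exp (- 1 / x) * (1 / x\<^sup>2)) (at x)"
        using True by (auto intro!: derivative_eq_intros simp: power2_eq_square)
      have p: "((\<lambda>x. x ^ k) has_real_derivative real k * x ^ (k - 1)) (at x)"
        by (auto intro!: derivative_eq_intros)
      have "x ^ k \<noteq> 0" using True by simp
      from DERIV_divide[OF e p this] show ?thesis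
        by (rule DERIV_cong) (use True in \<open>cases k; simp add: flat_def field_simps power2_eq_square power_add\<close>)
    qed
    then show ?thesis
      by (rule has_field_derivative_transform_within_open[of _ _ _ "{0<..}"]) (use True in \<open>auto simp: flat_def\<close>)
  next
    case neg: False
    have "((\<lambda>x. 0) has_real_derivative (flat (k + 2) x - real k * flat (k + 1) x)) (at x)"
      using neg by (simp add: flat_def)
    then show ?thesis
      by (rule has_field_derivative_transform_within_open[of _ _ _ "{..<0}"]) (use False neg in \<open>auto simp: flat_def\<close>)
  qed
qed

lemma smooth_on_flat:
  assumes S: "open S" and f: "smooth_on S f" shows "smooth_on S (\<lambda>x. flat k (f x))"
proof -
  have hd: "((\<lambda>x. flat k (f x)) has_derivative
     (\<lambda>h. (flat (k + 2) (f x) - real k * flat (k + 1) (f x)) * frechet_derivative f (at x) h)) (at x)" if "x \<in> S" for x k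
    using has_derivative_compose[OF has_derivative_frechet[OF smooth_on_differentiable[OF f that]]
       flat_has_derivative[of k "f x", unfolded has_field_derivative_def]] .
  have "diffk m S (\<lambda>x. flat k (f x))" for m
  proof (induction m arbitrary: k)
    case 0
    then show ?case using hd by (auto simp: differentiable_def)
  next
    case (Suc m)
    show ?case
    proof (rule diffk_SucI[OF S])
      show "x \<in> S \<Longrightarrow> (\<lambda>x. flat k (f x)) differentiable at x" for x using hd by (auto simp: differentiable_def)
      show "\<exists>h. diffk m S h \<and> (\<forall>x\<in>S. partial i (\<lambda>x. flat k (f x)) x = h x)" for i
      proof (intro exI conjI ballI)
        have "diffk m S (\<lambda>x. flat (k + 2) (f x) + (- real k) * flat (k + 1) (f x))"
          by (intro diffk_add diffk_bounded_bilinear[OF S bounded_bilinear_mult] diffk_const S Suc)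
        moreover have "diffk m S (partial i f)"
          using smooth_on_partial[OF f] by (simp add: smooth_on_iff_diffk)
        ultimately show "diffk m S (\<lambda>x. (flat (k + 2) (f x) + (- real k) * flat (k + 1) (f x)) * partial i f x)"
          by (rule diffk_bounded_bilinear[OF S bounded_bilinear_mult])
        show "x \<in> S \<Longrightarrow> partial i (\<lambda>x. flat k (f x)) x =
           (flat (k + 2) (f x) + (- real k) * flat (k + 1) (f x)) * partial i f x" for x
          using partial_eqI[OF hd] by (simp add: partial_def)
      qed
    qed
  qed
  then show ?thesis by (simp add: smooth_on_iff_diffk)
qed

text \<open>With \<open>a\<close> positive inside the ball of radius \<open>R\<close> and \<open>b\<close> positive outside the ball of radius \<open>R/2\<close>,
  the quotient \<open>flat a / (flat a + flat b)\<close> is 1 near the centre and vanishes far away.\<close>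

lemma smooth_cutoff:
  fixes y :: "('d::finite) rvec"
  assumes V: "open V" "y \<in> V"
  obtains \<beta> :: "'d rvec \<Rightarrow> real" and N K where "smooth_on UNIV \<beta>" "compact K" "K \<subseteq> V" "\<And>z. z \<notin> K \<Longrightarrow> \<beta> z = 0"
    "open N" "y \<in> N" "\<And>z. z \<in> N \<Longrightarrow> \<beta> z = 1"
proof -
  obtain R where R: "R > 0" "cball y R \<subseteq> V" using V open_contains_cball_eq by blast
  define a where "a z = R\<^sup>2 - (z - y) \<bullet> (z - y)" for z
  define b where "b z = (z - y) \<bullet> (z - y) - (R / 2)\<^sup>2" for z
  have q: "(z - y) \<bullet> (z - y) = (dist y z)\<^sup>2" for z
    by (simp add: dot_square_norm dist_norm norm_minus_commute)
  have pos: "flat 0 (a z) + flat 0 (b z) > 0" for z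
  proof -
    have "R\<^sup>2 - Q > 0 \<or> Q - R\<^sup>2 / 4 > 0" if "0 < R\<^sup>2" for Q using that by linarith
    then have "a z > 0 \<or> b z > 0" using R by (simp add: a_def b_def power_divide)
    then show ?thesis using flat_nonneg[of 0 "a z"] flat_nonneg[of 0 "b z"] flat_pos_iff[of 0] by (metis add_nonneg_pos add_pos_nonneg)
  qed
  define \<beta> where "\<beta> z = flat 0 (a z) / (flat 0 (a z) + flat 0 (b z))" for z
  have sq: "smooth_on UNIV (\<lambda>z. (z - y) \<bullet> (z - y))"
    unfolding inner_vec_def
    by (simp, intro smooth_on_sum smooth_on_mult open_UNIV) (auto intro!: smooth_on_diff smooth_on_vec_nth smooth_on_ident)
  show thesis
  proof
    show "smooth_on UNIV \<beta>"
      unfolding \<beta>_def using pos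
      by (intro smooth_on_divide smooth_on_add smooth_on_flat open_UNIV)
         (auto simp: a_def[abs_def] b_def[abs_def] less_le intro!: smooth_on_diff smooth_on_const sq)
    show "compact (cball y R)" "cball y R \<subseteq> V" using R by auto
    show "\<beta> z = 0" if "z \<notin> cball y R" for z
    proof -
      have "R\<^sup>2 < (dist y z)\<^sup>2" using that R by (intro power_strict_mono) auto
      then show ?thesis by (simp add: \<beta>_def flat_def a_def q)
    qed
    show "open (ball y (R / 2))" "y \<in> ball y (R / 2)" using R by auto
    show "\<beta> z = 1" if "z \<in> ball y (R / 2)" for z
    proof -
      have "(dist y z)\<^sup>2 < (R / 2)\<^sup>2" using that R by (intro power_strict_mono) auto
      then have "flat 0 (b z) = 0" by (simp add: flat_def b_def q)
      then show ?thesis using pos[of z] by (simp add: \<beta>_def)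
    qed
  qed
qed

section \<open>The exterior algebra\<close>

subsection \<open>Linear maps\<close>

abbreviation clin :: "((complex, 'a::finite) vec \<Rightarrow> (complex, 'b::finite) vec) \<Rightarrow> bool" where
  "clin \<equiv> Vector_Spaces.linear (*s) (*s)"

lemma clinI:
  assumes "\<And>v w. f (v + w) = f v + f w" "\<And>c v. f (c *s v) = c *s f v"
  shows "clin f"
  by (simp add: Vector_Spaces.linear_iff assms vec.vector_space_axioms)

lemma clin_add: "clin f \<Longrightarrow> f (v + w) = f v + f w"
  and clin_scale: "clin f \<Longrightarrow> f (c *s v) = c *s f v"
  by (simp_all add: Vector_Spaces.linear_iff)

lemma clin_zero: "clin f \<Longrightarrow> f 0 = 0"
  using clin_scale[of f 0 0] by simp

lemma clin_minus: "clin f \<Longrightarrow> f (- v) = - f v"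
  using clin_scale[of f "-1" v] by simp

lemma clin_diff: "clin f \<Longrightarrow> f (v - w) = f v - f w"
  using clin_add[of f v "-w"] clin_minus[of f w] by simp

lemma clin_sum: "clin f \<Longrightarrow> f (sum g A) = (\<Sum>a\<in>A. f (g a))"
  by (induction A rule: infinite_finite_induct) (simp_all add: clin_zero clin_add)

lemma clin_compose: "clin f \<Longrightarrow> clin g \<Longrightarrow> clin (\<lambda>v. f (g v))"
  by (rule clinI) (simp_all add: clin_add clin_scale)

lemma clin_ident: "clin (\<lambda>v. v)" by (rule clinI) simp_all

lemma clin_plus: "clin f \<Longrightarrow> clin g \<Longrightarrow> clin (\<lambda>v. f v + g v)"
  by (rule clinI) (simp_all add: clin_add clin_scale vector_add_ldistrib)

lemma clin_scaled: "clin f \<Longrightarrow> clin (\<lambda>v. c *s f v)"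
  by (rule clinI) (simp_all add: clin_add clin_scale vector_add_ldistrib vector_smult_assoc mult.commute)

lemma clin_summed: "(\<And>a. a \<in> A \<Longrightarrow> clin (f a)) \<Longrightarrow> clin (\<lambda>v. \<Sum>a\<in>A. f a v)"
  by (rule clinI) (simp_all add: clin_add clin_scale sum.distrib vec.scale_sum_right)

lemma vec_axis_expand: "(v :: (complex, 'a::finite) vec) = (\<Sum>I\<in>UNIV. v $ I *s axis I 1)"
  by (simp add: vec_eq_iff axis_def if_distrib sum.delta cong: if_cong)

lemma clin_expand: "clin f \<Longrightarrow> f v = (\<Sum>I\<in>UNIV. v $ I *s f (axis I 1))"
  by (subst vec_axis_expand[of v]) (simp add: clin_sum clin_scale)

lemma clin_eqI: "clin f \<Longrightarrow> clin g \<Longrightarrow> (\<And>I. f (axis I 1) = g (axis I 1)) \<Longrightarrow> f v = g v"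
  by (subst (1 2) clin_expand) auto

subsection \<open>Shuffle signs\<close>

lemma shuffle_sign_Un_left:
  assumes "I \<inter> M = {}" shows "shuffle_sign (I \<union> M) N = shuffle_sign I N * shuffle_sign M N"
proof -
  have "{(i, j). i \<in> I \<union> M \<and> j \<in> N \<and> j < i} = {(i, j). i \<in> I \<and> j \<in> N \<and> j < i} \<union> {(i, j). i \<in> M \<and> j \<in> N \<and> j < i}"
    by auto
  then have "card {(i, j). i \<in> I \<union> M \<and> j \<in> N \<and> j < i}
      = card {(i, j). i \<in> I \<and> j \<in> N \<and> j < i} + card {(i, j). i \<in> M \<and> j \<in> N \<and> j < i}"
    using assms by (simp only:, intro card_Un_disjoint) (auto intro: finite_subset[OF subset_UNIV])
  then show ?thesis by (simp add: shuffle_sign_def power_add)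
qed

lemma shuffle_sign_Un_right:
  assumes "M \<inter> N = {}" shows "shuffle_sign I (M \<union> N) = shuffle_sign I M * shuffle_sign I N"
proof -
  have "{(i, j). i \<in> I \<and> j \<in> M \<union> N \<and> j < i} = {(i, j). i \<in> I \<and> j \<in> M \<and> j < i} \<union> {(i, j). i \<in> I \<and> j \<in> N \<and> j < i}"
    by auto
  then have "card {(i, j). i \<in> I \<and> j \<in> M \<union> N \<and> j < i}
      = card {(i, j). i \<in> I \<and> j \<in> M \<and> j < i} + card {(i, j). i \<in> I \<and> j \<in> N \<and> j < i}"
    using assms by (simp only:, intro card_Un_disjoint) (auto intro: finite_subset[OF subset_UNIV])
  then show ?thesis by (simp add: shuffle_sign_def power_add)
qed

lemma shuffle_sign_empty [simp]: "shuffle_sign {} N = 1" "shuffle_sign N {} = 1"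
  by (simp_all add: shuffle_sign_def)

lemma shuffle_sign_square: "shuffle_sign I J * shuffle_sign I J = 1"
  by (simp add: shuffle_sign_def power_mult_distrib[symmetric])

lemma shuffle_sign_nonzero: "shuffle_sign I J \<noteq> 0"
  by (simp add: shuffle_sign_def)

lemma shuffle_sign_singletons: "shuffle_sign {i} {j} = (if j < i then -1 else 1)"
proof -
  have "{(a, b). a \<in> {i} \<and> b \<in> {j} \<and> b < a} = (if j < i then {(i, j)} else {})" by auto
  then show ?thesis by (simp add: shuffle_sign_def)
qed

lemma shuffle_sign_insert_left:
  "j \<notin> L \<Longrightarrow> shuffle_sign (insert j L) K = shuffle_sign {j} K * shuffle_sign L K"
  using shuffle_sign_Un_left[of "{j}" L K] by simp

lemma shuffle_sign_insert_right:
  "j \<notin> L \<Longrightarrow> shuffle_sign K (insert j L) = shuffle_sign K {j} * shuffle_sign K L"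
  using shuffle_sign_Un_right[of "{j}" L K] by simp

text \<open>Each pair in \<open>I \<times> J\<close> is an inversion in exactly one of the two orders.\<close>

lemma shuffle_sign_swap:
  assumes "I \<inter> J = {}" shows "shuffle_sign I J * shuffle_sign J I = (-1) ^ (card I * card J)"
proof -
  have "card I * card J = card (I \<times> J)" by (simp add: card_cartesian_product)
  also have "I \<times> J = {(i, j). i \<in> I \<and> j \<in> J \<and> j < i} \<union> prod.swap ` {(j, i). j \<in> J \<and> i \<in> I \<and> i < j}"
    using assms by (auto simp: image_iff)
  also have "card \<dots> = card {(i, j). i \<in> I \<and> j \<in> J \<and> j < i} + card (prod.swap ` {(j, i). j \<in> J \<and> i \<in> I \<and> i < j})"
    by (rule card_Un_disjoint) (auto intro: finite_subset[OF subset_UNIV])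
  also have "card (prod.swap ` {(j, i). j \<in> J \<and> i \<in> I \<and> i < j}) = card {(j, i). j \<in> J \<and> i \<in> I \<and> i < j}"
    by (rule card_image) (auto simp: inj_on_def)
  finally show ?thesis by (simp add: shuffle_sign_def power_add)
qed

subsection \<open>The wedge product\<close>

lemma wedge_add_left: "wedge (u + v) w = wedge u w + wedge v w"
  by (simp add: wedge_def vec_eq_iff sum.distrib[symmetric] algebra_simps)

lemma wedge_add_right: "wedge u (v + w) = wedge u v + wedge u w"
  by (simp add: wedge_def vec_eq_iff sum.distrib[symmetric] algebra_simps)

lemma wedge_scale_left: "wedge (c *s u) w = c *s wedge u w"
  by (simp add: wedge_def vec_eq_iff sum_distrib_left mult_ac)

lemma wedge_scale_right: "wedge u (c *s w) = c *s wedge u w"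
  by (simp add: wedge_def vec_eq_iff sum_distrib_left mult_ac)

lemma clin_wedge_left: "clin (\<lambda>u. wedge u w)"
  by (rule clinI) (simp_all add: wedge_add_left wedge_scale_left)

lemma clin_wedge_right: "clin (wedge u)"
  by (rule clinI) (simp_all add: wedge_add_right wedge_scale_right)

text \<open>Both sides are sums over the decompositions of \<open>K\<close> into three parts, and the signs agree because
  the numbers of inversions between the parts add up.\<close>

lemma wedge_assoc: "wedge (wedge u v) w = wedge u (wedge v w)"
proof -
  have "wedge (wedge u v) w $ K = wedge u (wedge v w) $ K" for K
  proof -
    let ?A = "SIGMA L:Pow K. Pow L" and ?B = "SIGMA I:Pow K. Pow (K - I)"
    have "wedge (wedge u v) w $ K =
       (\<Sum>L\<in>Pow K. \<Sum>I\<in>Pow L. shuffle_sign L (K - L) * (shuffle_sign I (L - I) * u $ I * v $ (L - I)) * w $ (K - L))"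
      by (simp add: wedge_def sum_distrib_left sum_distrib_right)
    also have "\<dots> = (\<Sum>(L, I)\<in>?A. shuffle_sign L (K - L) * (shuffle_sign I (L - I) * u $ I * v $ (L - I)) * w $ (K - L))"
      by (rule sum.Sigma) auto
    also have "\<dots> = (\<Sum>(I, M)\<in>?B. shuffle_sign I (K - I) * u $ I * (shuffle_sign M (K - I - M) * v $ M * w $ (K - I - M)))"
    proof (rule sum.reindex_bij_witness[of _ "\<lambda>(I, M). (I \<union> M, I)" "\<lambda>(L, I). (I, L - I)"], goal_cases)
      case (5 a)
      obtain L I where a: "a = (L, I)" "I \<subseteq> L" "L \<subseteq> K" using 5 by auto
      let ?M = "L - I" and ?N = "K - L"
      have eq: "L = I \<union> ?M" "K - I = ?M \<union> ?N" "K - I - ?M = ?N" using a by auto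
      have "shuffle_sign L ?N = shuffle_sign I ?N * shuffle_sign ?M ?N"
        by (subst eq(1), rule shuffle_sign_Un_left) auto
      moreover have "shuffle_sign I (K - I) = shuffle_sign I ?M * shuffle_sign I ?N"
        by (subst eq(2), rule shuffle_sign_Un_right) auto
      ultimately show ?case unfolding a by (simp only: split eq(3) mult_ac)
    qed auto
    also have "\<dots> = (\<Sum>I\<in>Pow K. \<Sum>M\<in>Pow (K - I). shuffle_sign I (K - I) * u $ I * (shuffle_sign M (K - I - M) * v $ M * w $ (K - I - M)))"
      by (rule sum.Sigma[symmetric]) auto
    also have "\<dots> = wedge u (wedge v w) $ K"
      by (simp add: wedge_def sum_distrib_left sum_distrib_right)
    finally show ?thesis .
  qed
  then show ?thesis by (simp add: vec_eq_iff)
qed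

lemma wedge_axis_left: "wedge (axis I 1) w $ K = (if I \<subseteq> K then shuffle_sign I (K - I) * w $ (K - I) else 0)"
proof -
  have "wedge (axis I 1) w $ K = (\<Sum>L\<in>Pow K. if L = I then shuffle_sign I (K - I) * w $ (K - I) else 0)"
    unfolding wedge_def vec_lambda_beta by (rule sum.cong) (auto simp: axis_def)
  then show ?thesis by (simp add: sum.delta)
qed

lemma wedge_one_left [simp]: "wedge (axis {} 1) w = w"
  by (simp add: vec_eq_iff wedge_axis_left)

lemma wedge_one_right [simp]: "wedge w (axis {} 1) = w"
proof -
  have "wedge w (axis {} 1) $ K = w $ K" for K
  proof -
    have "wedge w (axis {} 1) $ K = (\<Sum>L\<in>Pow K. if L = K then w $ K else 0)"
      unfolding wedge_def vec_lambda_beta by (rule sum.cong) (auto simp: axis_def)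
    then show ?thesis by (simp add: sum.delta)
  qed
  then show ?thesis by (simp add: vec_eq_iff)
qed

lemma wedge_list_Nil [simp]: "wedge_list [] = axis {} 1"
  and wedge_list_Cons [simp]: "wedge_list (v # vs) = wedge v (wedge_list vs)"
  by (simp_all add: wedge_list_def)

lemma wedge_list_append: "wedge_list (vs @ ws) = wedge (wedge_list vs) (wedge_list ws)"
  by (induction vs) (simp_all add: wedge_assoc)

subsection \<open>Exterior multiplication by covectors and contraction\<close>

definition emult :: "('d::{finite,linorder}) cvec \<Rightarrow> 'd ext \<Rightarrow> 'd ext" where
  "emult \<xi> v = wedge (covec \<xi>) v"

text \<open>The contraction with the vector \<open>\<eta>\<close>, which is the transpose of \<open>emult \<eta>\<close> with respect to the
  bilinear pairing of forms (\<open>pairing_emult_contract\<close>).\<close>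

definition contract :: "('d::{finite,linorder}) cvec \<Rightarrow> 'd ext \<Rightarrow> 'd ext" where
  "contract \<eta> v = (\<chi> K. \<Sum>i\<in>- K. shuffle_sign {i} K * \<eta> $ i * v $ insert i K)"

lemma covec_add: "covec (\<xi> + \<eta>) = covec \<xi> + covec \<eta>"
  by (simp add: covec_def vector_sadd_rdistrib sum.distrib)

lemma covec_scale: "covec (c *s \<xi>) = c *s covec \<xi>"
  by (simp add: covec_def vec.scale_sum_right)

lemma covec_axis: "covec (axis i 1) = axis {i} 1"
proof -
  have "covec (axis i 1) = (\<Sum>j\<in>UNIV. if j = i then axis {i} 1 else 0)"
    unfolding covec_def by (rule sum.cong) (auto simp: axis_def vec_eq_iff)
  then show ?thesis by (simp add: sum.delta)
qed

lemma clin_covec: "clin covec" by (rule clinI) (simp_all add: covec_add covec_scale)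

lemma clin_emult: "clin (emult \<xi>)"
  unfolding emult_def[abs_def] by (rule clin_wedge_right)

lemma emult_add_left: "emult (\<xi> + \<eta>) v = emult \<xi> v + emult \<eta> v"
  by (simp add: emult_def covec_add wedge_add_left)

lemma emult_scale_left: "emult (c *s \<xi>) v = c *s emult \<xi> v"
  by (simp add: emult_def covec_scale wedge_scale_left)

lemma clin_emult_left: "clin (\<lambda>\<xi>. emult \<xi> v)"
  by (rule clinI) (simp_all add: emult_add_left emult_scale_left)

lemma clin_contract: "clin (contract \<eta>)"
  by (rule clinI) (simp_all add: contract_def vec_eq_iff sum.distrib[symmetric] sum_distrib_left algebra_simps)

lemma clin_contract_left: "clin (\<lambda>\<eta>. contract \<eta> v)"
  by (rule clinI) (simp_all add: contract_def vec_eq_iff sum.distrib[symmetric] sum_distrib_left algebra_simps)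

lemma emult_axis: "emult (axis i 1) v $ K = (if i \<in> K then shuffle_sign {i} (K - {i}) * v $ (K - {i}) else 0)"
  by (simp add: emult_def covec_axis wedge_axis_left)

lemma contract_axis: "contract (axis j 1) v $ K = (if j \<in> K then 0 else shuffle_sign {j} K * v $ insert j K)"
proof -
  have "contract (axis j 1) v $ K = (\<Sum>i\<in>- K. if i = j then shuffle_sign {j} K * v $ insert j K else 0)"
    unfolding contract_def vec_lambda_beta by (rule sum.cong) (auto simp: axis_def)
  then show ?thesis by (simp add: sum.delta)
qed

text \<open>The relations of the Clifford algebra of \<open>V \<oplus> V\<^sup>*\<close>. For basis vectors they say how a shuffle
  sign changes when one index is moved past another.\<close>

lemma emult_anticommute: "emult \<xi> (emult \<eta> v) = - emult \<eta> (emult \<xi> v)"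
proof -
  have basis: "emult (axis i 1) (emult (axis j 1) v) = - emult (axis j 1) (emult (axis i 1) v)" for i j :: 'a
  proof (cases "i = j")
    case True
    then show ?thesis by (simp add: vec_eq_iff emult_axis)
  next
    case False
    have "shuffle_sign {i} (K - {i}) * shuffle_sign {j} (K - {i} - {j})
        = - (shuffle_sign {j} (K - {j}) * shuffle_sign {i} (K - {j} - {i}))" if "i \<in> K" "j \<in> K" for K
    proof -
      let ?L = "K - {i} - {j}"
      have e: "K - {i} = insert j ?L" "K - {j} = insert i ?L" "K - {j} - {i} = ?L" using that False by auto
      have "shuffle_sign {i} (K - {i}) = shuffle_sign {i} {j} * shuffle_sign {i} ?L"
        by (rule trans[OF arg_cong[OF e(1), of "shuffle_sign {i}"] shuffle_sign_insert_right]) simp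
      moreover have "shuffle_sign {j} (K - {j}) = shuffle_sign {j} {i} * shuffle_sign {j} ?L"
        by (rule trans[OF arg_cong[OF e(2), of "shuffle_sign {j}"] shuffle_sign_insert_right]) simp
      ultimately show ?thesis unfolding e(3)
        using False by (cases "i < j") (simp_all add: shuffle_sign_singletons)
    qed
    moreover have "K - {j} - {i} = K - {i} - {j}" for K by auto
    ultimately have "emult (axis i 1) (emult (axis j 1) v) $ K = - emult (axis j 1) (emult (axis i 1) v) $ K" for K
      using False by (cases "i \<in> K"; cases "j \<in> K") (simp_all add: emult_axis mult.assoc[symmetric])
    then show ?thesis by (simp add: vec_eq_iff)
  qed
  have step: "emult (axis i 1) (emult \<eta> v) = - emult \<eta> (emult (axis i 1) v)" for i
    by (rule clin_eqI[of "\<lambda>\<eta>. emult (axis i 1) (emult \<eta> v)" "\<lambda>\<eta>. - emult \<eta> (emult (axis i 1) v)"])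
      (auto intro!: basis clinI simp: emult_add_left emult_scale_left clin_add[OF clin_emult] clin_scale[OF clin_emult])
  show ?thesis
    by (rule clin_eqI[of "\<lambda>\<xi>. emult \<xi> (emult \<eta> v)" "\<lambda>\<xi>. - emult \<eta> (emult \<xi> v)"])
      (auto intro!: step clinI simp: emult_add_left emult_scale_left clin_add[OF clin_emult] clin_scale[OF clin_emult])
qed

lemma contract_anticommute: "contract \<xi> (contract \<eta> v) = - contract \<eta> (contract \<xi> v)"
proof -
  have basis: "contract (axis i 1) (contract (axis j 1) v) = - contract (axis j 1) (contract (axis i 1) v)" for i j :: 'a
  proof (cases "i = j")
    case True
    then show ?thesis by (simp add: vec_eq_iff contract_axis)
  next
    case False
    have "contract (axis i 1) (contract (axis j 1) v) $ K = - contract (axis j 1) (contract (axis i 1) v) $ K" for K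
    proof (cases "i \<in> K \<or> j \<in> K")
      case nin: False
      have "contract (axis i 1) (contract (axis j 1) v) $ K
          = shuffle_sign {i} K * (shuffle_sign {j} {i} * shuffle_sign {j} K * v $ insert i (insert j K))"
      proof -
        have "insert j (insert i K) = insert i (insert j K)" by auto
        then show ?thesis using False nin
          by (simp add: contract_axis shuffle_sign_insert_right[of i K "{j}"])
      qed
      moreover have "contract (axis j 1) (contract (axis i 1) v) $ K
          = shuffle_sign {j} K * (shuffle_sign {i} {j} * shuffle_sign {i} K * v $ insert i (insert j K))"
        using False nin by (simp add: contract_axis shuffle_sign_insert_right[of j K "{i}"])
      ultimately show ?thesis using False by (cases "i < j") (simp_all add: shuffle_sign_singletons)
    qed (auto simp: contract_axis)
    then show ?thesis by (simp add: vec_eq_iff)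
  qed
  have step: "contract (axis i 1) (contract \<eta> v) = - contract \<eta> (contract (axis i 1) v)" for i
    by (rule clin_eqI[of "\<lambda>\<eta>. contract (axis i 1) (contract \<eta> v)" "\<lambda>\<eta>. - contract \<eta> (contract (axis i 1) v)"])
      (auto intro!: basis clinI simp: clin_add[OF clin_contract_left] clin_scale[OF clin_contract_left]
         clin_add[OF clin_contract] clin_scale[OF clin_contract])
  show ?thesis
    by (rule clin_eqI[of "\<lambda>\<xi>. contract \<xi> (contract \<eta> v)" "\<lambda>\<xi>. - contract \<eta> (contract \<xi> v)"])
      (auto intro!: step clinI simp: clin_add[OF clin_contract_left] clin_scale[OF clin_contract_left]
         clin_add[OF clin_contract] clin_scale[OF clin_contract])
qed

definition cdot :: "(complex, 'a::finite) vec \<Rightarrow> (complex, 'a) vec \<Rightarrow> complex" where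
  "cdot x y = (\<Sum>i\<in>UNIV. x $ i * y $ i)"

lemma cdot_commute: "cdot x y = cdot y x" by (simp add: cdot_def mult.commute)

lemma cdot_simps:
  "cdot (x + x') y = cdot x y + cdot x' y" "cdot (c *s x) y = c * cdot x y"
  "cdot x (y + y') = cdot x y + cdot x y'" "cdot x (c *s y) = c * cdot x y"
  by (simp_all add: cdot_def algebra_simps sum.distrib sum_distrib_left)

lemma cdot_axis: "cdot (axis i 1) y = y $ i" "cdot y (axis i 1) = y $ i"
  by (simp_all add: cdot_def axis_def if_distrib if_distribR sum.delta cong: if_cong)

lemma clifford: "emult \<xi> (contract \<eta> v) + contract \<eta> (emult \<xi> v) = cdot \<xi> \<eta> *s v"
proof -
  have basis: "emult (axis i 1) (contract (axis j 1) v) + contract (axis j 1) (emult (axis i 1) v)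
      = cdot (axis i 1) (axis j 1) *s v" for i j :: 'a
  proof (cases "i = j")
    case True
    then show ?thesis
      by (auto simp: vec_eq_iff emult_axis contract_axis cdot_axis shuffle_sign_square mult.assoc[symmetric] insert_absorb)
  next
    case False
    have "emult (axis i 1) (contract (axis j 1) v) $ K + contract (axis j 1) (emult (axis i 1) v) $ K = 0" for K
    proof (cases "i \<in> K \<and> j \<notin> K")
      case True
      define L where "L = K - {i}"
      have e: "K = insert i L" "insert j K - {i} = insert j L" "i \<notin> L" "j \<notin> L" using True False by (auto simp: L_def)
      have "shuffle_sign {j} K = shuffle_sign {j} {i} * shuffle_sign {j} L"
        by (rule trans[OF arg_cong[OF e(1), of "shuffle_sign {j}"] shuffle_sign_insert_right]) (rule e)
      moreover have "shuffle_sign {i} (insert j L) = shuffle_sign {i} {j} * shuffle_sign {i} L"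
        by (rule shuffle_sign_insert_right) (use e in auto)
      moreover have "emult (axis i 1) (contract (axis j 1) v) $ K
          = shuffle_sign {i} L * (shuffle_sign {j} L * v $ insert j L)"
        using True by (simp add: emult_axis contract_axis L_def)
      moreover have "contract (axis j 1) (emult (axis i 1) v) $ K
          = shuffle_sign {j} K * (shuffle_sign {i} (insert j L) * v $ insert j L)"
      proof -
        have "j \<notin> K" "i \<in> insert j K" using True by auto
        then show ?thesis unfolding contract_axis emult_axis by (simp only: e(2) if_False if_True)
      qed
      ultimately show ?thesis using False
        by (cases "i < j") (simp_all add: shuffle_sign_singletons)
    qed (use False in \<open>auto simp: emult_axis contract_axis\<close>)
    moreover have "cdot (axis i 1) (axis j 1) = 0"
      unfolding cdot_axis using False by (simp add: axis_def)
    ultimately show ?thesis by (simp add: vec_eq_iff)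
  qed
  have lin: "clin (\<lambda>\<eta>. cdot \<xi> \<eta> *s v)" "clin (\<lambda>\<xi>. cdot \<xi> \<eta> *s v)" for \<xi> \<eta> :: "'a cvec"
    by (rule clinI; simp add: cdot_simps vector_sadd_rdistrib vector_smult_assoc)+
  have step: "emult (axis i 1) (contract \<eta> v) + contract \<eta> (emult (axis i 1) v) = cdot (axis i 1) \<eta> *s v" for i
    by (rule clin_eqI[of "\<lambda>\<eta>. emult (axis i 1) (contract \<eta> v) + contract \<eta> (emult (axis i 1) v)" "\<lambda>\<eta>. cdot (axis i 1) \<eta> *s v"])
       (intro clin_plus clin_compose[OF clin_emult clin_contract_left] clin_contract_left lin basis)+
  show ?thesis
    by (rule clin_eqI[of "\<lambda>\<xi>. emult \<xi> (contract \<eta> v) + contract \<eta> (emult \<xi> v)" "\<lambda>\<xi>. cdot \<xi> \<eta> *s v"])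
       (intro clin_plus clin_compose[OF clin_contract clin_emult_left] clin_emult_left lin step)+
qed

lemma pairing_emult_contract: "cdot (emult \<xi> v) w = cdot v (contract \<xi> w)"
proof -
  have "cdot (emult (axis i 1) v) w = cdot v (contract (axis i 1) w)" for i
  proof -
    have "cdot (emult (axis i 1) v) w = (\<Sum>K\<in>{K. i \<in> K}. shuffle_sign {i} (K - {i}) * v $ (K - {i}) * w $ K)"
      unfolding cdot_def by (rule sum.mono_neutral_cong_right) (auto simp: emult_axis)
    also have "\<dots> = (\<Sum>K\<in>{K. i \<notin> K}. shuffle_sign {i} K * v $ K * w $ insert i K)"
      by (rule sum.reindex_bij_witness[of _ "insert i" "\<lambda>K. K - {i}"]) (auto simp: insert_absorb)
    also have "\<dots> = cdot v (contract (axis i 1) w)"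
      unfolding cdot_def by (rule sum.mono_neutral_cong_left) (auto simp: contract_axis)
    finally show ?thesis .
  qed
  then have "(\<Sum>i\<in>UNIV. \<xi> $ i * cdot (emult (axis i 1) v) w) = (\<Sum>i\<in>UNIV. \<xi> $ i * cdot v (contract (axis i 1) w))"
    by simp
  moreover have "cdot (\<Sum>i\<in>A. c i *s x i) w = (\<Sum>i\<in>A. c i * cdot (x i) w)"
    "cdot w (\<Sum>i\<in>A. c i *s x i) = (\<Sum>i\<in>A. c i * cdot w (x i))" if "finite A" for A :: "'a set" and c x and w :: "'a ext"
    using that by (induction A rule: finite_induct) (simp_all add: cdot_simps, simp_all add: cdot_def)
  ultimately show ?thesis
    by (simp add: clin_expand[OF clin_emult_left, of \<xi>] clin_expand[OF clin_contract_left, of \<xi>])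
qed

subsection \<open>Decomposable forms\<close>

lemma axis_apply: "axis i c $ j = (if j = i then c else 0)"
  by (simp add: axis_def)

lemma emult_wedge: "emult \<xi> (wedge v w) = wedge (emult \<xi> v) w"
  by (simp add: emult_def wedge_assoc)

text \<open>One sign for each covector that is passed.\<close>

lemma emult_foldr_shift: "emult x (foldr emult xs v) = (-1) ^ length xs *s foldr emult xs (emult x v)"
proof (induction xs)
  case (Cons y xs)
  then show ?case
    by (simp add: emult_anticommute[of x y] clin_scale[OF clin_emult] vector_sneg_minus1[symmetric] vector_smult_assoc)
qed simp

lemma foldr_emult_eq_wedge: "foldr emult xs v = wedge (wedge_list (map covec xs)) v"
  by (induction xs) (simp_all add: emult_def wedge_assoc)

lemma emult_self: "emult x (emult x v) = 0"
proof -
  have "emult x (emult x v) $ K = 0" for K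
    using arg_cong[OF emult_anticommute[of x x v], of "\<lambda>v. v $ K"] by simp
  then show ?thesis by (simp add: vec_eq_iff)
qed

lemma emult_mem_wedge_list:
  assumes "x \<in> set xs" shows "emult x (wedge_list (map covec xs)) = 0"
proof -
  obtain ys zs where xs: "xs = ys @ x # zs" using assms split_list by metis
  have "wedge_list (map covec xs) = foldr emult ys (emult x (wedge_list (map covec zs)))"
    unfolding xs foldr_emult_eq_wedge by (simp add: wedge_list_append emult_def)
  moreover have "foldr emult ys 0 = 0" by (induction ys) (simp_all add: clin_zero[OF clin_emult])
  ultimately show ?thesis by (simp add: emult_foldr_shift emult_self)
qed

lemma wedge_list_sorted_axis:
  assumes "sorted L" "distinct L"
  shows "wedge_list (map (\<lambda>i. covec (axis i 1)) L) = axis (set L) 1"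
  using assms
proof (induction L)
  case (Cons i L)
  have "emult (axis i 1) (axis (set L) 1) $ K = axis (insert i (set L)) 1 $ K" for K
  proof -
    have "{(a, b). a \<in> {i} \<and> b \<in> set L \<and> b < a} = {}" using Cons.prems by auto
    then have "shuffle_sign {i} (set L) = 1" by (simp only: shuffle_sign_def card.empty power_0)
    moreover have "i \<notin> set L" using Cons.prems by auto
    ultimately show ?thesis
      by (cases "i \<in> K"; cases "K = insert i (set L)") (auto simp: emult_axis axis_apply)
  qed
  then have "emult (axis i 1) (axis (set L) 1) = axis (insert i (set L)) 1" by (simp add: vec_eq_iff)
  then show ?case using Cons by (simp add: emult_def)
qed simp

lemma axis_eq_wedge_list:
  "axis I 1 = wedge_list (map covec (map (\<lambda>i. axis i 1) (sorted_list_of_set I)))"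
  using wedge_list_sorted_axis[of "sorted_list_of_set I"] by (simp add: o_def)

text \<open>The new covector passes those with smaller index, one sign each.\<close>

lemma wedge_list_insort:
  assumes "i \<notin> set L" "sorted L" "distinct L"
  shows "wedge_list (map (\<lambda>i. covec (c i)) (insort i L))
    = shuffle_sign {i} (set L) *s emult (c i) (wedge_list (map (\<lambda>i. covec (c i)) L))"
  using assms
proof (induction L)
  case Nil
  then show ?case by (simp add: emult_def)
next
  case (Cons j L)
  show ?case
  proof (cases "i \<le> j")
    case True
    have "{(a, b). a \<in> {i} \<and> b \<in> set (j # L) \<and> b < a} = {}" using Cons.prems True by auto
    then have "shuffle_sign {i} (set (j # L)) = 1" by (simp only: shuffle_sign_def card.empty power_0)
    then show ?thesis using True by (simp add: emult_def)
  next
    case False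
    then have "shuffle_sign {i} (set (j # L)) = - shuffle_sign {i} (set L)"
      using Cons.prems shuffle_sign_insert_right[of j "set L" "{i}"] by (simp add: shuffle_sign_singletons)
    then show ?thesis using False Cons
      by (simp add: emult_def[symmetric] clin_scale[OF clin_emult] emult_anticommute[of "c j"])
  qed
qed

lemma ext_degree_add: "v \<in> ext_degree k \<Longrightarrow> w \<in> ext_degree k \<Longrightarrow> v + w \<in> ext_degree k"
  and ext_degree_scale: "v \<in> ext_degree k \<Longrightarrow> c *s v \<in> ext_degree k"
  and ext_degree_zero: "0 \<in> ext_degree k"
  by (simp_all add: ext_degree_def)

lemma ext_degree_sum: "(\<And>a. a \<in> A \<Longrightarrow> f a \<in> ext_degree k) \<Longrightarrow> sum f A \<in> ext_degree k"
  by (simp add: ext_degree_def)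

lemma subspace_ext_degree: "vec.subspace (ext_degree k)"
  by (rule vec.subspaceI) (auto intro: ext_degree_add ext_degree_scale ext_degree_zero)

lemma axis_in_ext_degree: "axis I c \<in> ext_degree (card I)"
  by (auto simp: ext_degree_def axis_apply)

lemma emult_ext_degree: "v \<in> ext_degree k \<Longrightarrow> emult \<xi> v \<in> ext_degree (Suc k)"
proof -
  assume v: "v \<in> ext_degree k"
  have "emult (axis i 1) v \<in> ext_degree (Suc k)" for i
    using v by (auto simp: ext_degree_def emult_axis)
       (metis card_Suc_Diff1 finite)
  then show ?thesis
    by (subst clin_expand[OF clin_emult_left]) (auto intro: ext_degree_sum ext_degree_scale)
qed

lemma wedge_list_ext_degree: "wedge_list (map covec xs) \<in> ext_degree (length xs)"
proof (induction xs)
  case Nil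
  then show ?case using axis_in_ext_degree[of "{}" 1] by simp
qed (simp add: emult_def[symmetric] emult_ext_degree)

lemma ext_degree_gt: "v \<in> ext_degree k \<Longrightarrow> k > CARD('d) \<Longrightarrow> v = (0 :: ('d::{finite,linorder}) ext)"
  by (simp add: ext_degree_def vec_eq_iff) (metis card_mono finite leD subset_UNIV)

text \<open>Carrying \<open>x\<close> and \<open>y\<close> past the covectors between them costs the same sign in both orders, and
  \<open>x\<close>, \<open>y\<close> themselves anticommute.\<close>

lemma wedge_list_swap:
  "wedge_list (map covec (pre @ x # mid @ y # post)) = - wedge_list (map covec (pre @ y # mid @ x # post))"
proof -
  let ?w = "wedge_list (map covec post)"
  have key: "emult x (foldr emult mid (emult y ?w)) = - emult y (foldr emult mid (emult x ?w))"
  proof -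
    have "foldr emult mid (- v) = - foldr emult mid v" for v
      by (induction mid) (simp_all add: clin_minus[OF clin_emult])
    then show ?thesis by (simp add: emult_foldr_shift emult_anticommute[of x y])
  qed
  have "wedge_list (map covec (pre @ x # mid @ y # post)) = foldr emult pre (emult x (foldr emult mid (emult y ?w)))" for x y
    unfolding foldr_emult_eq_wedge by (simp add: wedge_list_append emult_def)
  moreover have "foldr emult pre (- v) = - foldr emult pre v" for v
    by (induction pre) (simp_all add: clin_minus[OF clin_emult])
  ultimately show ?thesis by (simp add: key)
qed

subsection \<open>The induced algebra homomorphisms\<close>

type_synonym 'd cmat = "((complex, 'd) vec, 'd) vec"

text \<open>Pullback along complex matrices; it is needed for matrices acting differently on the two types of
  covectors. The rows of \<open>D\<close> are the images of the basis covectors, so \<open>D\<close> acts from the right.\<close>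

definition cpull :: "'d cmat \<Rightarrow> ('d::{finite,linorder}) ext \<Rightarrow> 'd ext" where
  "cpull D v = (\<Sum>I\<in>UNIV. v $ I *s wedge_list (map (\<lambda>i. covec (D $ i)) (sorted_list_of_set I)))"

definition cmat :: "'d rmat \<Rightarrow> ('d::finite) cmat" where
  "cmat D = (\<chi> i j. of_real (D $ i $ j))"

lemma pullback_eq_cpull: "pullback D = cpull (cmat D)"
  by (simp add: fun_eq_iff pullback_def cpull_def cmat_def)

lemma clin_cpull: "clin (cpull D)"
  by (rule clinI) (simp_all add: cpull_def vector_sadd_rdistrib sum.distrib vec.scale_sum_right)

lemma cpull_axis: "cpull D (axis I 1) = wedge_list (map (\<lambda>i. covec (D $ i)) (sorted_list_of_set I))"
proof -
  have "cpull D (axis I 1) = (\<Sum>L\<in>UNIV. if L = I then wedge_list (map (\<lambda>i. covec (D $ i)) (sorted_list_of_set I)) else 0)"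
    unfolding cpull_def by (rule sum.cong) (auto simp: axis_apply vec_eq_iff)
  then show ?thesis by (simp add: sum.delta)
qed

lemma cpull_one: "cpull D (axis {} 1) = axis {} 1"
  by (simp add: cpull_axis)

lemma axis_vector_matrix: "axis i 1 v* D = (D $ i :: (complex, 'a::finite) vec)"
  by (simp add: vector_matrix_mult_def vec_eq_iff axis_apply if_distrib if_distribR sum.delta cong: if_cong)

lemma clin_vector_matrix: "clin (\<lambda>\<xi>. \<xi> v* D)"
  by (rule clinI) (simp_all add: vector_matrix_mult_def vec_eq_iff algebra_simps sum.distrib sum_distrib_left)

text \<open>On basis forms: if \<open>i \<in> I\<close>, both sides contain a repeated factor; otherwise the factor for \<open>i\<close> is
  sorted into its place on both sides.\<close>

lemma cpull_emult: "cpull D (emult \<xi> v) = emult (\<xi> v* D) (cpull D v)"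
proof -
  have basis: "cpull D (emult (axis i 1) (axis I 1)) = emult (D $ i) (cpull D (axis I 1))" for i I
  proof (cases "i \<in> I")
    case True
    then have "emult (axis i 1) (axis I 1) = 0"
      by (auto simp: vec_eq_iff emult_axis axis_apply)
    moreover have "emult (D $ i) (cpull D (axis I 1)) = 0"
      unfolding cpull_axis using emult_mem_wedge_list[of "D $ i" "map (\<lambda>i. D $ i) (sorted_list_of_set I)"] True
      by (simp add: o_def)
    ultimately show ?thesis by (simp add: clin_zero[OF clin_cpull])
  next
    case False
    have "emult (axis i 1) (axis I 1) = shuffle_sign {i} I *s axis (insert i I) 1"
      using False by (auto simp: vec_eq_iff emult_axis axis_apply)
    moreover have "sorted_list_of_set (insert i I) = insort i (sorted_list_of_set I)"
      using False by (simp add: sorted_list_of_set_insert)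
    ultimately show ?thesis using False
      by (simp add: clin_scale[OF clin_cpull] cpull_axis wedge_list_insort vector_smult_assoc shuffle_sign_square)
  qed
  have step: "cpull D (emult (axis i 1) v) = emult (D $ i) (cpull D v)" for i
    by (rule clin_eqI[of "\<lambda>v. cpull D (emult (axis i 1) v)" "\<lambda>v. emult (D $ i) (cpull D v)"])
       (simp_all add: basis axis_vector_matrix clin_compose[OF clin_cpull clin_emult] clin_compose[OF clin_emult clin_cpull])
  show ?thesis
    by (rule clin_eqI[of "\<lambda>\<xi>. cpull D (emult \<xi> v)" "\<lambda>\<xi>. emult (\<xi> v* D) (cpull D v)"])
       (auto intro!: clin_compose[OF clin_cpull clin_emult_left] clin_compose[OF clin_emult_left clin_vector_matrix]
          simp: step axis_vector_matrix)
qed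

text \<open>A linear map on the exterior algebra is determined by its value at 1 and its interaction
  with multiplication by covectors.\<close>

lemma ext_linear_eqI:
  assumes "clin P" "clin Q" "P (axis {} 1) = Q (axis {} 1)"
    and "\<And>\<xi> v. P v = Q v \<Longrightarrow> P (emult \<xi> v) = Q (emult \<xi> v)"
  shows "P v = Q v"
proof (rule clin_eqI[OF assms(1,2)])
  have "P (wedge_list (map covec xs)) = Q (wedge_list (map covec xs))" for xs
    by (induction xs) (simp_all add: assms(3,4) emult_def[symmetric])
  then show "P (axis I 1) = Q (axis I 1)" for I
    by (subst (1 2) axis_eq_wedge_list) blast
qed

lemma cpull_wedge: "cpull D (wedge v w) = wedge (cpull D v) (cpull D w)"
  by (rule ext_linear_eqI[of "\<lambda>v. cpull D (wedge v w)" "\<lambda>v. wedge (cpull D v) (cpull D w)"])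
     (auto intro!: clin_compose[OF clin_cpull clin_wedge_left] clin_compose[OF clin_wedge_left clin_cpull]
       simp: cpull_one emult_wedge[symmetric] cpull_emult)

lemma cpull_compose: "cpull B (cpull A v) = cpull (A ** B) v"
  by (rule ext_linear_eqI[of "\<lambda>v. cpull B (cpull A v)" "cpull (A ** B)"])
     (simp_all add: clin_compose[OF clin_cpull clin_cpull] clin_cpull cpull_one cpull_emult vector_matrix_mul_assoc)

lemma cpull_id: "cpull (mat 1) v = v"
  by (rule ext_linear_eqI[of "cpull (mat 1)" "\<lambda>v. v"])
     (auto intro!: clin_ident clin_cpull simp: cpull_one cpull_emult)

definition mscale :: "complex \<Rightarrow> 'd cmat \<Rightarrow> ('d::finite) cmat" where
  "mscale c A = (\<chi> i. c *s A $ i)"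

lemma cpull_mscale: "v \<in> ext_degree k \<Longrightarrow> cpull (mscale c A) v = c ^ k *s cpull A v"
proof -
  have wl: "wedge_list (map (\<lambda>i. covec (c *s A $ i)) L) = c ^ length L *s wedge_list (map (\<lambda>i. covec (A $ i)) L)" for L
    by (induction L) (simp_all add: covec_scale wedge_scale_left wedge_scale_right vector_smult_assoc mult_ac)
  assume v: "v \<in> ext_degree k"
  have "cpull (mscale c A) v = (\<Sum>I\<in>UNIV. v $ I *s (c ^ card I *s wedge_list (map (\<lambda>i. covec (A $ i)) (sorted_list_of_set I))))"
    unfolding cpull_def by (simp add: wl mscale_def)
  also have "\<dots> = (\<Sum>I\<in>UNIV. c ^ k *s (v $ I *s wedge_list (map (\<lambda>i. covec (A $ i)) (sorted_list_of_set I))))"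
    using v by (intro sum.cong) (auto simp: ext_degree_def vector_smult_assoc mult_ac)
  finally show ?thesis by (simp add: cpull_def vec.scale_sum_right)
qed

lemma cpull_ext_degree: "v \<in> ext_degree k \<Longrightarrow> cpull D v \<in> ext_degree k"
  unfolding cpull_def
proof (rule ext_degree_sum)
  fix I assume v: "v \<in> ext_degree k"
  show "v $ I *s wedge_list (map (\<lambda>i. covec (D $ i)) (sorted_list_of_set I)) \<in> ext_degree k"
  proof (cases "card I = k")
    case True
    then show ?thesis
      using wedge_list_ext_degree[of "map (\<lambda>i. D $ i) (sorted_list_of_set I)"] by (simp add: o_def ext_degree_scale)
  qed (use v in \<open>simp add: ext_degree_def\<close>)
qed

subsection \<open>Transposition\<close>

lemma cdot_sum_left: "cdot (\<Sum>i\<in>A. f i) w = (\<Sum>i\<in>A. cdot (f i) w)"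
proof (induction A rule: infinite_finite_induct)
  case (insert x F)
  then show ?case by (simp add: cdot_simps)
qed (simp_all add: cdot_def)

lemma cdot_eqI: "(\<And>w. cdot v w = cdot v' w) \<Longrightarrow> v = v'"
  by (simp add: vec_eq_iff) (metis cdot_axis(2))

lemma vector_transpose_matrix_c: "cdot (\<xi> v* D) \<eta> = cdot \<xi> (\<eta> v* transpose D)"
proof -
  have "cdot (\<xi> v* D) \<eta> = (\<Sum>j\<in>UNIV. \<Sum>i\<in>UNIV. D $ i $ j * \<xi> $ i * \<eta> $ j)"
    by (simp add: cdot_def vector_matrix_mult_def sum_distrib_left sum_distrib_right mult_ac)
  also have "\<dots> = (\<Sum>i\<in>UNIV. \<Sum>j\<in>UNIV. D $ i $ j * \<xi> $ i * \<eta> $ j)" by (rule sum.swap)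
  also have "\<dots> = cdot \<xi> (\<eta> v* transpose D)"
    by (simp add: cdot_def vector_matrix_mult_def transpose_def sum_distrib_left mult_ac)
  finally show ?thesis .
qed

lemma contract_one: "contract \<xi> (axis {} 1) = 0"
  by (simp add: contract_def vec_eq_iff axis_apply)

text \<open>By induction along wedge products, with the Clifford relation on either side.\<close>

lemma contract_cpull: "contract \<xi> (cpull D v) = cpull D (contract (\<xi> v* transpose D) v)"
proof (rule ext_linear_eqI[of "\<lambda>v. contract \<xi> (cpull D v)" "\<lambda>v. cpull D (contract (\<xi> v* transpose D) v)"])
  fix \<eta> v assume IH: "contract \<xi> (cpull D v) = cpull D (contract (\<xi> v* transpose D) v)"
  have c: "contract \<xi> (emult \<eta> v) = cdot \<eta> \<xi> *s v - emult \<eta> (contract \<xi> v)" for \<xi> \<eta> :: "'a cvec" and v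
    using clifford[of \<eta> \<xi> v] by (simp add: algebra_simps)
  show "contract \<xi> (cpull D (emult \<eta> v)) = cpull D (contract (\<xi> v* transpose D) (emult \<eta> v))"
    by (simp add: c cpull_emult IH clin_diff[OF clin_cpull] clin_scale[OF clin_cpull] vector_transpose_matrix_c)
qed (simp_all add: clin_compose[OF clin_contract clin_cpull] clin_compose[OF clin_cpull clin_contract]
       cpull_one contract_one clin_zero[OF clin_cpull])

text \<open>The transpose of the map induced by \<open>D\<close> commutes with multiplication by covectors in the way
  that characterizes the map induced by the transpose of \<open>D\<close>.\<close>

lemma cdot_cpull: "cdot (cpull D v) w = cdot v (cpull (transpose D) w)"
proof -
  define T where "T w = (\<chi> I. cdot (cpull D (axis I 1)) w)" for w
  have clin_T: "clin T" by (rule clinI) (simp_all add: T_def vec_eq_iff cdot_simps)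
  have T: "cdot (cpull D v) w = cdot v (T w)" for v w
    by (subst clin_expand[OF clin_cpull]) (simp add: cdot_sum_left cdot_simps T_def, simp add: cdot_def)
  have "T w = cpull (transpose D) w"
  proof (rule ext_linear_eqI[OF clin_T clin_cpull])
    have "cdot (cpull D v) (axis {} 1) = v $ {}" for v
    proof -
      have "cpull D (axis I 1) $ {} = axis I 1 $ {}" for I
        using cpull_ext_degree[OF axis_in_ext_degree[of I 1], of D] cpull_one[of D]
        by (cases "I = {}") (auto simp: ext_degree_def axis_apply)
      then show ?thesis by (simp add: cdot_axis clin_expand[OF clin_cpull, of D v])
         (simp add: axis_apply if_distrib sum.delta cong: if_cong)
    qed
    then show "T (axis {} 1) = cpull (transpose D) (axis {} 1)"
      by (auto simp: T_def vec_eq_iff cpull_one axis_apply)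
    fix \<xi> w assume IH: "T w = cpull (transpose D) w"
    have "cdot v (T (emult \<xi> w)) = cdot v (emult (\<xi> v* transpose D) (T w))" for v
    proof -
      have "cdot v (T (emult \<xi> w)) = cdot (cpull D v) (emult \<xi> w)" by (simp add: T)
      also have "\<dots> = cdot w (contract \<xi> (cpull D v))"
        by (simp add: cdot_commute[of "cpull D v"] pairing_emult_contract)
      also have "\<dots> = cdot (contract (\<xi> v* transpose D) v) (T w)"
        by (simp add: contract_cpull T cdot_commute[of w])
      finally show ?thesis by (simp add: cdot_commute[of v "emult _ _"] pairing_emult_contract cdot_commute[of "T w"])
    qed
    then have "T (emult \<xi> w) = emult (\<xi> v* transpose D) (T w)"
      by (intro cdot_eqI) (metis cdot_commute)
    then show "T (emult \<xi> w) = cpull (transpose D) (emult \<xi> w)" by (simp add: IH cpull_emult)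
  qed
  then show ?thesis by (simp add: T)
qed

subsection \<open>Passing to complements\<close>

text \<open>The Hodge star of the flat metric for which the coordinate basis is orthonormal.\<close>

definition complement :: "('d::{finite,linorder}) ext \<Rightarrow> 'd ext" where
  "complement v = (\<chi> K. shuffle_sign (- K) K * v $ (- K))"

lemma clin_complement: "clin complement"
  by (rule clinI) (simp_all add: complement_def vec_eq_iff algebra_simps)

lemma complement_nth: "complement v $ K = shuffle_sign (- K) K * v $ (- K)"
  by (simp add: complement_def)

text \<open>The composite produces the sign \<open>(-1)\<^bsup>|K| |L|\<^esup>\<close> for \<open>|K| + |L| = dim - 1\<close>. In even dimension this
  sum is odd, so one of the factors is even.\<close>

lemma complement_emult_complement:
  assumes "even CARD('d::{finite,linorder})"
  shows "complement (emult \<xi> (complement v)) = contract \<xi> (v :: 'd ext)"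
proof -
  have "complement (emult (axis j 1) (complement v)) $ K = contract (axis j 1) v $ K" for j K
  proof (cases "j \<in> K")
    case False
    define L where "L = - K - {j}"
    have L: "- K = insert j L" "- L = insert j K" "j \<notin> L" "K \<inter> L = {}" "insert j L - {j} = L"
      using False by (auto simp: L_def)
    have "card K + card L + 1 = CARD('d)"
    proof -
      have "card (K \<union> insert j L) = card K + card (insert j L)" using L False by (intro card_Un_disjoint) auto
      moreover have "K \<union> insert j L = UNIV" using L(1) by auto
      ultimately show ?thesis using L(3) by simp
    qed
    then have "even (card K * card L)" using assms by (metis even_add even_mult_iff odd_one)
    then have s1: "shuffle_sign K L * shuffle_sign L K = 1" using shuffle_sign_swap[OF L(4)] by simp
    have "complement (emult (axis j 1) (complement v)) $ K
        = shuffle_sign (insert j L) K * (shuffle_sign {j} L * (shuffle_sign (insert j K) L * v $ insert j K))"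
      by (simp only: complement_nth emult_axis L insertI1 if_True)
    also have "\<dots> = (shuffle_sign K L * shuffle_sign L K) * (shuffle_sign {j} L * shuffle_sign {j} L) * shuffle_sign {j} K * v $ insert j K"
      using False L(3) by (simp add: shuffle_sign_insert_left[of j L K] shuffle_sign_insert_left[of j K L] mult_ac)
    finally show ?thesis using False by (simp add: s1 shuffle_sign_square contract_axis)
  qed (simp add: complement_nth emult_axis contract_axis)
  then have step: "complement (emult (axis j 1) (complement v)) = contract (axis j 1) v" for j
    by (simp add: vec_eq_iff)
  show ?thesis
    by (rule clin_eqI[of "\<lambda>\<xi>. complement (emult \<xi> (complement v))" "\<lambda>\<xi>. contract \<xi> v"])
       (rule clin_compose[OF clin_complement clin_emult_left] clin_contract_left step)+
qed

lemma wedge_top: "wedge v w $ UNIV = cdot (complement v) w"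
proof -
  have "wedge v w $ UNIV = (\<Sum>I\<in>UNIV. shuffle_sign I (- I) * v $ I * w $ (- I))"
    by (simp add: wedge_def Compl_eq_Diff_UNIV)
  also have "\<dots> = (\<Sum>I\<in>UNIV. shuffle_sign (- I) I * v $ (- I) * w $ I)"
    by (rule sum.reindex_bij_witness[of _ uminus uminus]) auto
  finally show ?thesis by (simp add: cdot_def complement_nth)
qed

text \<open>The determinant of \<open>D\<close>.\<close>

definition top_factor :: "('d::{finite,linorder}) cmat \<Rightarrow> complex" where
  "top_factor D = cpull D (axis UNIV 1) $ UNIV"

lemma cpull_top: "cpull D v $ UNIV = top_factor D * v $ UNIV"
proof -
  have ax: "cpull D (axis I 1) $ UNIV = (if I = UNIV then top_factor D else 0)" for I
  proof (cases "I = UNIV")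
    case False
    then have "card I \<noteq> CARD('a)" by (metis card_subset_eq finite subset_UNIV)
    then show ?thesis using False cpull_ext_degree[OF axis_in_ext_degree[of I 1], of D] by (simp add: ext_degree_def)
  qed (simp add: top_factor_def)
  have "(\<Sum>I\<in>UNIV. v $ I * cpull D (axis I 1) $ UNIV) = (\<Sum>I\<in>(UNIV :: 'a set set). if I = UNIV then top_factor D * v $ UNIV else 0)"
    by (rule sum.cong) (auto simp: ax)
  then show ?thesis by (simp add: clin_expand[OF clin_cpull, of D v] sum.delta)
qed

lemma top_degree: "v \<in> ext_degree CARD('d) \<Longrightarrow> v = v $ UNIV *s axis UNIV (1::complex)"
  for v :: "('d::{finite,linorder}) ext"
  by (simp add: ext_degree_def vec_eq_iff axis_apply) (metis card_subset_eq finite subset_UNIV)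

text \<open>The form \<open>(v, w) \<mapsto> v \<and> w\<close> with values in top degree is multiplied by the determinant when \<open>D\<close> is
  applied to both arguments; in terms of the pairing it is \<open>complement\<close>.\<close>

lemma complement_cpull: "cpull (transpose D) (complement (cpull D v)) = top_factor D *s complement v"
proof (rule cdot_eqI)
  fix w
  have "cdot (cpull (transpose D) (complement (cpull D v))) w = cdot (complement (cpull D v)) (cpull D w)"
    by (simp add: cdot_cpull)
  also have "\<dots> = cpull D (wedge v w) $ UNIV" by (simp add: wedge_top cpull_wedge)
  also have "\<dots> = cdot (top_factor D *s complement v) w" by (simp add: cpull_top wedge_top cdot_simps)
  finally show "cdot (cpull (transpose D) (complement (cpull D v))) w = cdot (top_factor D *s complement v) w" .
qed

lemma top_factor_nonzero: assumes "A ** B = mat 1" shows "top_factor A \<noteq> 0"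
proof
  assume "top_factor A = 0"
  then have "cpull B (cpull A (axis UNIV 1)) $ UNIV = 0" by (simp add: cpull_top)
  then show False by (simp add: cpull_compose assms cpull_id axis_apply)
qed

subsection \<open>Minors as coefficients\<close>

lemma wedge_list_axis_nonzero:
  "wedge_list (map (\<lambda>i. covec (axis i 1)) L) $ K \<noteq> 0 \<Longrightarrow> distinct L \<and> set L = K"
proof (induction L arbitrary: K)
  case Nil
  then show ?case by (simp add: axis_apply split: if_splits)
next
  case (Cons i L)
  then have i: "i \<in> K" and "wedge_list (map (\<lambda>i. covec (axis i 1)) L) $ (K - {i}) \<noteq> 0"
    by (auto simp: emult_def[symmetric] emult_axis split: if_splits)
  from Cons.IH[OF this(2)] i show ?case by auto
qed

text \<open>Multilinear expansion of a product of covectors in the basis.\<close>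

lemma wedge_list_expand:
  "wedge_list (map (\<lambda>a. covec (x a)) [0..<k]) =
    (\<Sum>f\<in>PiE {..<k} (\<lambda>_. UNIV). (\<Prod>a<k. x a $ f a) *s wedge_list (map (\<lambda>a. covec (axis (f a) 1)) [0..<k]))"
proof (induction k)
  case 0
  then show ?case by simp
next
  case (Suc k)
  let ?W = "\<lambda>k (f :: nat \<Rightarrow> 'a). wedge_list (map (\<lambda>a. covec (axis (f a) 1)) [0..<k])"
  have split: "PiE {..<Suc k} (\<lambda>_. UNIV :: 'a set) = (\<lambda>(i, f). f(k := i)) ` (UNIV \<times> PiE {..<k} (\<lambda>_. UNIV))"
    by (simp add: lessThan_Suc PiE_insert_eq)
  have inj: "inj_on (\<lambda>(i, f). f(k := i)) (UNIV \<times> PiE {..<k} (\<lambda>_. UNIV :: 'a set))"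
    by (rule inj_combinator) simp
  have W: "?W (Suc k) (f(k := i)) = wedge (?W k f) (covec (axis i 1))" for f i
  proof -
    have "map (\<lambda>a. covec (axis ((f(k := i)) a) 1)) [0..<k] = map (\<lambda>a. covec (axis (f a) 1)) [0..<k]" by simp
    then show ?thesis by (simp only: upt_Suc_append[OF zero_le] map_append wedge_list_append) simp
  qed
  have P: "(\<Prod>a<Suc k. x a $ (f(k := i)) a) = (\<Prod>a<k. x a $ f a) * x k $ i" for f i
    by simp
  have lin: "wedge u (covec y) = (\<Sum>i\<in>UNIV. y $ i *s wedge u (covec (axis i 1)))" for u and y :: "'a cvec"
    by (rule clin_expand[OF clin_compose[OF clin_wedge_right clin_covec]])
  have "wedge_list (map (\<lambda>a. covec (x a)) [0..<Suc k]) = wedge (wedge_list (map (\<lambda>a. covec (x a)) [0..<k])) (covec (x k))"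
    by (simp add: wedge_list_append)
  also have "\<dots> = (\<Sum>f\<in>PiE {..<k} (\<lambda>_. UNIV). (\<Prod>a<k. x a $ f a) *s wedge (?W k f) (covec (x k)))"
    by (simp only: Suc.IH clin_sum[OF clin_wedge_left] wedge_scale_left)
  also have "\<dots> = (\<Sum>f\<in>PiE {..<k} (\<lambda>_. UNIV). \<Sum>i\<in>UNIV. (\<Prod>a<Suc k. x a $ (f(k := i)) a) *s ?W (Suc k) (f(k := i)))"
    by (simp only: W P lin[of _ "x k"] vec.scale_sum_right vector_smult_assoc)
  also have "\<dots> = (\<Sum>i\<in>UNIV. \<Sum>f\<in>PiE {..<k} (\<lambda>_. UNIV). (\<Prod>a<Suc k. x a $ (f(k := i)) a) *s ?W (Suc k) (f(k := i)))"
    by (rule sum.swap)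
  also have "\<dots> = (\<Sum>(i, f)\<in>UNIV \<times> PiE {..<k} (\<lambda>_. UNIV). (\<Prod>a<Suc k. x a $ (f(k := i)) a) *s ?W (Suc k) (f(k := i)))"
    by (rule sum.cartesian_product)
  also have "\<dots> = (\<Sum>f\<in>PiE {..<Suc k} (\<lambda>_. UNIV). (\<Prod>a<Suc k. x a $ f a) *s ?W (Suc k) f)"
    unfolding split by (subst sum.reindex[OF inj]) (simp add: case_prod_unfold)
  finally show ?case .
qed

lemma wedge_list_transpose:
  assumes "a < k" "b < k" "a \<noteq> b"
  shows "wedge_list (map covec (map (x \<circ> Transposition.transpose a b) [0..<k])) = - wedge_list (map covec (map x [0..<k]))"
proof -
  have *: "wedge_list (map covec (map (x \<circ> Transposition.transpose a b) [0..<k])) = - wedge_list (map covec (map x [0..<k]))"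
    if ab: "a < b" "b < k" for a b
  proof -
    have "[0..<k] = [0..<a] @ a # [Suc a..<b] @ b # [Suc b..<k]"
      using ab upt_add_eq_append[of 0 a "k - a"] upt_conv_Cons[of a k]
        upt_add_eq_append[of "Suc a" b "k - b"] upt_conv_Cons[of b k] by simp
    moreover have "map (x \<circ> Transposition.transpose a b) [0..<a] = map x [0..<a]"
      "map (x \<circ> Transposition.transpose a b) [Suc a..<b] = map x [Suc a..<b]"
      "map (x \<circ> Transposition.transpose a b) [Suc b..<k] = map x [Suc b..<k]"
      using ab by (auto simp: Transposition.transpose_def)
    ultimately show ?thesis
      using wedge_list_swap[of "map x [0..<a]" "x b" "map x [Suc a..<b]" "x a" "map x [Suc b..<k]"]
      by (simp only: map_append list.map o_apply transpose_apply_first transpose_apply_second)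
  qed
  show ?thesis
  proof (cases "a < b")
    case False
    then show ?thesis using *[of b a] assms by (simp add: transpose_commute)
  qed (use * assms in auto)
qed

lemma wedge_list_permute:
  assumes "p permutes {..<k}"
  shows "wedge_list (map covec (map (x \<circ> p) [0..<k])) = of_int (sign p) *s wedge_list (map covec (map x [0..<k]))"
  using finite_lessThan assms
proof (induction p arbitrary: x rule: permutes_rev_induct)
  case id
  then show ?case by simp
next
  case (swap a b p)
  have "permutation p" using swap.hyps by (metis finite_lessThan permutation_permutes)
  then have sg: "sign (p \<circ> Transposition.transpose a b) = - sign p"
    using swap.hyps by (simp add: sign_compose permutation_swap_id sign_swap_id)
  have eq: "wedge_list (map covec (map (x \<circ> (p \<circ> Transposition.transpose a b)) [0..<k])) = - wedge_list (map covec (map (x \<circ> p) [0..<k]))"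
    using wedge_list_transpose[of a k b "x \<circ> p"] swap.hyps by (simp add: o_assoc del: map_map)
  show ?case unfolding sg eq swap.IH[of x] by simp
qed

text \<open>In the multilinear expansion only the choices of basis covectors that enumerate \<open>J\<close> contribute.
  They correspond to permutations, and each contributes its sign because a wedge product of covectors
  is alternating.\<close>

lemma wedge_list_coefficient:
  assumes "card J = k"
  shows "wedge_list (map (\<lambda>a. covec (x a)) [0..<k]) $ J =
    (\<Sum>p | p permutes {..<k}. of_int (sign p) * (\<Prod>a<k. x a $ (sorted_list_of_set J ! p a)))"
proof -
  define e where "e = (!) (sorted_list_of_set J)"
  have len: "length (sorted_list_of_set J) = k" using assms by simp
  have inj_e: "inj_on e {..<k}" unfolding e_def using len
    by (auto simp: inj_on_def nth_eq_iff_index_eq)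
  have img_e: "e ` {..<k} = J"
  proof -
    have "set (sorted_list_of_set J) = e ` {..<k}" unfolding e_def set_conv_nth len by auto
    then show ?thesis by simp
  qed
  have We: "wedge_list (map covec (map (\<lambda>a. axis (e a) 1) [0..<k])) = axis J 1"
  proof -
    have "map e [0..<k] = sorted_list_of_set J" unfolding e_def using len by (metis map_nth)
    moreover have "map covec (map (\<lambda>a. axis (e a) 1) [0..<k]) = map (\<lambda>i. covec (axis i 1)) (map e [0..<k])"
      by simp
    ultimately have "map covec (map (\<lambda>a. axis (e a) 1) [0..<k]) = map (\<lambda>i. covec (axis i 1)) (sorted_list_of_set J)"
      by (simp only:)
    then show ?thesis using wedge_list_sorted_axis[of "sorted_list_of_set J"] by simp
  qed
  have perm: "(\<lambda>a. if a < k then inv_into {..<k} e (f a) else a) permutes {..<k}"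
    if f: "inj_on f {..<k}" "f ` {..<k} = J" for f
  proof -
    have "bij_betw (\<lambda>a. inv_into {..<k} e (f a)) {..<k} {..<k}"
      using bij_betw_trans[of f "{..<k}" J "inv_into {..<k} e" "{..<k}"] f
        bij_betw_inv_into[of e "{..<k}" J] inj_e img_e
      by (simp add: bij_betw_def o_def)
    then have "bij_betw (\<lambda>a. if a < k then inv_into {..<k} e (f a) else a) {..<k} {..<k}"
      by (rule bij_betw_cong[THEN iffD1, rotated]) simp
    then show ?thesis by (rule bij_imp_permutes) simp
  qed
  let ?W = "\<lambda>f. wedge_list (map (\<lambda>a. covec (axis (f a) 1)) [0..<k]) $ J"
  let ?A = "{f \<in> PiE {..<k} (\<lambda>_. UNIV). inj_on f {..<k} \<and> f ` {..<k} = J}"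
  have zero: "?W f = 0" if "f \<in> PiE {..<k} (\<lambda>_. UNIV) - ?A" for f
  proof (rule ccontr)
    assume "?W f \<noteq> 0"
    then have "distinct (map f [0..<k]) \<and> set (map f [0..<k]) = J"
      using wedge_list_axis_nonzero[of "map f [0..<k]" J] by (simp add: o_def)
    then show False using that by (auto simp: distinct_map atLeast0LessThan)
  qed
  have "wedge_list (map (\<lambda>a. covec (x a)) [0..<k]) $ J = (\<Sum>f\<in>PiE {..<k} (\<lambda>_. UNIV). (\<Prod>a<k. x a $ f a) * ?W f)"
    by (subst wedge_list_expand) simp
  also have "\<dots> = (\<Sum>f\<in>?A. (\<Prod>a<k. x a $ f a) * ?W f)"
    by (rule sum.mono_neutral_right) (use zero in \<open>auto intro!: finite_PiE\<close>)
  also have "\<dots> = (\<Sum>p | p permutes {..<k}. of_int (sign p) * (\<Prod>a<k. x a $ e (p a)))"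
  proof (rule sum.reindex_bij_witness[of _ "\<lambda>p. restrict (e \<circ> p) {..<k}" "\<lambda>f a. if a < k then inv_into {..<k} e (f a) else a"], goal_cases)
    case (1 f)
    then have f: "f \<in> extensional {..<k}" "f a \<in> e ` {..<k}" if "a < k" for a using that img_e by (auto simp: PiE_def)
    show ?case
    proof
      show "restrict (e \<circ> (\<lambda>a. if a < k then inv_into {..<k} e (f a) else a)) {..<k} a = f a" for a
        using f[of a] 1 by (cases "a < k") (auto simp: f_inv_into_f PiE_def extensional_def)
    qed
  next
    case (2 f)
    then show ?case using perm[of f] by simp
  next
    case (3 p)
    show ?case
    proof
      show "(if a < k then inv_into {..<k} e (restrict (e \<circ> p) {..<k} a) else a) = p a" for a
        using 3 inj_e permutes_in_image[of p "{..<k}" a] permutes_not_in[of p "{..<k}" a]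
        by (auto simp: inv_into_f_f)
    qed
  next
    case (4 p)
    then have p: "p permutes {..<k}" by simp
    have "inj_on (e \<circ> p) {..<k}"
      using p inj_e by (simp add: comp_inj_on permutes_image permutes_inj_on)
    moreover have "(e \<circ> p) ` {..<k} = J" using p img_e by (metis image_comp permutes_image)
    ultimately show ?case by (auto simp: inj_on_def)
  next
    case (5 f)
    then have f: "inj_on f {..<k}" "f ` {..<k} = J" by auto
    define p where "p a = (if a < k then inv_into {..<k} e (f a) else a)" for a
    have p: "p permutes {..<k}" using perm[OF f] by (simp add: p_def[abs_def])
    have ep: "e (p a) = f a" if "a < k" for a
      using that f(2) img_e by (auto simp: p_def intro!: f_inv_into_f)
    have "wedge_list (map (\<lambda>a. covec (axis (f a) 1)) [0..<k]) = wedge_list (map covec (map ((\<lambda>a. axis (e a) 1) \<circ> p) [0..<k]))"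
      by (rule arg_cong[of _ _ wedge_list]) (simp add: ep)
    also have "\<dots> = of_int (sign p) *s axis J 1" unfolding wedge_list_permute[OF p] We ..
    finally have "?W f = of_int (sign p)" by (simp add: axis_apply)
    moreover have "(\<Prod>a<k. x a $ e (p a)) = (\<Prod>a<k. x a $ f a)" by (rule prod.cong) (auto simp: ep)
    moreover have "p = (\<lambda>a. if a < k then inv_into {..<k} e (f a) else a)" by (simp add: fun_eq_iff p_def)
    ultimately show ?case by (simp only: mult.commute)
  qed
  finally show ?thesis by (simp add: e_def)
qed

lemma cpull_minor:
  assumes "card I = card J" shows "cpull (cmat M) (axis I 1) $ J = of_real (minor M I J)"
proof -
  let ?L = "sorted_list_of_set I"
  have "map (\<lambda>i. covec (cmat M $ i)) ?L = map (\<lambda>a. covec (cmat M $ (?L ! a))) [0..<card I]"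
    by (rule nth_equalityI) auto
  then have "cpull (cmat M) (axis I 1) $ J = wedge_list (map (\<lambda>a. covec (cmat M $ (?L ! a))) [0..<card I]) $ J"
    by (simp only: cpull_axis)
  also have "\<dots> = of_real (minor M I J)"
    using wedge_list_coefficient[of J "card I" "\<lambda>a. cmat M $ (?L ! a)"] assms
    by (simp add: minor_def cmat_def)
  finally show ?thesis .
qed

lemma ext_inner_eq: "ext_inner g v w = cdot (cpull (cmat (matrix_inv g)) v) (conj_ext w)"
proof -
  let ?P = "\<lambda>I J. cpull (cmat (matrix_inv g)) (axis I 1) $ J"
  have zero: "?P I J = 0" if "card J \<noteq> card I" for I J
    using cpull_ext_degree[OF axis_in_ext_degree[of I 1], of "cmat (matrix_inv g)"] that by (simp add: ext_degree_def)
  have "ext_inner g v w = (\<Sum>I\<in>UNIV. \<Sum>J\<in>{J. card J = card I}. ?P I J * v $ I * cnj (w $ J))"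
    unfolding ext_inner_def by (intro sum.cong refl) (simp add: cpull_minor)
  also have "\<dots> = (\<Sum>I\<in>UNIV. \<Sum>J\<in>UNIV. ?P I J * v $ I * cnj (w $ J))"
    by (intro sum.cong[OF refl] sum.mono_neutral_left) (auto simp: zero)
  also have "\<dots> = (\<Sum>J\<in>UNIV. \<Sum>I\<in>UNIV. ?P I J * v $ I * cnj (w $ J))" by (rule sum.swap)
  also have "\<dots> = cdot (cpull (cmat (matrix_inv g)) v) (conj_ext w)"
    by (simp add: clin_expand[OF clin_cpull, of _ v] cdot_def conj_ext_def sum_distrib_right sum_distrib_left mult_ac)
  finally show ?thesis .
qed

subsection \<open>Two-forms and their powers\<close>

text \<open>For antisymmetric \<open>\<Omega>\<close> this is exterior multiplication by twice the two-form with values \<open>\<Omega>\<^sub>i\<^sub>j\<close> on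
  basis vectors.\<close>

definition two_form :: "('d::{finite,linorder}) cmat \<Rightarrow> 'd ext \<Rightarrow> 'd ext" where
  "two_form \<Omega> v = (\<Sum>i\<in>UNIV. \<Sum>j\<in>UNIV. \<Omega> $ i $ j *s emult (axis i 1) (emult (axis j 1) v))"

lemma clin_two_form: "clin (two_form \<Omega>)"
  unfolding two_form_def
  by (intro clin_summed clin_scaled clin_compose[OF clin_emult clin_emult])

lemma two_form_alt: "two_form \<Omega> v = (\<Sum>i\<in>UNIV. emult (axis i 1) (emult (\<Omega> $ i) v))"
proof -
  have e: "emult (\<Omega> $ i) v = (\<Sum>j\<in>UNIV. \<Omega> $ i $ j *s emult (axis j 1) v)" for i
    by (rule clin_expand[OF clin_emult_left])
  show ?thesis
    by (simp only: e two_form_def clin_sum[OF clin_emult] clin_scale[OF clin_emult])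
qed

lemma two_form_emult: "two_form \<Omega> (emult \<xi> v) = emult \<xi> (two_form \<Omega> v)"
  by (simp add: two_form_def clin_sum[OF clin_emult] clin_scale[OF clin_emult] emult_anticommute[of _ \<xi>] clin_minus[OF clin_emult])

lemma contract_emult: "contract \<eta> (emult \<xi> v) = cdot \<xi> \<eta> *s v - emult \<xi> (contract \<eta> v)"
  using clifford[of \<xi> \<eta> v] by (simp add: algebra_simps)

lemma contract_two_form:
  assumes "transpose \<Omega> = - \<Omega>"
  shows "contract \<eta> (two_form \<Omega> v) = two_form \<Omega> (contract \<eta> v) + 2 *s emult (\<eta> v* \<Omega>) v"
proof -
  have a: "\<Omega> $ j $ i = - \<Omega> $ i $ j" for i j
    using arg_cong[OF assms, of "\<lambda>M. M $ i $ j"] by (simp only: transpose_def vec_lambda_beta uminus_vec_def)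
  have e: "(\<Sum>i\<in>UNIV. \<eta> $ i *s emult (\<Omega> $ i) v) = emult (\<eta> v* \<Omega>) v"
  proof -
    have "emult (\<eta> v* \<Omega>) v = (\<Sum>i\<in>UNIV. \<eta> $ i *s emult (axis i 1 v* \<Omega>) v)"
      by (rule clin_expand[OF clin_compose[OF clin_emult_left clin_vector_matrix]])
    then show ?thesis by (simp only: axis_vector_matrix)
  qed
  have e2: "(\<Sum>i\<in>UNIV. cdot (\<Omega> $ i) \<eta> *s emult (axis i 1) v) = - emult (\<eta> v* \<Omega>) v"
  proof -
    have "cdot (\<Omega> $ i) \<eta> = - (\<eta> v* \<Omega>) $ i" for i
    proof -
      have "cdot (\<Omega> $ i) \<eta> = (\<Sum>j\<in>UNIV. - (\<Omega> $ j $ i) * \<eta> $ j)"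
        unfolding cdot_def by (intro sum.cong refl arg_cong2[where f = "(*)"] a)
      also have "\<dots> = - (\<eta> v* \<Omega>) $ i"
        unfolding vector_matrix_mult_def vec_lambda_beta sum_negf[symmetric] mult_minus_left
        by (simp only: mult.commute)
      finally show ?thesis .
    qed
    then show ?thesis
      by (simp add: clin_expand[OF clin_emult_left, of "\<eta> v* \<Omega>"] sum_negf[symmetric] vec_eq_iff)
  qed
  have "contract \<eta> (two_form \<Omega> v) = (\<Sum>i\<in>UNIV. \<eta> $ i *s emult (\<Omega> $ i) v
      - (cdot (\<Omega> $ i) \<eta> *s emult (axis i 1) v - emult (axis i 1) (emult (\<Omega> $ i) (contract \<eta> v))))"
    by (simp add: two_form_alt clin_sum[OF clin_contract] contract_emult cdot_axis clin_diff[OF clin_emult] clin_scale[OF clin_emult])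
  also have "\<dots> = emult (\<eta> v* \<Omega>) v - (- emult (\<eta> v* \<Omega>) v - two_form \<Omega> (contract \<eta> v))"
    by (simp only: sum_subtractf e e2 two_form_alt)
  finally show ?thesis by (simp add: vec_eq_iff)
qed

text \<open>If \<open>v\<close> has a component on \<open>K\<close> and \<open>i \<notin> K\<close>, then \<open>dx\<^sup>i \<and> v\<close> has a component on \<open>K \<union> {i}\<close>.\<close>

lemma emult_zero_imp_top:
  assumes "\<And>\<xi>. emult \<xi> v = 0" "v \<in> ext_degree k" "k < CARD('d)"
  shows "v = (0 :: ('d::{finite,linorder}) ext)"
proof -
  have "v $ K = 0" for K
  proof (cases "card K = k")
    case True
    then have "K \<noteq> UNIV" using assms(3) by auto
    then obtain i where i: "i \<notin> K" by auto
    have "emult (axis i 1) v $ insert i K = 0" using assms(1) by simp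
    then show ?thesis using i by (simp add: emult_axis shuffle_sign_nonzero)
  qed (use assms(2) in \<open>simp add: ext_degree_def\<close>)
  then show ?thesis by (simp add: vec_eq_iff)
qed

lemma two_form_ext_degree: "v \<in> ext_degree k \<Longrightarrow> two_form \<Omega> v \<in> ext_degree (k + 2)"
  using emult_ext_degree[OF emult_ext_degree, of v k] unfolding two_form_def
  by (intro ext_degree_sum ext_degree_scale) simp

text \<open>A nondegenerate two-form has nonzero powers up to the top degree: contraction acts on powers
  as a derivation, so if one power vanishes, all covectors annihilate the preceding one.\<close>

lemma two_form_power_nonzero:
  fixes \<Omega> :: "('d::{finite,linorder}) cmat"
  assumes anti: "transpose \<Omega> = - \<Omega>" and inv: "B ** \<Omega> = mat 1"
  shows "2 * k \<le> CARD('d) \<Longrightarrow> (two_form \<Omega> ^^ k) (axis {} 1) \<noteq> 0"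
proof -
  let ?w = "\<lambda>k. (two_form \<Omega> ^^ k) (axis {} 1)"
  have deg: "?w k \<in> ext_degree (2 * k)" for k
  proof (induction k)
    case 0
    then show ?case using axis_in_ext_degree[of "{}" 1] by simp
  next
    case (Suc k)
    then show ?case using two_form_ext_degree[OF Suc, of \<Omega>] by simp
  qed
  have contr: "contract \<eta> (?w (Suc k)) = of_nat (2 * Suc k) *s emult (\<eta> v* \<Omega>) (?w k)" for \<eta> k
  proof (induction k)
    case 0
    then show ?case by (simp add: contract_two_form[OF anti] contract_one clin_zero[OF clin_two_form])
  next
    case (Suc k)
    have "contract \<eta> (?w (Suc (Suc k))) = two_form \<Omega> (contract \<eta> (?w (Suc k))) + 2 *s emult (\<eta> v* \<Omega>) (?w (Suc k))"
      by (simp add: contract_two_form[OF anti])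
    also have "\<dots> = of_nat (2 * Suc k) *s emult (\<eta> v* \<Omega>) (?w (Suc k)) + 2 *s emult (\<eta> v* \<Omega>) (?w (Suc k))"
      unfolding Suc.IH by (simp only: clin_scale[OF clin_two_form] two_form_emult funpow.simps o_apply)
    also have "\<dots> = of_nat (2 * Suc (Suc k)) *s emult (\<eta> v* \<Omega>) (?w (Suc k))"
      unfolding vector_sadd_rdistrib[symmetric] by simp
    finally show ?case .
  qed
  show "2 * k \<le> CARD('d) \<Longrightarrow> ?w k \<noteq> 0"
  proof (induction k)
    case 0
    then show ?case by (simp add: axis_eq_0_iff)
  next
    case (Suc k)
    show ?case
    proof
      assume 0: "?w (Suc k) = 0"
      have "emult \<xi> (?w k) = 0" for \<xi>
      proof -
        have "of_nat (2 * Suc k) *s emult ((\<xi> v* B) v* \<Omega>) (?w k) = 0"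
          using contr[of "\<xi> v* B" k] by (simp only: 0 clin_zero[OF clin_contract])
        then show ?thesis by (simp add: vector_matrix_mul_assoc inv del: of_nat_mult of_nat_Suc)
      qed
      from emult_zero_imp_top[OF this deg] Suc show False by simp
    qed
  qed
qed

lemma cpull_two_form:
  "cpull D (two_form \<Omega> v) = two_form (transpose D ** \<Omega> ** D) (cpull D v)"
proof -
  have "cpull D (two_form \<Omega> v) = (\<Sum>i\<in>UNIV. \<Sum>j\<in>UNIV. \<Omega> $ i $ j *s emult (D $ i) (emult (D $ j) (cpull D v)))"
    by (simp add: two_form_def clin_sum[OF clin_cpull] clin_scale[OF clin_cpull] cpull_emult axis_vector_matrix)
  also have "\<dots> = (\<Sum>i\<in>UNIV. \<Sum>j\<in>UNIV. \<Sum>k\<in>UNIV. \<Sum>l\<in>UNIV.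
      (D $ i $ k * \<Omega> $ i $ j * D $ j $ l) *s emult (axis k 1) (emult (axis l 1) (cpull D v)))" (is "_ = ?S")
  proof (intro sum.cong refl)
    fix i j
    have "emult (D $ i) (emult (D $ j) w) = (\<Sum>k\<in>UNIV. \<Sum>l\<in>UNIV. (D $ i $ k * D $ j $ l) *s emult (axis k 1) (emult (axis l 1) w))" for w
    proof -
      have "emult (D $ i) (emult (D $ j) w) = (\<Sum>k\<in>UNIV. D $ i $ k *s emult (axis k 1) (emult (D $ j) w))"
        by (rule clin_expand[OF clin_emult_left])
      moreover have "emult (D $ j) w = (\<Sum>l\<in>UNIV. D $ j $ l *s emult (axis l 1) w)"
        by (rule clin_expand[OF clin_emult_left])
      ultimately show ?thesis
        by (simp only: clin_sum[OF clin_emult] clin_scale[OF clin_emult] vec.scale_sum_right vector_smult_assoc)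
    qed
    then show "\<Omega> $ i $ j *s emult (D $ i) (emult (D $ j) (cpull D v)) = (\<Sum>k\<in>UNIV. \<Sum>l\<in>UNIV.
      (D $ i $ k * \<Omega> $ i $ j * D $ j $ l) *s emult (axis k 1) (emult (axis l 1) (cpull D v)))"
      by (simp add: vec.scale_sum_right vector_smult_assoc mult_ac)
  qed
  also have "?S = (\<Sum>k\<in>UNIV. \<Sum>l\<in>UNIV. (\<Sum>j\<in>UNIV. \<Sum>i\<in>UNIV. D $ i $ k * \<Omega> $ i $ j * D $ j $ l)
       *s emult (axis k 1) (emult (axis l 1) (cpull D v)))"
  proof -
    have "(\<Sum>i\<in>UNIV. \<Sum>j\<in>UNIV. \<Sum>k\<in>UNIV. \<Sum>l\<in>UNIV. F i j k l) = (\<Sum>k\<in>UNIV. \<Sum>l\<in>UNIV. \<Sum>j\<in>UNIV. \<Sum>i\<in>UNIV. F i j k l)"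
      for F :: "'a \<Rightarrow> 'a \<Rightarrow> 'a \<Rightarrow> 'a \<Rightarrow> 'a ext"
    proof -
      have "(\<Sum>i\<in>UNIV. \<Sum>j\<in>UNIV. \<Sum>k\<in>UNIV. \<Sum>l\<in>UNIV. F i j k l) = (\<Sum>i\<in>UNIV. \<Sum>k\<in>UNIV. \<Sum>j\<in>UNIV. \<Sum>l\<in>UNIV. F i j k l)"
        by (intro sum.cong[OF refl] sum.swap)
      also have "\<dots> = (\<Sum>k\<in>UNIV. \<Sum>i\<in>UNIV. \<Sum>j\<in>UNIV. \<Sum>l\<in>UNIV. F i j k l)" by (rule sum.swap)
      also have "\<dots> = (\<Sum>k\<in>UNIV. \<Sum>i\<in>UNIV. \<Sum>l\<in>UNIV. \<Sum>j\<in>UNIV. F i j k l)"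
        by (intro sum.cong[OF refl] sum.swap)
      also have "\<dots> = (\<Sum>k\<in>UNIV. \<Sum>l\<in>UNIV. \<Sum>i\<in>UNIV. \<Sum>j\<in>UNIV. F i j k l)"
        by (intro sum.cong[OF refl] sum.swap)
      also have "\<dots> = (\<Sum>k\<in>UNIV. \<Sum>l\<in>UNIV. \<Sum>j\<in>UNIV. \<Sum>i\<in>UNIV. F i j k l)"
        by (intro sum.cong[OF refl] sum.swap)
      finally show ?thesis .
    qed
    then show ?thesis by (simp add: vec.scale_sum_left)
  qed
  also have "\<dots> = two_form (transpose D ** \<Omega> ** D) (cpull D v)"
    by (simp add: two_form_def matrix_matrix_mult_def transpose_def sum_distrib_right)
  finally show ?thesis .
qed

lemma two_form_mscale: "two_form (mscale c \<Omega>) v = c *s two_form \<Omega> v"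
  by (simp add: two_form_def mscale_def vec.scale_sum_right vector_smult_assoc)

section \<open>Hermitian linear algebra\<close>

subsection \<open>The volume form\<close>

lemma card_compl: "card (- K) = CARD('a) - card (K :: 'a::finite set)"
  by (simp add: Compl_eq_Diff_UNIV card_Diff_subset)

lemma complement_ext_degree:
  fixes v :: "('d::{finite,linorder}) ext"
  shows "v \<in> ext_degree k \<Longrightarrow> complement v \<in> ext_degree (CARD('d) - k)"
proof -
  assume v: "v \<in> ext_degree k"
  have "v $ (- K) = 0" if "card K \<noteq> CARD('d) - k" for K :: "'d set"
  proof -
    have "card (- K) = CARD('d) - card K" by (rule card_compl)
    moreover have "card K \<le> CARD('d)" by (simp add: card_mono)
    ultimately have "card (- K) \<noteq> k" using that by linarith
    then show ?thesis using v by (simp add: ext_degree_def)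
  qed
  then show ?thesis by (simp add: ext_degree_def complement_nth)
qed

lemma cdot_complement: "cdot (complement v) (complement w) = cdot v w"
proof -
  have "cdot (complement v) (complement w)
      = (\<Sum>K\<in>UNIV. (shuffle_sign (- K) K * shuffle_sign (- K) K) * (v $ (- K) * w $ (- K)))"
    by (simp add: cdot_def complement_nth mult_ac)
  also have "\<dots> = (\<Sum>K\<in>UNIV. v $ (- K) * w $ (- K))" by (simp add: shuffle_sign_square)
  also have "\<dots> = cdot v w"
    unfolding cdot_def by (rule sum.reindex_bij_witness[of _ uminus uminus]) auto
  finally show ?thesis .
qed

lemma wedge_ext_degree:
  assumes "v \<in> ext_degree k" "w \<in> ext_degree l" shows "wedge v w \<in> ext_degree (k + l)"
proof -
  have "v $ I * w $ (K - I) = 0" if "card K \<noteq> k + l" "I \<subseteq> K" for I K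
  proof -
    have "card I + card (K - I) = card K" using that(2) by (simp add: card_Diff_subset card_mono)
    then have "card I \<noteq> k \<or> card (K - I) \<noteq> l" using that(1) by auto
    then show ?thesis using assms by (auto simp: ext_degree_def)
  qed
  then show ?thesis by (auto simp: ext_degree_def wedge_def mult.assoc intro!: sum.neutral)
qed

lemma conj_ext_conj_ext [simp]: "conj_ext (conj_ext v) = v"
  by (simp add: conj_ext_def vec_eq_iff)

lemma conj_ext_degree: "v \<in> ext_degree k \<Longrightarrow> conj_ext v \<in> ext_degree k"
  by (simp add: ext_degree_def conj_ext_def)

lemma matrix_minus_left: "(- A) ** B = - (A ** (B :: ('a::comm_ring_1, 'n::finite) vec^'m))"
  by (simp add: matrix_matrix_mult_def vec_eq_iff sum_negf)

lemma matrix_minus_right: "A ** (- B) = - (A ** (B :: ('a::comm_ring_1, 'n::finite) vec^'m))"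
  by (simp add: matrix_matrix_mult_def vec_eq_iff sum_negf)

lemma transpose_minus: "transpose (- A) = - transpose A"
  by (simp add: transpose_def vec_eq_iff)

lemma cmat_mult: "cmat (A ** B) = cmat A ** cmat B"
  by (simp add: cmat_def matrix_matrix_mult_def vec_eq_iff)

lemma cmat_one: "cmat (mat 1) = mat 1"
  by (simp add: cmat_def mat_def vec_eq_iff)

lemma cmat_transpose: "cmat (transpose A) = transpose (cmat A)"
  by (simp add: cmat_def transpose_def vec_eq_iff)

lemma cmat_minus: "cmat (- A) = - cmat A"
  by (simp add: cmat_def vec_eq_iff)

definition omega_matrix :: "'d rmat \<Rightarrow> 'd rmat \<Rightarrow> ('d::finite) rmat" where
  "omega_matrix J g = transpose J ** g"

lemma omega_matrix_nth: "omega_matrix J g $ i $ j = (J *v axis i 1) \<bullet> (g *v axis j 1)"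
  by (simp add: omega_matrix_def matrix_matrix_mult_def transpose_def inner_vec_def matrix_vector_mult_basis column_def)

text \<open>The sum over \<open>i < j\<close> is half the sum over all pairs: the summand is symmetric, as both the
  coefficient and the product of the two covectors change sign.\<close>

lemma wedge_fund_form:
  assumes anti: "transpose (omega_matrix J g) = - omega_matrix J g"
  shows "2 *s wedge (fund_form J g) v = two_form (cmat (omega_matrix J g)) v"
proof -
  let ?\<Omega> = "cmat (omega_matrix J g)"
  define F where "F i j = ?\<Omega> $ i $ j *s emult (axis i 1) (emult (axis j 1) v)" for i j
  have a: "?\<Omega> $ j $ i = - ?\<Omega> $ i $ j" for i j
    using arg_cong[OF anti, of "\<lambda>M. M $ i $ j"] by (simp add: transpose_def cmat_def)
  have sym: "F j i = F i j" for i j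
    unfolding F_def a[of j i] emult_anticommute[of "axis j 1"] by simp
  have diag: "F i i = 0" for i by (simp add: F_def emult_self)
  have fund: "wedge (fund_form J g) v = (\<Sum>i\<in>UNIV. \<Sum>j\<in>{i<..}. F i j)"
    by (simp add: fund_form_def F_def clin_sum[OF clin_wedge_left] wedge_scale_left emult_def[symmetric] emult_wedge[symmetric]
         omega_matrix_nth[symmetric] cmat_def)
  have "(\<Sum>j\<in>UNIV. F i j) = (\<Sum>j\<in>{i<..}. F i j) + (\<Sum>j\<in>{..<i}. F i j)" for i
  proof -
    have "(UNIV :: 'a set) = insert i ({i<..} \<union> {..<i})" by auto
    then have "(\<Sum>j\<in>UNIV. F i j) = (\<Sum>j\<in>insert i ({i<..} \<union> {..<i}). F i j)" by (rule arg_cong)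
    also have "\<dots> = (\<Sum>j\<in>{i<..}. F i j) + (\<Sum>j\<in>{..<i}. F i j)"
      by (subst sum.insert) (auto simp: diag intro!: sum.union_disjoint)
    finally show ?thesis .
  qed
  moreover have "(\<Sum>i\<in>UNIV. \<Sum>j\<in>{..<i}. F i j) = (\<Sum>i\<in>UNIV. \<Sum>j\<in>{i<..}. F i j)"
  proof -
    have "(\<Sum>i\<in>UNIV. \<Sum>j\<in>{..<i}. F i j) = (\<Sum>(i, j)\<in>(SIGMA i:UNIV. {..<i}). F i j)"
      by (rule sum.Sigma) auto
    also have "\<dots> = (\<Sum>(i, j)\<in>(SIGMA i:UNIV. {i<..}). F i j)"
      by (rule sum.reindex_bij_witness[of _ "\<lambda>(i, j). (j, i)" "\<lambda>(i, j). (j, i)"]) (auto simp: sym)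
    also have "\<dots> = (\<Sum>i\<in>UNIV. \<Sum>j\<in>{i<..}. F i j)" by (rule sum.Sigma[symmetric]) auto
    finally show ?thesis .
  qed
  ultimately have "(\<Sum>i\<in>UNIV. \<Sum>j\<in>UNIV. F i j) = (\<Sum>i\<in>UNIV. \<Sum>j\<in>{i<..}. F i j) + (\<Sum>i\<in>UNIV. \<Sum>j\<in>{i<..}. F i j)"
    by (simp add: sum.distrib)
  then show ?thesis by (simp only: two_form_def F_def[symmetric] fund) (simp add: vec_eq_iff)
qed

lemma wedge_list_replicate_fund:
  assumes "transpose (omega_matrix J g) = - omega_matrix J g"
  shows "2 ^ k *s wedge_list (replicate k (fund_form J g)) = (two_form (cmat (omega_matrix J g)) ^^ k) (axis {} 1)"
proof (induction k)
  case (Suc k)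
  have "2 ^ Suc k *s wedge_list (replicate (Suc k) (fund_form J g))
      = 2 *s wedge (fund_form J g) (2 ^ k *s wedge_list (replicate k (fund_form J g)))"
    by (simp add: wedge_scale_right vector_smult_assoc)
  then show ?case by (simp only: Suc wedge_fund_form[OF assms] funpow.simps o_apply)
qed simp

text \<open>A tangent space with its structures, in coordinates.\<close>

locale hermitian_space =
  fixes n :: nat and J g :: "('d::{finite,linorder}) rmat"
  assumes card: "CARD('d) = 2 * n"
    and JJ: "J ** J = - mat 1"
    and sym: "transpose g = g"
    and pos: "\<And>v. v \<noteq> 0 \<Longrightarrow> v \<bullet> (g *v v) > 0"
    and compat: "\<And>u v. (J *v u) \<bullet> (g *v (J *v v)) = u \<bullet> (g *v v)"
begin

lemma g_invertible: "invertible g"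
proof -
  have "inj ((*v) g)"
  proof (rule injI)
    fix u v assume "g *v u = g *v v"
    then have "(u - v) \<bullet> (g *v (u - v)) = 0" by (simp add: matrix_vector_mult_diff_distrib)
    then show "u = v" using pos[of "u - v"] by force
  qed
  then show ?thesis using invertible_left_inverse matrix_left_invertible_injective by blast
qed

abbreviation ginv where "ginv \<equiv> matrix_inv g"
abbreviation G where "G \<equiv> cmat ginv"

lemma ginv: "g ** ginv = mat 1" "ginv ** g = mat 1"
  using matrix_inv[OF g_invertible] by auto

lemma ginv_sym: "transpose ginv = ginv"
proof -
  have "transpose ginv ** g = mat 1"
    using arg_cong[OF ginv(1), of transpose] by (simp add: matrix_transpose_mul sym)
  then have "transpose ginv ** g ** ginv = ginv" by simp
  then show ?thesis by (simp add: matrix_mul_assoc[symmetric] ginv)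
qed

lemma G_sym: "transpose G = G"
  by (simp add: cmat_transpose[symmetric] ginv_sym)

lemma JgJ: "transpose J ** g ** J = g"
proof -
  have "u \<bullet> ((transpose J ** g ** J) *v v) = u \<bullet> (g *v v)" for u v
    using compat[of u v]
    by (metis dot_lmul_matrix matrix_vector_mul_assoc transpose_matrix_vector transpose_transpose)
  then have "(transpose J ** g ** J) *v v = g *v v" for v
    by (metis vector_eq_rdot inner_commute)
  then show ?thesis by (simp add: matrix_eq)
qed

lemma omega_anti: "transpose (omega_matrix J g) = - omega_matrix J g"
proof -
  have "- (transpose J ** g) = transpose J ** g ** (J ** J)"
    by (simp add: JJ matrix_minus_right)
  also have "\<dots> = g ** J" by (simp add: matrix_mul_assoc JgJ)
  finally show ?thesis by (simp add: omega_matrix_def matrix_transpose_mul sym)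
qed

lemma omega_inverse: "cmat (- (ginv ** transpose J)) ** cmat (omega_matrix J g) = mat 1"
proof -
  have "transpose J ** transpose J = - mat 1"
    using arg_cong[OF JJ, of transpose] by (simp add: matrix_transpose_mul transpose_minus transpose_mat)
  moreover have "(ginv ** transpose J) ** (transpose J ** g) = - mat 1" if "transpose J ** transpose J = - mat 1"
  proof -
    have "(ginv ** transpose J) ** (transpose J ** g) = ginv ** (transpose J ** transpose J) ** g"
      by (simp only: matrix_mul_assoc)
    then show ?thesis unfolding that by (simp add: matrix_minus_left matrix_minus_right ginv)
  qed
  ultimately show ?thesis
    by (simp add: cmat_mult[symmetric] omega_matrix_def matrix_minus_left cmat_one)
qed

definition \<tau> :: complex where "\<tau> = vol_form n J g $ UNIV"

lemma vol_form_two_form: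
  "vol_form n J g = (1 / (2 ^ n * fact n)) *s (two_form (cmat (omega_matrix J g)) ^^ n) (axis {} 1)"
  by (simp add: vol_form_def wedge_list_replicate_fund[OF omega_anti, symmetric] vector_smult_assoc)

lemma vol_form_eq: "vol_form n J g = \<tau> *s axis UNIV 1"
proof -
  have "(two_form \<Omega> ^^ k) (axis {} 1) \<in> ext_degree (2 * k)" for \<Omega> :: "'d cmat" and k
  proof (induction k)
    case 0
    then show ?case using axis_in_ext_degree[of "{}" 1] by simp
  next
    case (Suc k)
    then show ?case using two_form_ext_degree[OF Suc] by simp
  qed
  then have "vol_form n J g \<in> ext_degree CARD('d)"
    unfolding vol_form_two_form card by (rule ext_degree_scale)
  from top_degree[OF this] show ?thesis unfolding \<tau>_def .
qed

lemma \<tau>_nonzero: "\<tau> \<noteq> 0"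
proof
  assume "\<tau> = 0"
  then have "vol_form n J g = 0" by (simp add: vol_form_eq)
  then have "(two_form (cmat (omega_matrix J g)) ^^ n) (axis {} 1) = 0"
    by (simp add: vol_form_two_form)
  moreover have "transpose (cmat (omega_matrix J g)) = - cmat (omega_matrix J g)"
    using omega_anti by (metis cmat_minus cmat_transpose)
  ultimately show False using two_form_power_nonzero[OF _ omega_inverse, of n] card by simp
qed

subsection \<open>The Hodge star\<close>

definition star :: "'d ext \<Rightarrow> 'd ext" where
  "star v = \<tau> *s complement (cpull G v)"

lemma clin_star: "clin star"
  unfolding star_def[abs_def] by (rule clin_scaled[OF clin_compose[OF clin_complement clin_cpull]])

lemma star_ext_degree: "v \<in> ext_degree k \<Longrightarrow> star v \<in> ext_degree (2 * n - k)"
  unfolding star_def card[symmetric] by (intro ext_degree_scale complement_ext_degree cpull_ext_degree)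

lemma wedge_star:
  assumes "k \<le> 2 * n" "\<alpha> \<in> ext_degree k" "\<beta> \<in> ext_degree k"
  shows "wedge \<alpha> (star (conj_ext \<beta>)) = ext_inner g \<alpha> \<beta> *s vol_form n J g"
proof -
  have "wedge \<alpha> (star (conj_ext \<beta>)) \<in> ext_degree CARD('d)"
    using wedge_ext_degree[OF assms(2) star_ext_degree[OF conj_ext_degree[OF assms(3)]]] assms(1) by (simp add: card)
  from top_degree[OF this] have "wedge \<alpha> (star (conj_ext \<beta>)) = wedge \<alpha> (star (conj_ext \<beta>)) $ UNIV *s axis UNIV 1" .
  moreover have "wedge \<alpha> (star (conj_ext \<beta>)) $ UNIV = ext_inner g \<alpha> \<beta> * \<tau>"
    by (simp add: wedge_top star_def cdot_simps cdot_complement ext_inner_eq cdot_cpull G_sym)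
  ultimately show ?thesis by (simp only: vol_form_eq vector_smult_assoc)
qed

text \<open>A map with the properties of the star is determined by testing \<open>* dx\<^sup>I\<close> against the basis forms in
  degree \<open>|I|\<close>: in complementary degree the wedge product is a perfect pairing.\<close>

lemma hodge_star_eq: "hodge_star n J g = star"
  unfolding hodge_star_def
proof (rule the_equality)
  show "clin star \<and> (\<forall>k\<le>2 * n. \<forall>\<alpha>\<in>ext_degree k. \<forall>\<beta>\<in>ext_degree k.
      star (conj_ext \<beta>) \<in> ext_degree (2 * n - k) \<and>
      wedge \<alpha> (star (conj_ext \<beta>)) = ext_inner g \<alpha> \<beta> *s vol_form n J g)"
    by (auto simp: clin_star wedge_star star_ext_degree conj_ext_degree)
next
  fix S assume S: "clin S \<and> (\<forall>k\<le>2 * n. \<forall>\<alpha>\<in>ext_degree k. \<forall>\<beta>\<in>ext_degree k.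
      S (conj_ext \<beta>) \<in> ext_degree (2 * n - k) \<and>
      wedge \<alpha> (S (conj_ext \<beta>)) = ext_inner g \<alpha> \<beta> *s vol_form n J g)"
  have "S (axis I 1) = star (axis I 1)" for I
  proof -
    define k where "k = card I"
    define \<beta> :: "'d ext" where "\<beta> = conj_ext (axis I 1)"
    have k: "k \<le> 2 * n" unfolding k_def card[symmetric] by (simp add: card_mono)
    have \<beta>: "\<beta> \<in> ext_degree k" "conj_ext \<beta> = axis I 1"
      by (simp_all add: \<beta>_def k_def conj_ext_degree axis_in_ext_degree)
    have deg: "S (axis I 1) \<in> ext_degree (2 * n - k)" "star (axis I 1) \<in> ext_degree (2 * n - k)"
      using S k \<beta> star_ext_degree[OF axis_in_ext_degree[of I 1]] by (auto simp: k_def) (metis k_def)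
    have eq: "wedge \<alpha> (S (axis I 1)) = wedge \<alpha> (star (axis I 1))" if "\<alpha> \<in> ext_degree k" for \<alpha>
      using S k \<beta> wedge_star[OF k that \<beta>(1)] that by metis
    have "S (axis I 1) $ K = star (axis I 1) $ K" for K
    proof (cases "card K = 2 * n - k")
      case True
      have "card (- K) = k" using True k card by (simp add: card_compl)
      then have "axis (- K) 1 \<in> ext_degree k" using axis_in_ext_degree[of "- K" 1] by simp
      from arg_cong[OF eq[OF this], of "\<lambda>v. v $ UNIV"]
      show ?thesis by (simp add: wedge_axis_left Diff_eq shuffle_sign_nonzero)
    qed (use deg in \<open>simp add: ext_degree_def\<close>)
    then show ?thesis by (simp add: vec_eq_iff)
  qed
  then show "S = star" using clin_eqI[of S star] S clin_star by blast
qed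

text \<open>The factor between the star-conjugate of a wedge multiplication and a contraction.\<close>

definition \<kappa> :: complex where "\<kappa> = \<tau>\<^sup>2 * top_factor G"

lemma \<kappa>_nonzero: "\<kappa> \<noteq> 0"
proof -
  have "G ** cmat g = mat 1" by (simp add: cmat_mult[symmetric] ginv cmat_one)
  then show ?thesis using \<tau>_nonzero top_factor_nonzero by (simp add: \<kappa>_def)
qed

text \<open>Moving the first \<open>G\<close> to the right past the covector leaves \<open>G\<close>, \<open>complement\<close>, \<open>G\<close> acting on \<open>v\<close>, which is
  \<open>complement\<close> up to the determinant; what remains is the flat identity.\<close>

lemma star_emult_star: "star (emult \<xi> (star v)) = \<kappa> *s contract (\<xi> v* G) v"
proof -
  have "cpull G (complement (cpull G v)) = top_factor G *s complement v"
    using complement_cpull[of G v] by (simp add: G_sym)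
  moreover have "even CARD('d)" by (simp add: card)
  ultimately show ?thesis
    by (simp add: star_def clin_scale[OF clin_emult] clin_scale[OF clin_cpull] clin_scale[OF clin_complement]
       cpull_emult complement_emult_complement \<kappa>_def vector_smult_assoc power2_eq_square mult_ac)
qed

end

lemma top_factor_transpose: "top_factor (transpose D) = top_factor D"
  using cdot_cpull[of D "axis UNIV 1" "axis UNIV 1"] by (simp add: top_factor_def cdot_axis)

text \<open>How the star transforms under a linear map that scales the fundamental form and the inverse
  metric by \<open>s\<close>. For \<open>s = 1\<close> this is the naturality of the star; for the matrix that separates the
  types of covectors, where \<open>s = 6\<close>, it tells how the star acts on bidegrees. The power \<open>s\<^sup>k\<close> comes from
  the inner product on forms of degree \<open>k\<close> and \<open>s\<^sup>n\<close> from the volume form \<open>\<omega>\<^sup>n/n!\<close>.\<close>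

lemma star_scaling:
  assumes h: "hermitian_space n J g" and h': "hermitian_space n J' g'"
    and \<omega>: "transpose D ** cmat (omega_matrix J' g') ** D = mscale s (cmat (omega_matrix J g))"
    and gi: "D ** cmat (matrix_inv g) ** transpose D = mscale s (cmat (matrix_inv g'))"
    and v: "v \<in> ext_degree k"
  shows "s ^ k *s cpull D (hermitian_space.star n J' g' v) = s ^ n *s hermitian_space.star n J g (cpull D v)"
proof -
  interpret h: hermitian_space n J g by (rule h)
  interpret h': hermitian_space n J' g' by (rule h')
  have pow: "cpull D ((two_form (cmat (omega_matrix J' g')) ^^ k) (axis {} 1))
     = s ^ k *s (two_form (cmat (omega_matrix J g)) ^^ k) (axis {} 1)" for k
    by (induction k) (simp_all add: cpull_one cpull_two_form \<omega> two_form_mscale clin_scale[OF clin_two_form] vector_smult_assoc)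
  have "cpull D (vol_form n J' g') = s ^ n *s vol_form n J g"
    by (simp add: h.vol_form_two_form h'.vol_form_two_form clin_scale[OF clin_cpull] pow vector_smult_assoc mult.commute)
  then have t: "h'.\<tau> * top_factor D = s ^ n * h.\<tau>"
    using cpull_top[of D "vol_form n J' g'"] by (simp add: h.\<tau>_def h'.\<tau>_def)
  have "cpull (transpose D) (cpull h.G (cpull D v)) = s ^ k *s cpull h'.G v"
    by (simp add: cpull_compose gi cpull_mscale[OF v])
  then have "s ^ k *s cpull D (complement (cpull h'.G v)) = cpull D (complement (cpull (transpose D) (cpull h.G (cpull D v))))"
    by (simp add: clin_scale[OF clin_cpull] clin_scale[OF clin_complement])
  also have "\<dots> = top_factor D *s complement (cpull h.G (cpull D v))" (is "_ = _ *s ?X")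
    using complement_cpull[of "transpose D"] by (simp add: top_factor_transpose)
  finally have "s ^ k *s cpull D (complement (cpull h'.G v)) = top_factor D *s ?X" .
  then have "h'.\<tau> *s (s ^ k *s cpull D (complement (cpull h'.G v))) = (s ^ n * h.\<tau>) *s ?X"
    by (simp only: vector_smult_assoc t[symmetric])
  then show ?thesis
    by (simp only: h.star_def h'.star_def clin_scale[OF clin_cpull] vector_smult_assoc mult.commute)
qed

section \<open>The bidegree decomposition\<close>

subsection \<open>Bidegrees as eigenvalues\<close>

lemma span_linear_induct [consumes 1, case_names subspace base]:
  assumes "v \<in> vec.span S" "vec.subspace {v. P v}" "\<And>v. v \<in> S \<Longrightarrow> P v" shows "P v"
  using vec.span_induct[OF assms(1), of P] assms(2,3) by simp

lemma subspace_preimage: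
  assumes "clin f" "vec.subspace S" shows "vec.subspace {v. f v \<in> S}"
  using assms(2) by (simp add: vec.subspace_def clin_zero[OF assms(1)] clin_add[OF assms(1)] clin_scale[OF assms(1)])

lemma matrix_add_rdistrib: "(A + B) ** C = A ** C + B ** (C :: ('a::comm_ring_1, 'n::finite) vec^'m)"
  by (simp add: matrix_matrix_mult_def vec_eq_iff distrib_right sum.distrib)

lemma mscale_mult_left: "mscale c A ** B = mscale c (A ** B)"
  by (simp add: mscale_def matrix_matrix_mult_def vec_eq_iff sum_distrib_left mult_ac)

lemma mscale_mult_right: "A ** mscale c B = mscale c (A ** B)"
  by (simp add: mscale_def matrix_matrix_mult_def vec_eq_iff sum_distrib_left mult_ac)

lemma transpose_mscale: "transpose (mscale c A) = mscale c (transpose A)"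
  by (simp add: mscale_def transpose_def vec_eq_iff)

lemma transpose_add: "transpose (A + B) = transpose A + transpose B"
  by (simp add: transpose_def vec_eq_iff)

lemma vector_matrix_mscale: "\<xi> v* mscale c A = c *s (\<xi> v* A)"
  by (simp add: mscale_def vector_matrix_mult_def vec_eq_iff sum_distrib_left mult_ac)

lemma vector_matrix_add: "\<xi> v* (A + B) = \<xi> v* A + \<xi> v* (B :: ('a::comm_ring_1, 'n::finite) vec^'m)"
  by (simp add: vector_matrix_mult_def vec_eq_iff distrib_left distrib_right sum.distrib)

text \<open>If \<open>C\<close> is a complex structure, then \<open>twist C\<close> acts on covectors of type \<open>(1,0)\<close> as 2 and on
  those of type \<open>(0,1)\<close> as 3. On forms of bidegree \<open>(p,q)\<close> the induced map therefore acts as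
  \<open>2\<^sup>p 3\<^sup>q\<close>, and by unique factorization this number determines \<open>(p,q)\<close>.\<close>

definition twist :: "'d cmat \<Rightarrow> ('d::finite) cmat" where
  "twist C = mscale (5 / 2) (mat 1) + mscale (\<i> / 2) C"

lemma twist_transpose: "twist (transpose C) = transpose (twist C)"
  by (simp add: twist_def transpose_add transpose_mscale transpose_mat)

lemma twist_intertwine: "C' ** D = D ** C \<Longrightarrow> twist C' ** D = D ** twist C" for D :: "('d::finite) cmat"
  by (simp add: twist_def matrix_add_ldistrib matrix_add_rdistrib mscale_mult_left mscale_mult_right)

text \<open>As \<open>twist C = (5 + \<i> C)/2\<close>, the mixed terms cancel by the first assumption, and the others give
  \<open>(25 - 1)/4 = 6\<close>, which is the product of the two eigenvalues 2 and 3.\<close>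

lemma twist_congruence:
  assumes "C ** M + M ** transpose C = 0" "C ** M ** transpose C = M"
  shows "twist C ** M ** transpose (twist C) = mscale 6 M"
proof -
  have e: "M ** transpose C = - (C ** M)" using assms(1) by (simp add: eq_neg_iff_add_eq_0 add.commute)
  have "twist C ** M ** transpose (twist C) =
     mscale (25 / 4) M + mscale (5 * \<i> / 4) (C ** M) + mscale (5 * \<i> / 4) (M ** transpose C) + mscale (- 1 / 4) (C ** M ** transpose C)"
    by (simp add: twist_def matrix_add_ldistrib matrix_add_rdistrib mscale_mult_left mscale_mult_right
         transpose_add transpose_mscale transpose_mat)
       (simp add: mscale_def vec_eq_iff algebra_simps)
  then show ?thesis unfolding assms(2) unfolding e
    by (simp add: mscale_def vec_eq_iff algebra_simps)
qed

abbreviation bideg_op :: "'d rmat \<Rightarrow> ('d::{finite,linorder}) ext \<Rightarrow> 'd ext" where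
  "bideg_op J \<equiv> cpull (twist (cmat J))"

definition ev :: "nat \<Rightarrow> nat \<Rightarrow> complex" where "ev p q = 2 ^ p * 3 ^ q"

lemma ev_inject: "ev p q = ev r s \<longleftrightarrow> p = r \<and> q = s"
proof
  assume "ev p q = ev r s"
  then have "of_nat (2 ^ p * 3 ^ q) = (of_nat (2 ^ r * 3 ^ s) :: complex)" by (simp add: ev_def)
  then have e: "(2 ^ p * 3 ^ q :: nat) = 2 ^ r * 3 ^ s" by (simp only: of_nat_eq_iff)
  have *: "p = r" if "(2 ^ p * 3 ^ q :: nat) = 2 ^ r * 3 ^ s" "p \<le> r" for p q r s
  proof (rule ccontr)
    assume "p \<noteq> r"
    then have "2 ^ r = (2 ^ p * 2 ^ (r - p) :: nat)" using that(2) by (simp add: power_add[symmetric])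
    then have "(3 ^ q :: nat) = 2 ^ (r - p) * 3 ^ s" using that(1) by simp
    moreover have "even ((2::nat) ^ (r - p) * 3 ^ s)" using \<open>p \<noteq> r\<close> that(2) by simp
    ultimately have "even ((3::nat) ^ q)" by (simp only:)
    then show False by simp
  qed
  have "p = r" using *[OF e] *[OF e[symmetric]] by (metis nle_le)
  then show "p = r \<and> q = s" using e by simp
qed simp

lemma pq_space_eigen:
  assumes "v \<in> pq_space J p q" shows "bideg_op J v = ev p q *s v"
proof -
  have T: "\<xi> v* twist (cmat J) = 2 *s \<xi>" if "\<xi> \<in> eigen_covectors \<i> J" for \<xi>
    using that by (simp add: eigen_covectors_def cmat_def[symmetric] twist_def vector_matrix_add vector_matrix_mscale)
      (simp add: vec_eq_iff)
  have T': "\<xi> v* twist (cmat J) = 3 *s \<xi>" if "\<xi> \<in> eigen_covectors (- \<i>) J" for \<xi>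
    using that by (simp add: eigen_covectors_def cmat_def[symmetric] twist_def vector_matrix_add vector_matrix_mscale)
      (simp add: vec_eq_iff)
  have e1: "bideg_op J (foldr emult as w) = 2 ^ length as *s foldr emult as (bideg_op J w)"
    if "set as \<subseteq> eigen_covectors \<i> J" for as w
    using that by (induction as)
      (simp_all add: cpull_emult T emult_scale_left clin_scale[OF clin_emult] vector_smult_assoc mult.commute)
  have e2: "bideg_op J (foldr emult bs w) = 3 ^ length bs *s foldr emult bs (bideg_op J w)"
    if "set bs \<subseteq> eigen_covectors (- \<i>) J" for bs w
    using that by (induction bs)
      (simp_all add: cpull_emult T' emult_scale_left clin_scale[OF clin_emult] vector_smult_assoc mult.commute)
  have lin: "foldr emult as (c *s w) = c *s foldr emult as w" for as w and c :: complex
    by (induction as) (simp_all add: clin_scale[OF clin_emult])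
  have gen: "bideg_op J (wedge_list (map covec (as @ bs))) = ev p q *s wedge_list (map covec (as @ bs))"
    if "length as = p" "set as \<subseteq> eigen_covectors \<i> J" "length bs = q" "set bs \<subseteq> eigen_covectors (- \<i>) J" for as bs
  proof -
    have "wedge_list (map covec (as @ bs)) = foldr emult as (foldr emult bs (axis {} 1))"
      unfolding foldr_emult_eq_wedge by (simp add: wedge_list_append)
    then show ?thesis using that
      by (simp add: e1 e2 cpull_one lin vector_smult_assoc ev_def)
  qed
  show ?thesis
    using assms unfolding pq_space_def
  proof (induction rule: span_linear_induct)
    case base
    then show ?case using gen by auto
  next
    case subspace
    show ?case by (rule vec.subspaceI)
      (auto simp: clin_zero[OF clin_cpull] clin_add[OF clin_cpull] clin_scale[OF clin_cpull] vector_add_ldistrib vector_smult_assoc mult.commute)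
  qed
qed

lemma pq_space_ext_degree: "pq_space J p q \<subseteq> ext_degree (p + q)"
  unfolding pq_space_def
proof (rule vec.span_minimal[OF _ subspace_ext_degree])
  show "{wedge_list (map covec (as @ bs)) | as bs. length as = p \<and> set as \<subseteq> eigen_covectors \<i> J \<and>
     length bs = q \<and> set bs \<subseteq> eigen_covectors (- \<i>) J} \<subseteq> ext_degree (p + q)"
  proof clarify
    fix as bs :: "'a cvec list"
    show "wedge_list (map covec (as @ bs)) \<in> ext_degree (length as + length bs)"
      using wedge_list_ext_degree[of "as @ bs"] by simp
  qed
qed

lemma subspace_pq_space: "vec.subspace (pq_space J p q)"
  unfolding pq_space_def by (rule vec.subspace_span)

subsection \<open>The projections\<close>

text \<open>The interpolation polynomial in \<open>X\<close> that is 1 at \<open>c\<close> and 0 at the entries of \<open>\<mu>s\<close>.\<close>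

definition lagrange :: "(('a::finite) ext \<Rightarrow> 'a ext) \<Rightarrow> complex \<Rightarrow> complex list \<Rightarrow> 'a ext \<Rightarrow> 'a ext" where
  "lagrange X c \<mu>s = foldr (\<lambda>\<mu> w v. (1 / (c - \<mu>)) *s (X (w v) - \<mu> *s w v)) \<mu>s (\<lambda>v. v)"

lemma lagrange_Nil: "lagrange X c [] v = v"
  and lagrange_Cons: "lagrange X c (\<mu> # \<mu>s) v = (1 / (c - \<mu>)) *s (X (lagrange X c \<mu>s v) - \<mu> *s lagrange X c \<mu>s v)"
  by (simp_all add: lagrange_def)

lemma clin_lagrange: "clin X \<Longrightarrow> clin (lagrange X c \<mu>s)"
proof (induction \<mu>s)
  case Nil
  then show ?case by (simp add: lagrange_def clin_ident)
next
  case (Cons \<mu> \<mu>s)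
  then show ?case
    by (intro clinI) (simp_all add: lagrange_Cons clin_add clin_scale vec_eq_iff algebra_simps)
qed

lemma lagrange_eigen:
  assumes "clin X" "X v = \<nu> *s v"
  shows "lagrange X c \<mu>s v = prod_list (map (\<lambda>\<mu>. (\<nu> - \<mu>) / (c - \<mu>)) \<mu>s) *s v"
proof (induction \<mu>s)
  case (Cons \<mu> \<mu>s)
  let ?P = "prod_list (map (\<lambda>\<mu>. (\<nu> - \<mu>) / (c - \<mu>)) \<mu>s)"
  have "lagrange X c (\<mu> # \<mu>s) v = (1 / (c - \<mu>)) *s (?P *s (\<nu> *s v) - \<mu> *s (?P *s v))"
    by (simp only: lagrange_Cons Cons clin_scale[OF assms(1)] assms(2))
  also have "\<dots> = ((\<nu> - \<mu>) / (c - \<mu>) * ?P) *s v"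
    by (simp add: vec_eq_iff diff_divide_distrib) (simp add: algebra_simps)
  finally show ?case by simp
qed (simp add: lagrange_Nil)

lemma lagrange_intertwine:
  assumes "clin A" "\<And>v. A (X v) = Y (A v)"
  shows "A (lagrange X c \<mu>s v) = lagrange Y c \<mu>s (A v)"
  by (induction \<mu>s) (simp_all add: lagrange_Nil lagrange_Cons clin_scale[OF assms(1)] clin_diff[OF assms(1)] assms(2))

text \<open>The grid contains \<open>(p,q)\<close> itself and all bidegrees of nonzero forms on a space of dimension \<open>N\<close>.\<close>

definition other_evs :: "nat \<Rightarrow> nat \<Rightarrow> nat \<Rightarrow> complex list" where
  "other_evs N p q = map (\<lambda>(r, s). ev r s)
     (filter (\<lambda>rs. rs \<noteq> (p, q)) (List.product [0..<Suc (N + p + q)] [0..<Suc (N + p + q)]))"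

lemma set_other_evs: "set (other_evs N p q) = {ev r s | r s. r \<le> N + p + q \<and> s \<le> N + p + q \<and> (r, s) \<noteq> (p, q)}"
proof -
  have "set [0..<Suc M] = {..M}" for M by auto
  then show ?thesis unfolding other_evs_def set_map set_filter set_product by auto
qed

definition pq_proj :: "'d rmat \<Rightarrow> nat \<Rightarrow> nat \<Rightarrow> 'd ext \<Rightarrow> ('d::{finite,linorder}) ext" where
  "pq_proj J p q = lagrange (bideg_op J) (ev p q) (other_evs CARD('d) p q)"

lemma clin_pq_proj: "clin (pq_proj J p q)"
  unfolding pq_proj_def by (rule clin_lagrange[OF clin_cpull])

lemma pq_proj_same:
  assumes "v \<in> pq_space J p q" shows "pq_proj J p q v = v"
proof -
  have "prod_list (map (\<lambda>\<mu>. (ev p q - \<mu>) / (ev p q - \<mu>)) L) = 1" if "ev p q \<notin> set L" for L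
    using that by (induction L) auto
  moreover have "ev p q \<notin> set (other_evs N p q)" for N by (auto simp: set_other_evs ev_inject)
  ultimately show ?thesis
    by (simp add: pq_proj_def lagrange_eigen[OF clin_cpull pq_space_eigen[OF assms]])
qed

lemma pq_space_large: "v \<in> pq_space J r s \<Longrightarrow> r + s > CARD('d) \<Longrightarrow> v = 0"
  for J :: "('d::{finite,linorder}) rmat"
  using pq_space_ext_degree ext_degree_gt by blast

lemma pq_proj_other:
  fixes J :: "('d::{finite,linorder}) rmat"
  assumes "v \<in> pq_space J r s" "(r, s) \<noteq> (p, q)" shows "pq_proj J p q v = 0"
proof (cases "r \<le> CARD('d) + p + q \<and> s \<le> CARD('d) + p + q")
  case True
  have "prod_list (map (\<lambda>\<mu>. (ev r s - \<mu>) / (ev p q - \<mu>)) L) = 0" if "ev r s \<in> set L" for L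
    using that by (auto simp: prod_list_zero_iff image_iff)
  moreover have "ev r s \<in> set (other_evs CARD('d) p q)" using True assms(2) by (auto simp: set_other_evs)
  ultimately show ?thesis
    by (simp add: pq_proj_def lagrange_eigen[OF clin_cpull pq_space_eigen[OF assms(1)]])
next
  case False
  then have "v = 0" using pq_space_large[OF assms(1)] by linarith
  then show ?thesis by (simp add: clin_zero[OF clin_pq_proj])
qed

locale complex_structure =
  fixes J :: "('d::{finite,linorder}) rmat"
  assumes JJ: "J ** J = - mat 1"
begin

definition proj10 :: "'d cvec \<Rightarrow> 'd cvec" where "proj10 \<xi> = (1 / 2) *s (\<xi> - \<i> *s (\<xi> v* cmat J))"
definition proj01 :: "'d cvec \<Rightarrow> 'd cvec" where "proj01 \<xi> = (1 / 2) *s (\<xi> + \<i> *s (\<xi> v* cmat J))"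

lemma proj_sum: "proj10 \<xi> + proj01 \<xi> = \<xi>"
  by (simp add: proj10_def proj01_def vec_eq_iff field_simps)

lemma JJ_covector: "(\<xi> v* cmat J) v* cmat J = - \<xi>"
proof -
  have "\<xi> v* (- mat 1) = - \<xi>"
    by (simp add: vector_matrix_mult_def vec_eq_iff mat_def if_distrib if_distribR sum.delta sum_negf cong: if_cong)
  then show ?thesis
    by (simp add: vector_matrix_mul_assoc cmat_mult[symmetric] JJ cmat_minus cmat_one)
qed

lemma proj10_J: "proj10 \<xi> v* cmat J = \<i> *s proj10 \<xi>"
  by (simp add: proj10_def clin_scale[OF clin_vector_matrix] clin_diff[OF clin_vector_matrix] JJ_covector vec_eq_iff field_simps)

lemma proj01_J: "proj01 \<xi> v* cmat J = - \<i> *s proj01 \<xi>"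
  by (simp add: proj01_def clin_scale[OF clin_vector_matrix] clin_add[OF clin_vector_matrix] JJ_covector vec_eq_iff field_simps)

lemma proj_eigen: "proj10 \<xi> \<in> eigen_covectors \<i> J" "proj01 \<xi> \<in> eigen_covectors (- \<i>) J"
  by (simp_all add: eigen_covectors_def cmat_def[symmetric] proj10_J proj01_J)

abbreviation all_pq where "all_pq \<equiv> \<Union>{pq_space J r s | r s. True}"

text \<open>Every covector splits into its two types, so products of covectors expand into products of pure
  ones, and factors of type \<open>(0,1)\<close> can be moved behind those of type \<open>(1,0)\<close>.\<close>

lemma span_all_pq: "v \<in> vec.span all_pq"
proof -
  have step: "emult \<xi> v \<in> vec.span all_pq" if "v \<in> vec.span all_pq" for \<xi> v
    using that
  proof (induction rule: span_linear_induct)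
    case subspace
    show ?case
      by (rule vec.subspaceI) (auto simp: clin_zero[OF clin_emult] clin_add[OF clin_emult] clin_scale[OF clin_emult]
          intro: vec.span_zero vec.span_add vec.span_scale)
  next
    case (base v)
    then obtain r s where "v \<in> pq_space J r s" by auto
    then have "v \<in> vec.span {wedge_list (map covec (as @ bs)) | as bs.
       length as = r \<and> set as \<subseteq> eigen_covectors \<i> J \<and> length bs = s \<and> set bs \<subseteq> eigen_covectors (- \<i>) J}"
      by (simp only: pq_space_def)
    then show ?case
    proof (induction rule: span_linear_induct)
      case subspace
      show ?case
        by (rule vec.subspaceI) (auto simp: clin_zero[OF clin_emult] clin_add[OF clin_emult] clin_scale[OF clin_emult]
            intro: vec.span_zero vec.span_add vec.span_scale)
    next
      case (base v)
      then obtain as bs where v: "v = wedge_list (map covec (as @ bs))" and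
        ab: "length as = r" "set as \<subseteq> eigen_covectors \<i> J" "length bs = s" "set bs \<subseteq> eigen_covectors (- \<i>) J"
        by auto
      have gen: "wedge_list (map covec (as @ bs)) \<in> vec.span all_pq"
        if "set as \<subseteq> eigen_covectors \<i> J" "set bs \<subseteq> eigen_covectors (- \<i>) J" for as bs
      proof (rule vec.span_base)
        have "wedge_list (map covec (as @ bs)) \<in> pq_space J (length as) (length bs)"
          unfolding pq_space_def by (rule vec.span_base) (use that in blast)
        then show "wedge_list (map covec (as @ bs)) \<in> all_pq" by blast
      qed
      have "emult (proj10 \<xi>) v = wedge_list (map covec ((proj10 \<xi> # as) @ bs))"
        by (simp add: v emult_def)
      then have 1: "emult (proj10 \<xi>) v \<in> vec.span all_pq"
        using gen[of "proj10 \<xi> # as" bs] ab proj_eigen by simp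
      have "emult (proj01 \<xi>) v = (-1) ^ length as *s wedge_list (map covec (as @ (proj01 \<xi> # bs)))"
      proof -
        have "v = foldr emult as (wedge_list (map covec bs))"
          unfolding v foldr_emult_eq_wedge by (simp add: wedge_list_append)
        then show ?thesis
          by (simp add: emult_foldr_shift) (simp add: foldr_emult_eq_wedge wedge_list_append emult_def)
      qed
      then have 2: "emult (proj01 \<xi>) v \<in> vec.span all_pq"
        using gen[of as "proj01 \<xi> # bs"] ab proj_eigen by (simp add: vec.span_scale)
      show ?case using vec.span_add[OF 1 2] by (simp add: emult_add_left[symmetric] proj_sum)
    qed
  qed
  have "wedge_list (map covec xs) \<in> vec.span all_pq" for xs
  proof (induction xs)
    case Nil
    have "wedge_list (map covec ([] @ [])) \<in> pq_space J 0 0"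
      unfolding pq_space_def by (rule vec.span_base) auto
    then show ?case by (intro vec.span_base) auto
  next
    case (Cons a xs)
    show ?case using step[OF Cons, of a] by (simp add: emult_def)
  qed
  then have "axis I 1 \<in> vec.span all_pq" for I by (subst axis_eq_wedge_list)
  then show ?thesis by (subst vec_axis_expand) (intro vec.span_sum vec.span_scale)
qed

lemma pq_induct:
  assumes "vec.subspace {v. P v}" "\<And>r s v. v \<in> pq_space J r s \<Longrightarrow> P v" shows "P v"
  using span_all_pq[of v]
proof (induction rule: span_linear_induct)
  case subspace
  show ?case by (rule assms(1))
next
  case (base v)
  then show ?case using assms(2) by blast
qed

lemma clin_eq_pq_induct:
  assumes "clin A" "clin B" "\<And>r s v. v \<in> pq_space J r s \<Longrightarrow> A v = B v" shows "A v = B v"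
  by (rule pq_induct[OF vec.subspaceI])
     (use assms(3) in \<open>auto simp: clin_zero[OF assms(1)] clin_zero[OF assms(2)] clin_add[OF assms(1)] clin_add[OF assms(2)]
       clin_scale[OF assms(1)] clin_scale[OF assms(2)]\<close>)

lemma pq_proj_in: "pq_proj J p q v \<in> pq_space J p q"
proof (rule pq_induct[of "\<lambda>v. pq_proj J p q v \<in> pq_space J p q"])
  show "vec.subspace {v. pq_proj J p q v \<in> pq_space J p q}"
    by (rule subspace_preimage[OF clin_pq_proj subspace_pq_space])
  show "pq_proj J p q v \<in> pq_space J p q" if "v \<in> pq_space J r s" for r s v
    using pq_proj_same[of v J p q] pq_proj_other[OF that] that vec.subspace_0[OF subspace_pq_space]
    by (cases "(r, s) = (p, q)") auto
qed

text \<open>The projection \<open>pq_proj J p q\<close> is the identity on its own bidegree and kills all others, so the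
  decomposition that defines \<open>pq_comp\<close> exists and is unique.\<close>

lemma pq_comp_eq: "pq_comp J p q = pq_proj J p q"
proof
  fix v
  let ?O = "\<Union>{pq_space J r s | r s. (r, s) \<noteq> (p, q)}"
  show "pq_comp J p q v = pq_proj J p q v"
    unfolding pq_comp_def
  proof (rule the_equality)
    have "v - pq_proj J p q v \<in> vec.span ?O"
    proof (rule pq_induct[of "\<lambda>v. v - pq_proj J p q v \<in> vec.span ?O"])
      have "clin (\<lambda>v. v - pq_proj J p q v)"
        by (rule clinI) (simp_all add: clin_add[OF clin_pq_proj] clin_scale[OF clin_pq_proj] vec_eq_iff algebra_simps)
      then show "vec.subspace {v. v - pq_proj J p q v \<in> vec.span ?O}"
        by (rule subspace_preimage[OF _ vec.subspace_span])
      show "v - pq_proj J p q v \<in> vec.span ?O" if v: "v \<in> pq_space J r s" for r s v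
      proof (cases "(r, s) = (p, q)")
        case True
        then show ?thesis using pq_proj_same[of v J p q] v vec.span_zero by simp
      next
        case False
        then have "v \<in> ?O" using v by blast
        then show ?thesis using pq_proj_other[OF v False] vec.span_base[of v ?O] by simp
      qed
    qed
    then show "pq_proj J p q v \<in> pq_space J p q \<and> v - pq_proj J p q v \<in> vec.span ?O"
      using pq_proj_in by simp
  next
    fix w assume w: "w \<in> pq_space J p q \<and> v - w \<in> vec.span ?O"
    have "pq_proj J p q u = 0" if "u \<in> vec.span ?O" for u
      using that
    proof (induction rule: span_linear_induct)
      case subspace
      show ?case by (rule vec.subspaceI) (auto simp: clin_zero[OF clin_pq_proj] clin_add[OF clin_pq_proj] clin_scale[OF clin_pq_proj])
    next
      case (base u)
      then obtain r s where "u \<in> pq_space J r s" "(r, s) \<noteq> (p, q)" by blast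
      then show ?case by (rule pq_proj_other)
    qed
    then have "pq_proj J p q (v - w) = 0" using w by blast
    then show "w = pq_proj J p q v" using pq_proj_same[of w J p q] w by (simp add: clin_diff[OF clin_pq_proj])
  qed
qed

lemma pq_proj_sum: "(\<Sum>p\<le>CARD('d). \<Sum>q\<le>CARD('d). pq_proj J p q v) = v"
proof (rule clin_eq_pq_induct[of "\<lambda>v. \<Sum>p\<le>CARD('d). \<Sum>q\<le>CARD('d). pq_proj J p q v" "\<lambda>v. v"])
  fix r s v assume v: "v \<in> pq_space J r s"
  show "(\<Sum>p\<le>CARD('d). \<Sum>q\<le>CARD('d). pq_proj J p q v) = v"
  proof (cases "r \<le> CARD('d) \<and> s \<le> CARD('d)")
    case True
    have "pq_proj J p q v = (if q = s then if p = r then v else 0 else 0)" for p q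
      using pq_proj_same[of v J r s] pq_proj_other[OF v, of p q] v by auto
    then have "(\<Sum>p\<le>CARD('d). \<Sum>q\<le>CARD('d). pq_proj J p q v)
        = (\<Sum>p\<le>CARD('d). \<Sum>q\<le>CARD('d). if q = s then if p = r then v else 0 else 0)" by simp
    also have "\<dots> = v" using True by (simp add: sum.delta)
    finally show ?thesis .
  next
    case False
    then have "v = 0" using pq_space_large[OF v] by linarith
    then show ?thesis by (simp add: clin_zero[OF clin_pq_proj])
  qed
qed (intro clin_summed clin_pq_proj clin_ident)+

lemma pq_proj_bideg_op: "pq_proj J r s (bideg_op J v) = ev r s *s pq_proj J r s v"
proof (rule clin_eq_pq_induct[of "\<lambda>v. pq_proj J r s (bideg_op J v)" "\<lambda>v. ev r s *s pq_proj J r s v"])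
  fix p q v assume v: "v \<in> pq_space J p q"
  show "pq_proj J r s (bideg_op J v) = ev r s *s pq_proj J r s v"
    using pq_proj_other[OF v, of r s]
    by (cases "(p, q) = (r, s)") (auto simp: pq_space_eigen[OF v] clin_scale[OF clin_pq_proj])
qed (intro clin_compose[OF clin_pq_proj clin_cpull] clin_scaled clin_pq_proj)+

text \<open>The projection of \<open>v\<close> is an eigenvector for \<open>c\<close> and for \<open>2\<^sup>r 3\<^sup>s\<close>.\<close>

lemma eigen_pq_proj:
  assumes "bideg_op J v = c *s v" "c \<noteq> ev r s" shows "pq_proj J r s v = 0"
proof -
  have "c *s pq_proj J r s v = ev r s *s pq_proj J r s v"
    using pq_proj_bideg_op[of r s v] assms(1) by (simp add: clin_scale[OF clin_pq_proj])
  then have "(c - ev r s) *s pq_proj J r s v = 0" by (simp add: vec_eq_iff)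
  then show ?thesis using assms(2) by simp
qed

lemma eigen_zero:
  assumes "bideg_op J v = c *s v" "\<And>r s. c \<noteq> ev r s" shows "v = 0"
  using pq_proj_sum[of v] eigen_pq_proj[OF assms(1)] assms(2) by simp

lemma pq_space_iff: "v \<in> pq_space J p q \<longleftrightarrow> bideg_op J v = ev p q *s v"
proof
  assume v: "bideg_op J v = ev p q *s v"
  have "pq_proj J r s v = pq_proj J p q (pq_proj J r s v)" for r s
    using eigen_pq_proj[OF v, of r s] pq_proj_same[OF pq_proj_in, of p q v]
    by (cases "(r, s) = (p, q)") (auto simp: ev_inject clin_zero[OF clin_pq_proj])
  then have "pq_proj J r s v \<in> pq_space J p q" for r s
    by (metis pq_proj_in)
  then have "(\<Sum>r\<le>CARD('d). \<Sum>s\<le>CARD('d). pq_proj J r s v) \<in> pq_space J p q"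
    by (intro vec.subspace_sum[OF subspace_pq_space])
  then show "v \<in> pq_space J p q" by (simp add: pq_proj_sum)
qed (rule pq_space_eigen)

subsection \<open>Integer bidegrees\<close>

text \<open>Allowing negative degrees, where the spaces vanish, lets all operators act on bidegrees by
  translations and reflections.\<close>

definition wt :: "int \<Rightarrow> int \<Rightarrow> 'd ext set" where
  "wt a b = {v. bideg_op J v = (2 powi a * 3 powi b) *s v}"

lemma wt_nat: "wt (int p) (int q) = pq_space J p q"
  by (auto simp: wt_def pq_space_iff ev_def)

text \<open>Multiplication by a high power of 6 reduces integer exponents to natural ones.\<close>

lemma powi_eq_ev:
  assumes "2 powi a * 3 powi b = ev r s" shows "a = int r \<and> b = int s"
proof -
  obtain k :: nat where k: "a + int k \<ge> 0" "b + int k \<ge> 0"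
    by (rule that[of "nat (max (- a) (- b))"]) auto
  obtain a' b' where ab: "a + int k = int a'" "b + int k = int b'" using k by (metis nonneg_int_cases)
  have "(2 powi a * 2 ^ k) * (3 powi b * 3 ^ k) = ev (r + k) (s + k)"
    using assms by (simp add: ev_def power_add mult_ac)
  moreover have "2 powi a * 2 ^ k = (2 ^ a' :: complex)" "3 powi b * 3 ^ k = (3 ^ b' :: complex)"
    by (simp_all add: power_int_add[symmetric] power_int_of_nat[symmetric] ab del: power_int_of_nat)
  ultimately have "ev a' b' = ev (r + k) (s + k)" by (simp add: ev_def)
  then show ?thesis using ab by (simp add: ev_inject)
qed

lemma wt_negative:
  assumes "v \<in> wt a b" "a < 0 \<or> b < 0" shows "v = 0"
proof (rule eigen_zero)
  show "bideg_op J v = (2 powi a * 3 powi b) *s v" using assms(1) by (simp add: wt_def)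
  show "2 powi a * 3 powi b \<noteq> ev r s" for r s using powi_eq_ev[of a b r s] assms(2) by auto
qed

lemma wt_cases:
  assumes "v \<in> wt a b" obtains "v = 0" | p q where "a = int p" "b = int q" "v \<in> pq_space J p q"
proof (cases "a < 0 \<or> b < 0")
  case True
  then show thesis using wt_negative[OF assms] that by blast
next
  case False
  then obtain p q where "a = int p" "b = int q" by (metis linorder_not_less nonneg_int_cases)
  then show thesis using assms that wt_nat by blast
qed

lemma wt_zero: "0 \<in> wt a b" by (simp add: wt_def clin_zero[OF clin_cpull])

lemma subspace_wt: "vec.subspace (wt a b)"
  by (rule vec.subspaceI) (auto simp: wt_def clin_zero[OF clin_cpull] clin_add[OF clin_cpull] clin_scale[OF clin_cpull]
     vector_add_ldistrib vector_smult_assoc mult.commute)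

lemma emult_wt:
  assumes "v \<in> wt a b"
  shows "emult (proj10 \<xi>) v \<in> wt (a + 1) b" "emult (proj01 \<xi>) v \<in> wt a (b + 1)"
proof -
  have "proj10 \<xi> v* twist (cmat J) = 2 *s proj10 \<xi>"
    by (simp add: twist_def vector_matrix_add vector_matrix_mscale proj10_J) (simp add: vec_eq_iff)
  moreover have "proj01 \<xi> v* twist (cmat J) = 3 *s proj01 \<xi>"
    by (simp add: twist_def vector_matrix_add vector_matrix_mscale proj01_J) (simp add: vec_eq_iff)
  ultimately show "emult (proj10 \<xi>) v \<in> wt (a + 1) b" "emult (proj01 \<xi>) v \<in> wt a (b + 1)"
    using assms by (simp_all add: wt_def cpull_emult emult_scale_left clin_scale[OF clin_emult] vector_smult_assoc power_int_add mult_ac)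
qed

text \<open>These sums are the principal symbols of \<open>\<partial>\<close> and of its conjugate. Multiplication by the \<open>(1,0)\<close> part
  of \<open>\<xi>\<close> raises \<open>p\<close> and multiplication by the \<open>(0,1)\<close> part raises \<open>q\<close>, so each projection selects one part.\<close>

lemma pq_proj_emult:
  "(\<Sum>p\<le>CARD('d). \<Sum>q\<le>CARD('d). pq_proj J (p + 1) q (emult \<xi> (pq_proj J p q v))) = emult (proj10 \<xi>) v"
  "(\<Sum>p\<le>CARD('d). \<Sum>q\<le>CARD('d). pq_proj J p (q + 1) (emult \<xi> (pq_proj J p q v))) = emult (proj01 \<xi>) v"
proof -
  have in10: "emult (proj10 \<xi>) (pq_proj J p q v) \<in> pq_space J (p + 1) q"
    and in01: "emult (proj01 \<xi>) (pq_proj J p q v) \<in> pq_space J p (q + 1)" for p q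
    using emult_wt[of "pq_proj J p q v" "int p" "int q" \<xi>] pq_proj_in[of p q v]
      wt_nat[of "p + 1" q] wt_nat[of p "q + 1"] by (auto simp: wt_nat add.commute)
  have split: "emult \<xi> w = emult (proj10 \<xi>) w + emult (proj01 \<xi>) w" for w
    by (simp add: emult_add_left[symmetric] proj_sum)
  have "pq_proj J (p + 1) q (emult \<xi> (pq_proj J p q v)) = emult (proj10 \<xi>) (pq_proj J p q v)" for p q
    unfolding split clin_add[OF clin_pq_proj] pq_proj_same[OF in10]
    by (subst pq_proj_other[OF in01]) auto
  then show "(\<Sum>p\<le>CARD('d). \<Sum>q\<le>CARD('d). pq_proj J (p + 1) q (emult \<xi> (pq_proj J p q v))) = emult (proj10 \<xi>) v"
    by (simp only: clin_sum[OF clin_emult, symmetric] pq_proj_sum)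
  have "pq_proj J p (q + 1) (emult \<xi> (pq_proj J p q v)) = emult (proj01 \<xi>) (pq_proj J p q v)" for p q
    unfolding split clin_add[OF clin_pq_proj] pq_proj_same[OF in01]
    by (subst pq_proj_other[OF in10]) auto
  then show "(\<Sum>p\<le>CARD('d). \<Sum>q\<le>CARD('d). pq_proj J p (q + 1) (emult \<xi> (pq_proj J p q v))) = emult (proj01 \<xi>) v"
    by (simp only: clin_sum[OF clin_emult, symmetric] pq_proj_sum)
qed

end

text \<open>Projections are polynomials in an operator that is natural in \<open>J\<close>.\<close>

lemma pq_proj_intertwine:
  assumes "cmat J' ** D = D ** cmat J"
  shows "cpull D (pq_proj J' p q v) = pq_proj J p q (cpull D v)"
  unfolding pq_proj_def
  by (rule lagrange_intertwine[OF clin_cpull]) (simp add: cpull_compose twist_intertwine[OF assms])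

section \<open>The pointwise symbol\<close>

context hermitian_space
begin

sublocale complex_structure J by unfold_locales (rule JJ)

lemma transpose_J_g: "transpose J ** g = - (g ** J)"
  using omega_anti by (simp add: omega_matrix_def matrix_transpose_mul sym)

lemma ginv_J: "J ** ginv = - (ginv ** transpose J)"
proof -
  have "ginv ** (transpose J ** g) ** ginv = - (ginv ** (g ** J) ** ginv)"
    unfolding transpose_J_g by (simp add: matrix_minus_left matrix_minus_right)
  moreover have "ginv ** (transpose J ** g) ** ginv = ginv ** transpose J ** (g ** ginv)"
    "ginv ** (g ** J) ** ginv = ginv ** g ** (J ** ginv)"
    by (simp_all only: matrix_mul_assoc)
  ultimately show ?thesis by (simp add: ginv)
qed

lemma J_ginv_J: "J ** ginv ** transpose J = ginv"
proof -
  have "ginv ** transpose J = - (J ** ginv)" by (simp add: ginv_J)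
  then have "J ** (ginv ** transpose J) = - (J ** J ** ginv)"
    by (simp add: matrix_minus_right matrix_mul_assoc)
  then show ?thesis by (simp add: matrix_mul_assoc JJ matrix_minus_left)
qed

lemma twist_G: "twist (cmat J) ** G ** transpose (twist (cmat J)) = mscale 6 G"
proof (rule twist_congruence)
  show "cmat J ** G + G ** transpose (cmat J) = 0"
    by (simp add: cmat_mult[symmetric] cmat_transpose[symmetric] ginv_J cmat_minus)
  show "cmat J ** G ** transpose (cmat J) = G"
    by (simp add: cmat_mult[symmetric] cmat_transpose[symmetric] J_ginv_J)
qed

lemma twist_omega:
  "transpose (twist (cmat J)) ** cmat (omega_matrix J g) ** twist (cmat J) = mscale 6 (cmat (omega_matrix J g))"
proof -
  let ?O = "omega_matrix J g"
  have "transpose J ** ?O = - (?O ** J)"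
    unfolding omega_matrix_def transpose_J_g by (simp add: matrix_minus_left matrix_minus_right matrix_mul_assoc transpose_J_g)
  then have 1: "cmat (transpose J) ** cmat ?O + cmat ?O ** transpose (cmat (transpose J)) = 0"
    by (simp add: cmat_mult[symmetric] cmat_transpose[symmetric] cmat_minus)
  have "transpose J ** ?O ** J = ?O"
    using JgJ by (simp add: omega_matrix_def matrix_mul_assoc[symmetric])
  then have 2: "cmat (transpose J) ** cmat ?O ** transpose (cmat (transpose J)) = cmat ?O"
    by (simp add: cmat_mult[symmetric] cmat_transpose[symmetric])
  show ?thesis using twist_congruence[OF 1 2] by (simp add: cmat_transpose twist_transpose)
qed

text \<open>The matrix \<open>twist J\<close> scales both the fundamental form and the inverse metric by 6, so the
  eigenvalue \<open>2\<^sup>p 3\<^sup>q\<close> becomes \<open>6\<^bsup>n - p - q\<^esup> 2\<^sup>p 3\<^sup>q = 2\<^bsup>n - q\<^esup> 3\<^bsup>n - p\<^esup>\<close>.\<close>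

lemma star_wt:
  assumes "v \<in> wt a b" shows "star v \<in> wt (int n - b) (int n - a)"
  using assms
proof (cases rule: wt_cases)
  case 1
  then show ?thesis by (simp add: clin_zero[OF clin_star] wt_zero)
next
  case (2 p q)
  have "v \<in> ext_degree (p + q)" using 2 pq_space_ext_degree by blast
  from star_scaling[OF hermitian_space_axioms hermitian_space_axioms twist_omega twist_G this]
  have "6 ^ (p + q) *s bideg_op J (star v) = (6 ^ n * ev p q) *s star v"
    by (simp add: pq_space_eigen[OF 2(3)] clin_scale[OF clin_star] vector_smult_assoc)
  moreover have "6 ^ n * ev p q = 6 ^ (p + q) * (2 powi (int n - int q) * 3 powi (int n - int p))"
  proof -
    have "(6 :: complex) ^ m = 2 ^ m * 3 ^ m" for m by (simp add: power_mult_distrib[symmetric])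
    then show ?thesis by (simp add: ev_def power_int_diff power_add field_simps)
  qed
  ultimately have "6 ^ (p + q) *s bideg_op J (star v) = 6 ^ (p + q) *s ((2 powi (int n - int q) * 3 powi (int n - int p)) *s star v)"
    by (simp only: vector_smult_assoc)
  then have "bideg_op J (star v) = (2 powi (int n - int q) * 3 powi (int n - int p)) *s star v"
    by (simp only: vector_mul_lcancel) simp
  then show ?thesis using 2 by (simp add: wt_def)
qed

text \<open>The symbols of \<open>\<partial>\<close>, its conjugate and their formal adjoints at the covector \<open>\<xi>\<close>.\<close>

definition "sym_del \<xi> v = emult (proj10 \<xi>) v"
definition "sym_delbar \<xi> v = emult (proj01 \<xi>) v"
definition "sym_del_adj \<xi> v = - star (sym_delbar \<xi> (star v))"
definition "sym_delbar_adj \<xi> v = - star (sym_del \<xi> (star v))"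

lemma sym_adj_contract:
  "sym_del_adj \<xi> v = (- \<kappa>) *s contract (proj01 \<xi> v* G) v"
  "sym_delbar_adj \<xi> v = (- \<kappa>) *s contract (proj10 \<xi> v* G) v"
  by (simp_all add: sym_del_adj_def sym_delbar_adj_def sym_del_def sym_delbar_def star_emult_star)

lemma G_bilinear_J: "cdot ((\<xi> v* cmat J) v* G) (\<eta> v* cmat J) = cdot (\<xi> v* G) \<eta>"
proof -
  have "cmat J ** G ** transpose (cmat J) = G"
    by (simp add: cmat_mult[symmetric] cmat_transpose[symmetric] J_ginv_J)
  then have "((\<xi> v* cmat J) v* G) v* transpose (cmat J) = \<xi> v* G"
    by (simp only: vector_matrix_mul_assoc matrix_mul_assoc)
  then show ?thesis
    by (metis cdot_commute vector_transpose_matrix_c)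
qed

lemma G_bilinear_sym: "cdot (\<xi> v* G) \<eta> = cdot (\<eta> v* G) \<xi>"
  by (metis G_sym cdot_commute vector_transpose_matrix_c)

text \<open>The metric is \<open>J\<close>-invariant and bilinear over the complex numbers, so \<open>J\<close> multiplies the square of
  an eigenvector by \<open>c\<^sup>2 = -1\<close> and also preserves it.\<close>

lemma eigen_isotropic:
  assumes "\<xi> v* cmat J = c *s \<xi>" "c * c = -1" shows "cdot (\<xi> v* G) \<xi> = 0"
  using G_bilinear_J[of \<xi> \<xi>]
  by (simp add: assms clin_scale[OF clin_vector_matrix] cdot_simps mult.assoc[symmetric])

lemma proj_isotropic:
  "cdot (proj10 \<xi> v* G) (proj10 \<xi>) = 0" "cdot (proj01 \<xi> v* G) (proj01 \<xi>) = 0"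
  by (rule eigen_isotropic[OF proj10_J] eigen_isotropic[OF proj01_J], simp)+

text \<open>Half the squared length of \<open>\<xi>\<close>, by the isotropy of its two parts.\<close>

definition cov_norm :: "'d cvec \<Rightarrow> complex" where
  "cov_norm \<xi> = cdot (proj10 \<xi> v* G) (proj01 \<xi>)"

lemma cov_norm_eq: "cdot (\<xi> v* G) \<xi> = 2 * cov_norm \<xi>"
proof -
  have "cdot (\<xi> v* G) \<xi> = cdot ((proj10 \<xi> + proj01 \<xi>) v* G) (proj10 \<xi> + proj01 \<xi>)" by (simp only: proj_sum)
  also have "\<dots> = 2 * cov_norm \<xi>"
    by (simp add: clin_add[OF clin_vector_matrix] cdot_simps proj_isotropic G_bilinear_sym[of "proj01 \<xi>" "proj10 \<xi>"] cov_norm_def)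
  finally show ?thesis .
qed

lemma cov_norm_nonzero:
  fixes \<xi> :: "'d rvec"
  assumes "\<xi> \<noteq> 0" shows "cov_norm (\<chi> i. of_real (\<xi> $ i)) \<noteq> 0"
proof -
  define \<eta> where "\<eta> = ginv *v \<xi>"
  have \<xi>: "\<xi> = g *v \<eta>" by (simp add: \<eta>_def matrix_vector_mul_assoc ginv)
  then have "\<eta> \<noteq> 0" using assms by auto
  from pos[OF this] have p: "\<xi> \<bullet> (ginv *v \<xi>) > 0"
    by (simp add: \<xi>[symmetric] \<eta>_def[symmetric] inner_commute)
  have "cdot ((\<chi> i. of_real (\<xi> $ i)) v* G) (\<chi> i. of_real (\<xi> $ i)) = of_real (\<xi> \<bullet> (ginv *v \<xi>))"
  proof -
    have "\<xi> \<bullet> (ginv *v \<xi>) = (\<Sum>j\<in>UNIV. (\<Sum>i\<in>UNIV. ginv $ i $ j * \<xi> $ i) * \<xi> $ j)"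
    proof -
      have "ginv *v \<xi> = \<xi> v* ginv" by (metis ginv_sym transpose_matrix_vector)
      then show ?thesis by (simp add: inner_vec_def vector_matrix_mult_def mult.commute)
    qed
    then show ?thesis by (simp add: cdot_def vector_matrix_mult_def cmat_def mult.commute)
  qed
  then show ?thesis using p cov_norm_eq by (metis mult_zero_right of_real_eq_0_iff less_irrefl)
qed

text \<open>On the level of symbols, \<open>\<partial>\<close> and its adjoint anticommute to a multiple of the identity, and so
  do their conjugates with the same multiple; all other pairs anticommute. Moving factors past each
  other turns the four terms into products of the number operators \<open>a a'\<close>, \<open>a' a\<close>, \<open>b b'\<close>, \<open>b' b\<close>, and
  their sum factors as \<open>(a a' + a' a) (b b' + b' b)\<close>.\<close>

lemma bott_chern_symbol:
  "sym_del \<xi> (sym_delbar \<xi> (sym_delbar_adj \<xi> (sym_del_adj \<xi> v)))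
   + sym_delbar_adj \<xi> (sym_del_adj \<xi> (sym_del \<xi> (sym_delbar \<xi> v)))
   + sym_del_adj \<xi> (sym_delbar \<xi> (sym_delbar_adj \<xi> (sym_del \<xi> v)))
   + sym_delbar_adj \<xi> (sym_del \<xi> (sym_del_adj \<xi> (sym_delbar \<xi> v)))
   = (\<kappa> * cov_norm \<xi>)\<^sup>2 *s v"
proof -
  let ?a = "sym_del \<xi>" and ?b = "sym_delbar \<xi>" and ?a' = "sym_del_adj \<xi>" and ?b' = "sym_delbar_adj \<xi>"
  have lin: "clin ?a" "clin ?b" "clin ?a'" "clin ?b'"
    unfolding sym_del_def[abs_def] sym_delbar_def[abs_def] sym_adj_contract[abs_def]
    by (rule clin_emult clin_scaled[OF clin_contract])+
  note [simp] = lin[THEN clin_minus] lin[THEN clin_add] lin[THEN clin_scale]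
  have ab: "?b (?a v) = - ?a (?b v)" for v
    unfolding sym_del_def sym_delbar_def by (rule emult_anticommute)
  have a'b': "?b' (?a' v) = - ?a' (?b' v)" for v
    unfolding sym_adj_contract clin_scale[OF clin_contract]
    by (subst contract_anticommute) simp
  have anti: "emult x (c *s contract y v) + c *s contract y (emult x v) = (c * cdot x y) *s v"
    for x y c and v :: "'d ext"
    using arg_cong[OF clifford[of x y v], of "\<lambda>w. c *s w"]
    by (simp add: clin_scale[OF clin_emult] vector_add_ldistrib vector_smult_assoc)
  have aa': "?a (?a' v) + ?a' (?a v) = (- \<kappa> * cov_norm \<xi>) *s v" for v
    unfolding sym_adj_contract sym_del_def anti
    by (simp add: cov_norm_def cdot_commute[of "proj10 \<xi>"] G_bilinear_sym[of "proj01 \<xi>"])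
  have bb': "?b (?b' v) + ?b' (?b v) = (- \<kappa> * cov_norm \<xi>) *s v" for v
    unfolding sym_adj_contract sym_delbar_def anti
    by (simp add: cov_norm_def cdot_commute[of "proj01 \<xi>"])
  have ab': "?a (?b' v) + ?b' (?a v) = 0" for v
    unfolding sym_adj_contract sym_del_def anti
    by (simp add: cdot_commute[of "proj10 \<xi>"] proj_isotropic)
  have ba': "?b (?a' v) + ?a' (?b v) = 0" for v
    unfolding sym_adj_contract sym_delbar_def anti
    by (simp add: cdot_commute[of "proj01 \<xi>"] proj_isotropic)
  have ab'': "?b' (?a v) = - ?a (?b' v)" for v using ab'[of v] by (simp add: eq_neg_iff_add_eq_0 add.commute)
  have ba'': "?b (?a' v) = - ?a' (?b v)" for v using ba'[of v] by (simp add: eq_neg_iff_add_eq_0 add.commute)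
  \<comment> \<open>Every summand is brought to the order in which the factors with \<open>a\<close> precede those with \<open>b\<close>.\<close>
  have "?a (?b (?b' (?a' v))) = ?a (?a' (?b (?b' v)))" by (simp add: a'b' ba'')
  moreover have "?b' (?a' (?a (?b v))) = ?a' (?a (?b' (?b v)))" by (simp add: a'b' ab'')
  moreover have "?a' (?b (?b' (?a v))) = ?a' (?a (?b (?b' v)))" by (simp add: ab ab'')
  moreover have "?b' (?a (?a' (?b v))) = ?a (?a' (?b' (?b v)))" by (simp add: a'b' ab'')
  ultimately have "?a (?b (?b' (?a' v))) + ?b' (?a' (?a (?b v))) + ?a' (?b (?b' (?a v))) + ?b' (?a (?a' (?b v)))
    = ?a (?a' (?b (?b' v) + ?b' (?b v))) + ?a' (?a (?b (?b' v) + ?b' (?b v)))" by simp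
  also have "\<dots> = (- \<kappa> * cov_norm \<xi>) *s (?a (?a' v) + ?a' (?a v))"
    unfolding bb' by (simp add: vector_add_ldistrib)
  also have "\<dots> = (\<kappa> * cov_norm \<xi>)\<^sup>2 *s v"
    unfolding aa' by (simp add: vector_smult_assoc power2_eq_square)
  finally show ?thesis .
qed

end

section \<open>Smooth families of linear maps\<close>

text \<open>A family of linear maps is recorded by its values on basis forms, so that its smoothness is that of
  finitely many forms.\<close>

definition opfield :: "(('d::finite) rvec) set \<Rightarrow> ('d rvec \<Rightarrow> 'd ext \<Rightarrow> 'd ext) \<Rightarrow> bool" where
  "opfield S M \<longleftrightarrow> (\<forall>y. clin (M y)) \<and> (\<forall>I. smooth_on S (\<lambda>y. M y (axis I 1)))"

lemma opfieldI: "(\<And>y. clin (M y)) \<Longrightarrow> (\<And>I. smooth_on S (\<lambda>y. M y (axis I 1))) \<Longrightarrow> opfield S M"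
  by (simp add: opfield_def)

lemma opfield_clin: "opfield S M \<Longrightarrow> clin (M y)"
  by (simp add: opfield_def)

context
  fixes S :: "(('d::{finite,linorder}) rvec) set" assumes S: "open S"
begin

lemma smooth_on_opfield: "opfield S M \<Longrightarrow> smooth_on S f \<Longrightarrow> smooth_on S (\<lambda>y. M y (f y))"
proof -
  assume M: "opfield S M" and f: "smooth_on S f"
  have "smooth_on S (\<lambda>y. \<Sum>I\<in>UNIV. f y $ I *s M y (axis I 1))"
    using M f by (intro smooth_on_sum smooth_on_scale smooth_on_vec_nth S) (auto simp: opfield_def)
  moreover have "M y (f y) = (\<Sum>I\<in>UNIV. f y $ I *s M y (axis I 1))" for y
    by (rule clin_expand[OF opfield_clin[OF M]])
  ultimately show ?thesis by (simp only:)
qed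

lemma opfield_compose:
  assumes "opfield S M" "opfield S N" shows "opfield S (\<lambda>y v. M y (N y v))"
proof (rule opfieldI)
  show "clin (\<lambda>v. M y (N y v))" for y
    by (rule clin_compose[OF opfield_clin[OF assms(1)] opfield_clin[OF assms(2)]])
  show "smooth_on S (\<lambda>y. M y (N y (axis I 1)))" for I
    by (rule smooth_on_opfield[OF assms(1)]) (use assms(2) in \<open>simp add: opfield_def\<close>)
qed

lemma opfield_const: "clin M \<Longrightarrow> opfield S (\<lambda>y. M)"
  by (intro opfieldI smooth_on_const S)

lemma opfield_plus: "opfield S M \<Longrightarrow> opfield S N \<Longrightarrow> opfield S (\<lambda>y v. M y v + N y v)"
  by (intro opfieldI clin_plus smooth_on_add S) (auto simp: opfield_def)

lemma opfield_scaled: "smooth_on S c \<Longrightarrow> opfield S M \<Longrightarrow> opfield S (\<lambda>y v. c y *s M y v)"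
  by (intro opfieldI clin_scaled smooth_on_scale S) (auto simp: opfield_def)

lemma smooth_on_wedge:
  assumes "smooth_on S f" "smooth_on S h" shows "smooth_on S (\<lambda>y. wedge (f y) (h y))"
  unfolding wedge_def
  by (intro smooth_on_vec_lambda S smooth_on_sum smooth_on_mult smooth_on_const smooth_on_vec_nth assms)

lemma smooth_on_covec: "smooth_on S f \<Longrightarrow> smooth_on S (\<lambda>y. covec (f y))"
  unfolding covec_def by (intro smooth_on_sum smooth_on_scale S smooth_on_vec_nth smooth_on_const)

lemma smooth_on_wedge_list:
  "(\<And>h. h \<in> set hs \<Longrightarrow> smooth_on S h) \<Longrightarrow> smooth_on S (\<lambda>y. wedge_list (map (\<lambda>h. h y) hs))"
  by (induction hs) (simp_all add: smooth_on_const[OF S] smooth_on_wedge)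

lemma opfield_cpull:
  assumes "smooth_on S D" shows "opfield S (\<lambda>y. cpull (D y))"
proof (intro opfieldI clin_cpull)
  fix I
  have "smooth_on S (\<lambda>y. wedge_list (map (\<lambda>h. h y) (map (\<lambda>i y. covec (D y $ i)) (sorted_list_of_set I))))"
    by (rule smooth_on_wedge_list) (auto intro!: smooth_on_covec smooth_on_vec_nth[OF S] assms)
  then show "smooth_on S (\<lambda>y. cpull (D y) (axis I 1))"
    by (simp add: cpull_axis o_def)
qed

lemma smooth_on_cmat: "smooth_on S D \<Longrightarrow> smooth_on S (\<lambda>y. cmat (D y))"
  unfolding cmat_def by (intro smooth_on_vec_lambda S smooth_on_of_real smooth_on_vec_nth)

lemma smooth_on_matrix_mult:
  fixes A B :: "'d rvec \<Rightarrow> 'd rmat"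
  assumes "smooth_on S A" "smooth_on S B" shows "smooth_on S (\<lambda>y. A y ** B y)"
  unfolding matrix_matrix_mult_def
  by (intro smooth_on_vec_lambda S smooth_on_sum smooth_on_mult smooth_on_vec_nth assms)

lemma smooth_on_transpose:
  fixes A :: "'d rvec \<Rightarrow> 'd rmat"
  assumes "smooth_on S A" shows "smooth_on S (\<lambda>y. transpose (A y))"
  unfolding transpose_def by (intro smooth_on_vec_lambda S smooth_on_vec_nth assms)

lemma opfield_bideg_op:
  assumes "smooth_on S J" shows "opfield S (\<lambda>y. bideg_op (J y))"
proof (rule opfield_cpull)
  have "twist (cmat M) = (\<chi> i j. 5 / 2 * mat 1 $ i $ j + \<i> / 2 * of_real (M $ i $ j))" for M :: "'d rmat"
    by (simp add: twist_def mscale_def cmat_def vec_eq_iff)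
  moreover have "smooth_on S (\<lambda>y. \<chi> i j. 5 / 2 * mat 1 $ i $ j + \<i> / 2 * of_real (J y $ i $ j))"
    by (intro smooth_on_vec_lambda S smooth_on_add smooth_on_mult smooth_on_const smooth_on_of_real smooth_on_vec_nth assms)
  ultimately show "smooth_on S (\<lambda>y. twist (cmat (J y)))" by (simp only:)
qed

lemma opfield_pq_proj:
  assumes "smooth_on S J" shows "opfield S (\<lambda>y. pq_proj (J y) p q)"
proof -
  have "opfield S (\<lambda>y. lagrange (bideg_op (J y)) c \<mu>s)" for c \<mu>s
  proof (induction \<mu>s)
    case Nil
    then show ?case by (simp add: lagrange_def opfield_const clin_ident)
  next
    case (Cons \<mu> \<mu>s)
    have "opfield S (\<lambda>y v. (1 / (c - \<mu>)) *s (bideg_op (J y) (lagrange (bideg_op (J y)) c \<mu>s v)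
         + (- \<mu>) *s lagrange (bideg_op (J y)) c \<mu>s v))"
      by (intro opfield_scaled opfield_plus smooth_on_const S Cons opfield_compose[OF opfield_bideg_op[OF assms] Cons])
    moreover have "lagrange (bideg_op (J y)) c (\<mu> # \<mu>s) = (\<lambda>v. (1 / (c - \<mu>)) *s (bideg_op (J y) (lagrange (bideg_op (J y)) c \<mu>s v)
         + (- \<mu>) *s lagrange (bideg_op (J y)) c \<mu>s v))" for y
      by (simp add: fun_eq_iff lagrange_Cons vec_eq_iff)
    ultimately show ?case by simp
  qed
  then show ?thesis by (simp add: pq_proj_def)
qed

lemma smooth_on_vol_form:
  fixes J g :: "'d rvec \<Rightarrow> 'd rmat"
  assumes "smooth_on S J" "smooth_on S g" shows "smooth_on S (\<lambda>y. vol_form n (J y) (g y))"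
proof -
  have "smooth_on S (\<lambda>y. fund_form (J y) (g y))"
    unfolding fund_form_def omega_matrix_nth[symmetric] omega_matrix_def
    by (intro smooth_on_sum smooth_on_scale S smooth_on_of_real smooth_on_vec_nth smooth_on_const
        smooth_on_matrix_mult smooth_on_transpose assms)
  then have "smooth_on S (\<lambda>y. wedge_list (replicate n (fund_form (J y) (g y))))"
    by (induction n) (simp_all add: smooth_on_const[OF S] smooth_on_wedge)
  then show ?thesis unfolding vol_form_def by (intro smooth_on_scale smooth_on_const S)
qed

lemma opfield_hodge_star:
  assumes "smooth_on S J" "smooth_on S g" "\<And>y. y \<in> S \<Longrightarrow> hermitian_space n (J y) (g y)"
  obtains M where "opfield S M" "\<And>y. y \<in> S \<Longrightarrow> M y = hodge_star n (J y) (g y)"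
proof
  let ?M = "\<lambda>y v. vol_form n (J y) (g y) $ UNIV *s complement (cpull (cmat (matrix_inv (g y))) v)"
  show "opfield S ?M"
    using hermitian_space.g_invertible[OF assms(3)]
    by (intro opfield_scaled smooth_on_vec_nth smooth_on_vol_form S assms
        opfield_compose[OF opfield_const[OF clin_complement] opfield_cpull] smooth_on_cmat smooth_on_matrix_inv) auto
  show "?M y = hodge_star n (J y) (g y)" if "y \<in> S" for y
    by (simp add: fun_eq_iff hermitian_space.hodge_star_eq[OF assms(3)[OF that]]
        hermitian_space.star_def[OF assms(3)[OF that]] hermitian_space.\<tau>_def[OF assms(3)[OF that]])
qed

end

section \<open>Linear differential operators on families of functions\<close>

text \<open>\<open>T\<close> maps a family \<open>w\<close> of complex functions indexed by \<open>K\<close> to a field of forms; it is a linear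
  differential operator of order \<open>l\<close> on \<open>U\<close> with coefficients \<open>C\<close> and principal symbol \<open>s\<close>. Both the
  operators on sections of a bundle trivialized by a frame (\<open>K\<close> indexes the frame) and the operators
  on arbitrary forms (\<open>K\<close> indexes the standard basis) are of this kind.\<close>

definition coefficients :: "(('d::{finite,linorder}) rvec) set \<Rightarrow> 'k set \<Rightarrow> nat \<Rightarrow>
    (('k \<Rightarrow> 'd rvec \<Rightarrow> complex) \<Rightarrow> 'd rvec \<Rightarrow> 'd ext) \<Rightarrow> ('d rvec \<Rightarrow> 'd rvec \<Rightarrow> 'k \<Rightarrow> 'd ext) \<Rightarrow>
    ('k \<Rightarrow> 'd multiset \<Rightarrow> 'd rvec \<Rightarrow> 'd ext) \<Rightarrow> bool" where
  "coefficients U K l T s C \<longleftrightarrow> (\<forall>k\<in>K. \<forall>\<alpha>. smooth_on U (C k \<alpha>)) \<and>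
     (\<forall>w. (\<forall>k\<in>K. smooth_on U (w k)) \<longrightarrow> (\<forall>y\<in>U. T w y =
        (\<Sum>k\<in>K. \<Sum>\<alpha> | size \<alpha> \<le> l. mpartial \<alpha> (w k) y *s C k \<alpha> y))) \<and>
     (\<forall>y\<in>U. \<forall>k\<in>K. \<forall>\<xi>. s y \<xi> k = (\<Sum>\<alpha> | size \<alpha> = l. of_real (mpower \<xi> \<alpha>) *s C k \<alpha> y))"

definition diffop :: "(('d::{finite,linorder}) rvec) set \<Rightarrow> 'k set \<Rightarrow> nat \<Rightarrow>
    (('k \<Rightarrow> 'd rvec \<Rightarrow> complex) \<Rightarrow> 'd rvec \<Rightarrow> 'd ext) \<Rightarrow> ('d rvec \<Rightarrow> 'd rvec \<Rightarrow> 'k \<Rightarrow> 'd ext) \<Rightarrow> bool" where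
  "diffop U K l T s \<longleftrightarrow> (\<exists>C. coefficients U K l T s C)"

lemma coefficientsD:
  assumes "coefficients U K l T s C"
  shows "\<And>k \<alpha>. k \<in> K \<Longrightarrow> smooth_on U (C k \<alpha>)"
    and "\<And>w y. (\<And>k. k \<in> K \<Longrightarrow> smooth_on U (w k)) \<Longrightarrow> y \<in> U \<Longrightarrow>
       T w y = (\<Sum>k\<in>K. \<Sum>\<alpha> | size \<alpha> \<le> l. mpartial \<alpha> (w k) y *s C k \<alpha> y)"
    and "\<And>y k \<xi>. y \<in> U \<Longrightarrow> k \<in> K \<Longrightarrow> s y \<xi> k = (\<Sum>\<alpha> | size \<alpha> = l. of_real (mpower \<xi> \<alpha>) *s C k \<alpha> y)"
proof -
  note C = assms[unfolded coefficients_def]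
  note 1 = C[THEN conjunct1] and 2 = C[THEN conjunct2, THEN conjunct1] and 3 = C[THEN conjunct2, THEN conjunct2]
  show "smooth_on U (C k \<alpha>)" if "k \<in> K" for k \<alpha> by (rule 1[rule_format, OF that])
  show "T w y = (\<Sum>k\<in>K. \<Sum>\<alpha> | size \<alpha> \<le> l. mpartial \<alpha> (w k) y *s C k \<alpha> y)"
    if "\<And>k. k \<in> K \<Longrightarrow> smooth_on U (w k)" "y \<in> U" for w y
    by (rule 2[rule_format, OF that])
  show "s y \<xi> k = (\<Sum>\<alpha> | size \<alpha> = l. of_real (mpower \<xi> \<alpha>) *s C k \<alpha> y)" if "y \<in> U" "k \<in> K" for y k \<xi>
    by (rule 3[rule_format, OF that])
qed

lemma diffopI:
  assumes "\<And>k \<alpha>. k \<in> K \<Longrightarrow> smooth_on U (C k \<alpha>)"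
    "\<And>w y. (\<And>k. k \<in> K \<Longrightarrow> smooth_on U (w k)) \<Longrightarrow> y \<in> U \<Longrightarrow>
       T w y = (\<Sum>k\<in>K. \<Sum>\<alpha> | size \<alpha> \<le> l. mpartial \<alpha> (w k) y *s C k \<alpha> y)"
    "\<And>y k \<xi>. y \<in> U \<Longrightarrow> k \<in> K \<Longrightarrow> s y \<xi> k = (\<Sum>\<alpha> | size \<alpha> = l. of_real (mpower \<xi> \<alpha>) *s C k \<alpha> y)"
  shows "diffop U K l T s"
  unfolding diffop_def coefficients_def
proof (intro exI[of _ C] conjI ballI allI impI)
  show "T w y = (\<Sum>k\<in>K. \<Sum>\<alpha> | size \<alpha> \<le> l. mpartial \<alpha> (w k) y *s C k \<alpha> y)"
    if "\<forall>k\<in>K. smooth_on U (w k)" "y \<in> U" for w y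
    by (rule assms(2)[OF _ that(2)]) (rule that(1)[rule_format])
qed (rule assms(1,3); assumption)+

lemma finite_multisets_size_le: "finite {\<alpha> :: ('a::finite) multiset. size \<alpha> \<le> l}"
proof -
  have "{\<alpha> :: 'a multiset. size \<alpha> \<le> l} \<subseteq> mset ` {xs. set xs \<subseteq> UNIV \<and> length xs \<le> l}"
  proof
    fix \<alpha> :: "'a multiset" assume \<alpha>: "\<alpha> \<in> {\<alpha>. size \<alpha> \<le> l}"
    obtain xs where "mset xs = \<alpha>" using ex_mset by auto
    then show "\<alpha> \<in> mset ` {xs. set xs \<subseteq> UNIV \<and> length xs \<le> l}" using \<alpha> by auto
  qed
  then show ?thesis
    by (rule finite_subset[OF _ finite_imageI[OF finite_lists_length_le]]) simp
qed

lemma finite_multisets_size: "finite {\<alpha> :: ('a::finite) multiset. size \<alpha> = l}"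
  by (rule finite_subset[OF _ finite_multisets_size_le[of l]]) auto

lemma clin_imp_linear: "clin f \<Longrightarrow> linear f"
proof -
  assume f: "clin f"
  have sc: "r *\<^sub>R v = of_real r *s v" for r and v :: "(complex, 'n::finite) vec"
    by (simp add: vec_eq_iff scaleR_conv_of_real[where 'a = complex])
  show "linear f" by (rule linearI) (simp_all add: clin_add[OF f] clin_scale[OF f] sc)
qed

lemma partial_scale:
  assumes "f differentiable (at x)" "h differentiable (at x)"
  shows "partial i (\<lambda>x. f x *s (h x :: ('d::{finite,linorder}) ext)) x = f x *s partial i h x + partial i f x *s h x"
proof -
  have bb: "bounded_bilinear (\<lambda>(c :: complex) (v :: 'd ext). c *s v)"
    by (rule bilinear_conv_bounded_bilinear[THEN iffD1])
       (auto simp: bilinear_def vec_eq_iff algebra_simps intro!: linearI)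
  show ?thesis by (rule partial_bounded_bilinear[OF bb assms])
qed

lemma partial_sum:
  assumes "\<And>a. a \<in> A \<Longrightarrow> f a differentiable (at x)"
  shows "partial i (\<lambda>x. \<Sum>a\<in>A. f a x) x = (\<Sum>a\<in>A. partial i (f a) x)"
    and "(\<lambda>x. \<Sum>a\<in>A. f a x) differentiable (at x)"
  using assms by (induction A rule: infinite_finite_induct) (auto simp: partial_add)

lemma mpower_add_mset: "mpower \<xi> (add_mset j \<alpha>) = \<xi> $ j * mpower \<xi> \<alpha>"
  by (simp add: mpower_def)

lemma sum_add_mset:
  fixes F :: "('d::{finite,linorder}) multiset \<Rightarrow> 'd ext"
  shows "(\<Sum>\<alpha> | size \<alpha> \<le> l. F (add_mset j \<alpha>)) = (\<Sum>\<beta> | size \<beta> \<le> Suc l. if j \<in># \<beta> then F \<beta> else 0)"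
    and "(\<Sum>\<alpha> | size \<alpha> = l. F (add_mset j \<alpha>)) = (\<Sum>\<beta> | size \<beta> = Suc l. if j \<in># \<beta> then F \<beta> else 0)"
proof -
  have "(\<Sum>\<alpha> | size \<alpha> \<le> l. F (add_mset j \<alpha>)) = (\<Sum>\<beta> | size \<beta> \<le> Suc l \<and> j \<in># \<beta>. F \<beta>)"
    by (rule sum.reindex_bij_witness[of _ "\<lambda>\<beta>. \<beta> - {#j#}" "add_mset j"]) (auto simp: size_Diff_singleton)
  also have "\<dots> = (\<Sum>\<beta> | size \<beta> \<le> Suc l. if j \<in># \<beta> then F \<beta> else 0)"
    by (rule sum.mono_neutral_cong_left) (auto simp: finite_multisets_size_le)
  finally show "(\<Sum>\<alpha> | size \<alpha> \<le> l. F (add_mset j \<alpha>)) = (\<Sum>\<beta> | size \<beta> \<le> Suc l. if j \<in># \<beta> then F \<beta> else 0)" .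
  have "(\<Sum>\<alpha> | size \<alpha> = l. F (add_mset j \<alpha>)) = (\<Sum>\<beta> | size \<beta> = Suc l \<and> j \<in># \<beta>. F \<beta>)"
    by (rule sum.reindex_bij_witness[of _ "\<lambda>\<beta>. \<beta> - {#j#}" "add_mset j"]) (auto simp: size_Diff_singleton)
  also have "\<dots> = (\<Sum>\<beta> | size \<beta> = Suc l. if j \<in># \<beta> then F \<beta> else 0)"
    by (rule sum.mono_neutral_cong_left) (auto simp: finite_multisets_size)
  finally show "(\<Sum>\<alpha> | size \<alpha> = l. F (add_mset j \<alpha>)) = (\<Sum>\<beta> | size \<beta> = Suc l. if j \<in># \<beta> then F \<beta> else 0)" .
qed

context
  fixes U :: "(('d::{finite,linorder}) rvec) set" and K :: "'k set"
  assumes U: "open U" and K: "finite K"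
begin

lemma diffop_smooth:
  assumes "diffop U K l T s" "\<And>k. k \<in> K \<Longrightarrow> smooth_on U (w k)" shows "smooth_on U (T w)"
proof -
  obtain C where "coefficients U K l T s C" using assms(1) unfolding diffop_def by blast
  note C = coefficientsD[OF this]
  have "smooth_on U (\<lambda>y. \<Sum>k\<in>K. \<Sum>\<alpha> | size \<alpha> \<le> l. mpartial \<alpha> (w k) y *s C k \<alpha> y)"
    by (intro smooth_on_sum smooth_on_scale U smooth_on_mpartial assms(2) C(1))
  then show ?thesis by (rule smooth_on_cong[OF U, rotated]) (use C(2) assms(2) in auto)
qed

lemma diffop_cong:
  assumes "diffop U K l T s" "\<And>w y. (\<And>k. k \<in> K \<Longrightarrow> smooth_on U (w k)) \<Longrightarrow> y \<in> U \<Longrightarrow> T' w y = T w y"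
    "\<And>y \<xi> k. y \<in> U \<Longrightarrow> k \<in> K \<Longrightarrow> s' y \<xi> k = s y \<xi> k"
  shows "diffop U K l T' s'"
proof -
  obtain C where "coefficients U K l T s C" using assms(1) unfolding diffop_def by blast
  note C = coefficientsD[OF this]
  then show ?thesis by (intro diffopI[of _ _ C]) (simp_all add: assms(2,3))
qed

lemma diffop_frame:
  assumes "\<And>k. k \<in> K \<Longrightarrow> smooth_on U (e k)"
  shows "diffop U K 0 (\<lambda>w y. \<Sum>k\<in>K. w k y *s e k y) (\<lambda>y \<xi> k. e k y)"
proof (rule diffopI[of _ _ "\<lambda>k \<alpha>. e k"])
  have "{\<alpha> :: 'd multiset. size \<alpha> = 0} = {{#}}" by auto
  then show "e k y = (\<Sum>\<alpha> | size \<alpha> = 0. of_real (mpower \<xi> \<alpha>) *s e k y)" for k y and \<xi> :: "'d rvec"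
    by (simp add: mpower_def)
qed (simp_all add: assms)

lemma diffop_opfield:
  assumes "diffop U K l T s" "opfield U M"
  shows "diffop U K l (\<lambda>w y. M y (T w y)) (\<lambda>y \<xi> k. M y (s y \<xi> k))"
proof -
  note lin = clin_sum[OF opfield_clin[OF assms(2)]] clin_scale[OF opfield_clin[OF assms(2)]]
  obtain C where "coefficients U K l T s C" using assms(1) unfolding diffop_def by blast
  note C = coefficientsD[OF this]
  show ?thesis
    by (rule diffopI[of _ _ "\<lambda>k \<alpha> y. M y (C k \<alpha> y)"])
       (simp_all add: smooth_on_opfield[OF U assms(2)] C lin)
qed

lemma diffop_minus: "diffop U K l T s \<Longrightarrow> diffop U K l (\<lambda>w y. - T w y) (\<lambda>y \<xi> k. - s y \<xi> k)"
  using diffop_opfield[of l T s "\<lambda>y v. (-1) *s v"] opfield_const[OF U clin_scaled[OF clin_ident, of "-1"]]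
  by (simp add: vector_sneg_minus1[symmetric])

lemma diffop_add:
  assumes "diffop U K l T s" "diffop U K l T' s'"
  shows "diffop U K l (\<lambda>w y. T w y + T' w y) (\<lambda>y \<xi> k. s y \<xi> k + s' y \<xi> k)"
proof -
  obtain C where "coefficients U K l T s C" using assms(1) unfolding diffop_def by blast
  note C = coefficientsD[OF this]
  obtain C' where "coefficients U K l T' s' C'" using assms(2) unfolding diffop_def by blast
  note C' = coefficientsD[OF this]
  show ?thesis
    by (rule diffopI[of _ _ "\<lambda>k \<alpha> y. C k \<alpha> y + C' k \<alpha> y"])
       (simp_all add: smooth_on_add[OF U] C C' vector_add_ldistrib sum.distrib)
qed

lemma diffop_zero: "diffop U K l (\<lambda>w y. 0) (\<lambda>y \<xi> k. 0)"
  by (rule diffopI[of _ _ "\<lambda>k \<alpha> y. 0"]) (simp_all add: smooth_on_const[OF U])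

lemma diffop_sum:
  assumes "finite A" "\<And>a. a \<in> A \<Longrightarrow> diffop U K l (T a) (s a)"
  shows "diffop U K l (\<lambda>w y. \<Sum>a\<in>A. T a w y) (\<lambda>y \<xi> k. \<Sum>a\<in>A. s a y \<xi> k)"
  using assms by (induction A rule: finite_induct) (auto intro: diffop_zero diffop_add)

lemma diffop_raise_order:
  assumes "diffop U K l T s" "l < l'"
  shows "diffop U K l' T (\<lambda>y \<xi> k. 0)"
proof -
  obtain C where "coefficients U K l T s C" using assms(1) unfolding diffop_def by blast
  note C = coefficientsD[OF this]
  show ?thesis
  proof (rule diffopI[of _ _ "\<lambda>k \<alpha>. if size \<alpha> \<le> l then C k \<alpha> else (\<lambda>y. 0)"])
    fix w :: "'k \<Rightarrow> 'd rvec \<Rightarrow> complex" and y assume w: "\<And>k. k \<in> K \<Longrightarrow> smooth_on U (w k)" and y: "y \<in> U"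
    have "(\<Sum>\<alpha> | size \<alpha> \<le> l. mpartial \<alpha> (w k) y *s C k \<alpha> y) =
       (\<Sum>\<alpha> | size \<alpha> \<le> l'. mpartial \<alpha> (w k) y *s (if size \<alpha> \<le> l then C k \<alpha> else (\<lambda>y. 0)) y)" for k
      by (rule sum.mono_neutral_cong_left) (use assms(2) finite_multisets_size_le in auto)
    then show "T w y = (\<Sum>k\<in>K. \<Sum>\<alpha> | size \<alpha> \<le> l'. mpartial \<alpha> (w k) y *s (if size \<alpha> \<le> l then C k \<alpha> else (\<lambda>y. 0)) y)"
      using C(2)[OF w y] by simp
  qed (use C(1) assms(2) in \<open>auto simp: smooth_on_const[OF U]\<close>)
qed

text \<open>By the product rule, the coefficient at \<open>\<beta>\<close> of the new operator collects the old coefficient at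
  \<open>\<beta> - j\<close> and the derivative of the old coefficient at \<open>\<beta>\<close>. In the top order only the former remains.\<close>

lemma diffop_partial:
  assumes "diffop U K l T s"
  shows "diffop U K (Suc l) (\<lambda>w. partial j (T w)) (\<lambda>y \<xi> k. of_real (\<xi> $ j) *s s y \<xi> k)"
proof -
  obtain C where "coefficients U K l T s C" using assms unfolding diffop_def by blast
  note C = coefficientsD[OF this]
  define C' where "C' k \<beta> y = (if j \<in># \<beta> then C k (\<beta> - {#j#}) y else 0)
      + (if size \<beta> \<le> l then partial j (C k \<beta>) y else 0)" for k \<beta> y
  show ?thesis
  proof (rule diffopI[of _ _ C'])
    show "smooth_on U (C' k \<alpha>)" if "k \<in> K" for k \<alpha>
      unfolding C'_def[abs_def]
      by (intro smooth_on_add U; cases "j \<in># \<alpha>"; cases "size \<alpha> \<le> l")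
         (auto intro: C(1)[OF that] smooth_on_partial smooth_on_const[OF U])
  next
    fix w :: "'k \<Rightarrow> 'd rvec \<Rightarrow> complex" and y assume w: "\<And>k. k \<in> K \<Longrightarrow> smooth_on U (w k)" and y: "y \<in> U"
    have d: "mpartial \<alpha> (w k) differentiable at y" "C k \<alpha> differentiable at y" if "k \<in> K" for k \<alpha>
      using smooth_on_differentiable[OF smooth_on_mpartial[OF w[OF that]] y]
        smooth_on_differentiable[OF C(1)[OF that] y] by auto
    have ds: "(\<lambda>y. mpartial \<alpha> (w k) y *s C k \<alpha> y) differentiable at y" if "k \<in> K" for k \<alpha>
      by (rule smooth_on_differentiable[OF smooth_on_scale[OF U smooth_on_mpartial[OF w[OF that]] C(1)[OF that]] y])
    have "partial j (T w) y = partial j (\<lambda>y. \<Sum>k\<in>K. \<Sum>\<alpha> | size \<alpha> \<le> l. mpartial \<alpha> (w k) y *s C k \<alpha> y) y"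
      by (rule partial_cong[OF U y]) (rule C(2)[OF w])
    also have "\<dots> = (\<Sum>k\<in>K. partial j (\<lambda>y. \<Sum>\<alpha> | size \<alpha> \<le> l. mpartial \<alpha> (w k) y *s C k \<alpha> y) y)"
      by (rule partial_sum(1)) (intro partial_sum(2) ds)
    also have "\<dots> = (\<Sum>k\<in>K. \<Sum>\<alpha> | size \<alpha> \<le> l. partial j (\<lambda>y. mpartial \<alpha> (w k) y *s C k \<alpha> y) y)"
      by (intro sum.cong[OF refl] partial_sum(1) ds)
    also have "\<dots> = (\<Sum>k\<in>K. \<Sum>\<beta> | size \<beta> \<le> Suc l. mpartial \<beta> (w k) y *s C' k \<beta> y)"
    proof (rule sum.cong[OF refl])
      fix k assume k: "k \<in> K"
      have "(\<Sum>\<alpha> | size \<alpha> \<le> l. partial j (\<lambda>y. mpartial \<alpha> (w k) y *s C k \<alpha> y) y)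
          = (\<Sum>\<alpha> | size \<alpha> \<le> l. mpartial \<alpha> (w k) y *s partial j (C k \<alpha>) y)
            + (\<Sum>\<alpha> | size \<alpha> \<le> l. mpartial (add_mset j \<alpha>) (w k) y *s C k (add_mset j \<alpha> - {#j#}) y)"
        by (simp add: partial_scale[OF d[OF k]] mpartial_add_mset[OF U w[OF k] y] sum.distrib)
      also have "(\<Sum>\<alpha> | size \<alpha> \<le> l. mpartial (add_mset j \<alpha>) (w k) y *s C k (add_mset j \<alpha> - {#j#}) y)
          = (\<Sum>\<beta> | size \<beta> \<le> Suc l. if j \<in># \<beta> then mpartial \<beta> (w k) y *s C k (\<beta> - {#j#}) y else 0)"
        by (rule sum_add_mset(1)[of "\<lambda>\<beta>. mpartial \<beta> (w k) y *s C k (\<beta> - {#j#}) y"])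
      also have "(\<Sum>\<alpha> | size \<alpha> \<le> l. mpartial \<alpha> (w k) y *s partial j (C k \<alpha>) y)
          = (\<Sum>\<beta> | size \<beta> \<le> Suc l. if size \<beta> \<le> l then mpartial \<beta> (w k) y *s partial j (C k \<beta>) y else 0)"
        by (rule sum.mono_neutral_cong_left) (auto simp: finite_multisets_size_le)
      finally show "(\<Sum>\<alpha> | size \<alpha> \<le> l. partial j (\<lambda>y. mpartial \<alpha> (w k) y *s C k \<alpha> y) y)
          = (\<Sum>\<beta> | size \<beta> \<le> Suc l. mpartial \<beta> (w k) y *s C' k \<beta> y)"
        by (simp add: sum.distrib[symmetric] C'_def vector_add_ldistrib if_distrib[of "\<lambda>v. c *s v" for c] add.commute cong: if_cong)
    qed
    finally show "partial j (T w) y = (\<Sum>k\<in>K. \<Sum>\<beta> | size \<beta> \<le> Suc l. mpartial \<beta> (w k) y *s C' k \<beta> y)" .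
  next
    fix y k \<xi> assume y: "y \<in> U" "k \<in> K"
    have "of_real (\<xi> $ j) *s s y \<xi> k
        = (\<Sum>\<alpha> | size \<alpha> = l. of_real (mpower \<xi> (add_mset j \<alpha>)) *s C k (add_mset j \<alpha> - {#j#}) y)"
      by (simp add: C(3)[OF y] vec.scale_sum_right vector_smult_assoc mpower_add_mset)
    also have "\<dots> = (\<Sum>\<beta> | size \<beta> = Suc l. if j \<in># \<beta> then of_real (mpower \<xi> \<beta>) *s C k (\<beta> - {#j#}) y else 0)"
      by (rule sum_add_mset(2)[of "\<lambda>\<beta>. of_real (mpower \<xi> \<beta>) *s C k (\<beta> - {#j#}) y"])
    also have "\<dots> = (\<Sum>\<beta> | size \<beta> = Suc l. of_real (mpower \<xi> \<beta>) *s C' k \<beta> y)"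
      by (rule sum.cong) (auto simp: C'_def)
    finally show "of_real (\<xi> $ j) *s s y \<xi> k = (\<Sum>\<beta> | size \<beta> = Suc l. of_real (mpower \<xi> \<beta>) *s C' k \<beta> y)" .
  qed
qed

lemma diffop_ext_d:
  assumes "diffop U K l T s"
  shows "diffop U K (Suc l) (\<lambda>w. ext_d (T w)) (\<lambda>y \<xi> k. emult (\<chi> i. of_real (\<xi> $ i)) (s y \<xi> k))"
proof (rule diffop_cong)
  show "diffop U K (Suc l) (\<lambda>w y. \<Sum>i\<in>UNIV. emult (axis i 1) (partial i (T w) y))
     (\<lambda>y \<xi> k. \<Sum>i\<in>UNIV. emult (axis i 1) (of_real (\<xi> $ i) *s s y \<xi> k))"
    by (rule diffop_sum) (auto intro: diffop_opfield[OF diffop_partial[OF assms] opfield_const[OF U clin_emult]])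
  show "ext_d (T w) y = (\<Sum>i\<in>UNIV. emult (axis i 1) (partial i (T w) y))" for w y
    by (simp add: ext_d_def emult_def)
  show "emult (\<chi> i. of_real (\<xi> $ i)) (s y \<xi> k) = (\<Sum>i\<in>UNIV. emult (axis i 1) (of_real (\<xi> $ i) *s s y \<xi> k))" for \<xi> y k
  proof -
    have "emult (\<chi> i. of_real (\<xi> $ i)) v = (\<Sum>i\<in>UNIV. (\<chi> i. of_real (\<xi> $ i)) $ i *s emult (axis i 1) v)" for v
      by (rule clin_expand[OF clin_emult_left])
    then show ?thesis by (simp add: clin_scale[OF clin_emult])
  qed
qed

end

section \<open>The operators on a coordinate domain\<close>

subsection \<open>Locality, principal symbol and bidegree\<close>

text \<open>Both \<open>\<partial>\<close> and its conjugate are components of \<open>d\<close> of a fixed bidegree \<open>(a,b)\<close>.\<close>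

definition d_comp :: "nat \<Rightarrow> nat \<Rightarrow> ('d rvec \<Rightarrow> 'd rmat) \<Rightarrow> ('d rvec \<Rightarrow> 'd ext) \<Rightarrow> 'd rvec \<Rightarrow> ('d::{finite,linorder}) ext" where
  "d_comp a b J f y = (\<Sum>p\<le>CARD('d). \<Sum>q\<le>CARD('d).
     pq_comp (J y) (p + a) (q + b) (ext_d (\<lambda>z. pq_comp (J z) p q (f z)) y))"

lemma del_eq_d_comp: "del J = d_comp 1 0 J" and delbar_eq_d_comp: "delbar J = d_comp 0 1 J"
  by (simp_all add: fun_eq_iff del_def delbar_def d_comp_def)

lemma ext_d_cong:
  assumes "open V" "y \<in> V" "\<And>z. z \<in> V \<Longrightarrow> f z = h z" shows "ext_d f y = ext_d h y"
  using partial_cong[OF assms] by (simp add: ext_d_def)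

lemma d_comp_cong:
  assumes "open V" "y \<in> V" "\<And>z. z \<in> V \<Longrightarrow> f z = h z" shows "d_comp a b J f y = d_comp a b J h y"
  unfolding d_comp_def
  by (intro sum.cong refl arg_cong[of _ _ "pq_comp _ _ _"] ext_d_cong[OF assms(1,2)]) (simp add: assms(3))

lemma adj_cong:
  assumes "open V" "y \<in> V" "\<And>z. z \<in> V \<Longrightarrow> f z = h z"
  shows "del_adj n J g f y = del_adj n J g h y" "delbar_adj n J g f y = delbar_adj n J g h y"
proof -
  have "d_comp a b J (star_field n J g f) z = d_comp a b J (star_field n J g h) z" if "z \<in> V" for a b z
    by (rule d_comp_cong[OF assms(1) that]) (simp add: star_field_def assms(3))
  then show "del_adj n J g f y = del_adj n J g h y" "delbar_adj n J g f y = delbar_adj n J g h y"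
    using assms(2) by (simp_all add: del_adj_def delbar_adj_def del_eq_d_comp delbar_eq_d_comp star_field_def)
qed

lemma bott_chern_local_cong:
  assumes V: "open V" and y: "y \<in> V" and "\<And>z. z \<in> V \<Longrightarrow> f z = h z"
  shows "bott_chern_local n J g f y = bott_chern_local n J g h y"
proof -
  define R where "R F = (\<forall>f h. (\<forall>z\<in>V. f z = h z) \<longrightarrow> (\<forall>z\<in>V. F f z = F h z))" for F :: "('a rvec \<Rightarrow> 'a ext) \<Rightarrow> 'a rvec \<Rightarrow> 'a ext"
  have ops: "R (del J)" "R (delbar J)" "R (del_adj n J g)" "R (delbar_adj n J g)"
    unfolding R_def del_eq_d_comp delbar_eq_d_comp
    using d_comp_cong[OF V] adj_cong[OF V] by (blast, blast, blast, blast)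
  have comp: "R (\<lambda>f. F (H f))" if "R F" "R H" for F H using that unfolding R_def by blast
  have add: "R (\<lambda>f y. F f y + H f y)" if "R F" "R H" for F H using that unfolding R_def by metis
  have "R (\<lambda>f y. bott_chern_local n J g f y)"
    unfolding bott_chern_local_def Let_def
    by (rule add; (rule add)?; (rule add)?; (rule add)?; (rule add)?)
       (rule comp[OF ops(1) comp[OF ops(2) comp[OF ops(4) ops(3)]]]
             comp[OF ops(4) comp[OF ops(3) comp[OF ops(1) ops(2)]]]
             comp[OF ops(3) comp[OF ops(2) comp[OF ops(4) ops(1)]]]
             comp[OF ops(4) comp[OF ops(1) comp[OF ops(3) ops(2)]]]
             comp[OF ops(3) ops(1)] comp[OF ops(4) ops(2)])+
  then show ?thesis using y assms(3) unfolding R_def by blast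
qed

abbreviation rcov :: "('d::finite) rvec \<Rightarrow> 'd cvec" where
  "rcov \<xi> \<equiv> (\<chi> i. of_real (\<xi> $ i))"

locale hermitian_domain =
  fixes U :: "(('d::{finite,linorder}) rvec) set" and n :: nat and J g :: "'d rvec \<Rightarrow> 'd rmat"
  assumes U: "open U" and smooth_J: "smooth_on U J" and smooth_g: "smooth_on U g"
    and herm: "\<And>y. y \<in> U \<Longrightarrow> hermitian_space n (J y) (g y)"
begin

lemma complex: "y \<in> U \<Longrightarrow> complex_structure (J y)"
  using herm unfolding hermitian_space_def complex_structure_def by blast

lemma d_comp_eq:
  assumes "y \<in> U"
  shows "d_comp a b J f y = (\<Sum>p\<le>CARD('d). \<Sum>q\<le>CARD('d).
     pq_proj (J y) (p + a) (q + b) (ext_d (\<lambda>z. pq_proj (J z) p q (f z)) y))"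
  unfolding d_comp_def complex_structure.pq_comp_eq[OF complex[OF assms]]
  by (intro sum.cong refl arg_cong[of _ _ "pq_proj _ _ _"] ext_d_cong[OF U assms])
     (simp add: complex_structure.pq_comp_eq[OF complex])

lemma diffop_d_comp:
  assumes K: "finite K" and T: "diffop U K l T s"
  shows "diffop U K (Suc l) (\<lambda>w. d_comp a b J (T w)) (\<lambda>y \<xi> k. \<Sum>p\<le>CARD('d). \<Sum>q\<le>CARD('d).
     pq_proj (J y) (p + a) (q + b) (emult (rcov \<xi>) (pq_proj (J y) p q (s y \<xi> k))))"
proof (rule diffop_cong[OF U K])
  show "diffop U K (Suc l) (\<lambda>w y. \<Sum>p\<le>CARD('d). \<Sum>q\<le>CARD('d).
     pq_proj (J y) (p + a) (q + b) (ext_d (\<lambda>z. pq_proj (J z) p q (T w z)) y))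
     (\<lambda>y \<xi> k. \<Sum>p\<le>CARD('d). \<Sum>q\<le>CARD('d).
       pq_proj (J y) (p + a) (q + b) (emult (rcov \<xi>) (pq_proj (J y) p q (s y \<xi> k))))"
    by (rule diffop_sum[OF U K finite_atMost], rule diffop_sum[OF U K finite_atMost],
        rule diffop_opfield[OF U K _ opfield_pq_proj[OF U smooth_J]],
        rule diffop_ext_d[OF U K diffop_opfield[OF U K T opfield_pq_proj[OF U smooth_J]]])
qed (simp_all add: d_comp_eq)

lemma diffop_del:
  assumes "finite K" "diffop U K l T s"
  shows "diffop U K (Suc l) (\<lambda>w. del J (T w)) (\<lambda>y \<xi> k. emult (complex_structure.proj10 (J y) (rcov \<xi>)) (s y \<xi> k))"
  unfolding del_eq_d_comp
  by (rule diffop_cong[OF U assms(1) diffop_d_comp[OF assms, where a = 1 and b = 0]])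
     (simp_all add: complex_structure.pq_proj_emult(1)[OF complex, simplified])

lemma diffop_delbar:
  assumes "finite K" "diffop U K l T s"
  shows "diffop U K (Suc l) (\<lambda>w. delbar J (T w)) (\<lambda>y \<xi> k. emult (complex_structure.proj01 (J y) (rcov \<xi>)) (s y \<xi> k))"
  unfolding delbar_eq_d_comp
  by (rule diffop_cong[OF U assms(1) diffop_d_comp[OF assms, where a = 0 and b = 1]])
     (simp_all add: complex_structure.pq_proj_emult(2)[OF complex, simplified])

lemma diffop_star_field:
  assumes "finite K" "diffop U K l T s"
  shows "diffop U K l (\<lambda>w. star_field n J g (T w)) (\<lambda>y \<xi> k. hodge_star n (J y) (g y) (s y \<xi> k))"
proof (rule opfield_hodge_star[OF U smooth_J smooth_g herm])
  fix M assume M: "opfield U M" "\<And>y. y \<in> U \<Longrightarrow> M y = hodge_star n (J y) (g y)"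
  show ?thesis
    by (rule diffop_cong[OF U assms(1) diffop_opfield[OF U assms M(1)]]) (simp_all add: M(2) star_field_def)
qed

lemma diffop_adj:
  assumes "finite K" "diffop U K l T s"
  shows "diffop U K (Suc l) (\<lambda>w. del_adj n J g (T w)) (\<lambda>y \<xi> k.
       - hodge_star n (J y) (g y) (emult (complex_structure.proj01 (J y) (rcov \<xi>)) (hodge_star n (J y) (g y) (s y \<xi> k))))"
    and "diffop U K (Suc l) (\<lambda>w. delbar_adj n J g (T w)) (\<lambda>y \<xi> k.
       - hodge_star n (J y) (g y) (emult (complex_structure.proj10 (J y) (rcov \<xi>)) (hodge_star n (J y) (g y) (s y \<xi> k))))"
  unfolding del_adj_def[abs_def] delbar_adj_def[abs_def]
  by (intro diffop_minus[OF U assms(1)] diffop_star_field[OF assms(1)]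
        diffop_delbar[OF assms(1)] diffop_del[OF assms(1)] assms(2))+

definition bc_factor :: "'d rvec \<Rightarrow> 'd rvec \<Rightarrow> complex" where
  "bc_factor y \<xi> = (hermitian_space.\<kappa> n (J y) (g y) * hermitian_space.cov_norm (J y) (g y) (rcov \<xi>))\<^sup>2"

lemma bc_factor_nonzero: "y \<in> U \<Longrightarrow> \<xi> \<noteq> 0 \<Longrightarrow> bc_factor y \<xi> \<noteq> 0"
  by (simp add: bc_factor_def hermitian_space.\<kappa>_nonzero[OF herm] hermitian_space.cov_norm_nonzero[OF herm])

text \<open>The operators are composed along the definition of the Laplacian; the two summands of order 2 have
  vanishing symbol in order 4.\<close>

lemma diffop_bott_chern:
  assumes K: "finite K" and T: "diffop U K 0 T s"
  shows "diffop U K 4 (\<lambda>w. bott_chern_local n J g (T w)) (\<lambda>y \<xi> k. bc_factor y \<xi> *s s y \<xi> k)"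
proof -
  note D = diffop_del[OF K] and Db = diffop_delbar[OF K] and Da = diffop_adj(1)[OF K] and Dba = diffop_adj(2)[OF K]
  note add = diffop_add[OF U K] and raise = diffop_raise_order[OF U K]
  have 4: "Suc (Suc (Suc (Suc 0))) = 4" "Suc (Suc 0) < 4" by simp_all
  note main = add[OF add[OF add[OF add[OF add[OF
      D[OF Db[OF Dba[OF Da[OF T]]], unfolded 4] Dba[OF Da[OF D[OF Db[OF T]]], unfolded 4]]
      Da[OF Db[OF Dba[OF D[OF T]]], unfolded 4]] Dba[OF D[OF Da[OF Db[OF T]]], unfolded 4]]
      raise[OF Da[OF D[OF T]] 4(2)]] raise[OF Dba[OF Db[OF T]] 4(2)]]
  show ?thesis
  proof (rule diffop_cong[OF U K main])
    fix y \<xi> k assume y: "y \<in> U"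
    interpret h: hermitian_space n "J y" "g y" by (rule herm[OF y])
    show "bc_factor y \<xi> *s s y \<xi> k = emult (h.proj10 (rcov \<xi>)) (emult (h.proj01 (rcov \<xi>))
         (- hodge_star n (J y) (g y) (emult (h.proj10 (rcov \<xi>)) (hodge_star n (J y) (g y)
           (- hodge_star n (J y) (g y) (emult (h.proj01 (rcov \<xi>)) (hodge_star n (J y) (g y) (s y \<xi> k))))))))
       + - hodge_star n (J y) (g y) (emult (h.proj10 (rcov \<xi>)) (hodge_star n (J y) (g y)
           (- hodge_star n (J y) (g y) (emult (h.proj01 (rcov \<xi>)) (hodge_star n (J y) (g y)
             (emult (h.proj10 (rcov \<xi>)) (emult (h.proj01 (rcov \<xi>)) (s y \<xi> k))))))))
       + - hodge_star n (J y) (g y) (emult (h.proj01 (rcov \<xi>)) (hodge_star n (J y) (g y) (emult (h.proj01 (rcov \<xi>))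
           (- hodge_star n (J y) (g y) (emult (h.proj10 (rcov \<xi>)) (hodge_star n (J y) (g y) (emult (h.proj10 (rcov \<xi>)) (s y \<xi> k))))))))
       + - hodge_star n (J y) (g y) (emult (h.proj10 (rcov \<xi>)) (hodge_star n (J y) (g y) (emult (h.proj10 (rcov \<xi>))
           (- hodge_star n (J y) (g y) (emult (h.proj01 (rcov \<xi>)) (hodge_star n (J y) (g y) (emult (h.proj01 (rcov \<xi>)) (s y \<xi> k))))))))
       + 0 + 0"
      using h.bott_chern_symbol[of "rcov \<xi>" "s y \<xi> k"]
      by (simp only: bc_factor_def h.sym_del_def h.sym_delbar_def h.sym_del_adj_def h.sym_delbar_adj_def h.hodge_star_eq add_0_right)
  qed (simp only: bott_chern_local_def Let_def)
qed

text \<open>Taking the standard basis as frame, the preceding statements apply to arbitrary forms.\<close>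

lemma standard_frame: "(\<lambda>y. \<Sum>I\<in>UNIV. f y $ I *s axis I 1) = (f :: 'd rvec \<Rightarrow> 'd ext)"
  by (simp add: fun_eq_iff vec_axis_expand[symmetric])

lemma smooth_on_diffop_standard:
  assumes "\<And>T :: ('d set \<Rightarrow> 'd rvec \<Rightarrow> complex) \<Rightarrow> 'd rvec \<Rightarrow> 'd ext.
      \<And>s. diffop U UNIV 0 T s \<Longrightarrow> \<exists>l s'. diffop U UNIV l (\<lambda>w. P (T w)) s'"
    and "smooth_on U f"
  shows "smooth_on U (P f)"
proof -
  obtain l s' where "diffop U UNIV l (\<lambda>w. P (\<lambda>y. \<Sum>I\<in>UNIV. w I y *s axis I 1)) s'"
    using assms(1)[OF diffop_frame[OF U finite, where e = "\<lambda>I y. axis I 1"]] smooth_on_const[OF U] by blast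
  from diffop_smooth[OF U finite this, of "\<lambda>I y. f y $ I"] show ?thesis
    using smooth_on_vec_nth[OF U assms(2)] by (simp add: standard_frame)
qed

lemma smooth_on_d_comp: "smooth_on U f \<Longrightarrow> smooth_on U (d_comp a b J f)"
  by (rule smooth_on_diffop_standard) (use diffop_d_comp[OF finite] in blast)

lemma smooth_on_star_field: "smooth_on U f \<Longrightarrow> smooth_on U (star_field n J g f)"
  by (rule smooth_on_diffop_standard) (use diffop_star_field[OF finite] in blast)

lemma smooth_on_bott_chern: "smooth_on U f \<Longrightarrow> smooth_on U (bott_chern_local n J g f)"
  by (rule smooth_on_diffop_standard) (use diffop_bott_chern[OF finite] in blast)

lemma bott_chern_coefficients:
  obtains C :: "'d set \<Rightarrow> 'd multiset \<Rightarrow> 'd rvec \<Rightarrow> 'd ext" where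
    "\<forall>f. smooth_on U f \<longrightarrow> (\<forall>y\<in>U. bott_chern_local n J g f y =
      (\<Sum>I\<in>UNIV. \<Sum>\<alpha> | size \<alpha> \<le> 4. mpartial \<alpha> (\<lambda>y. f y $ I) y *s C I \<alpha> y))"
proof -
  have "diffop U UNIV 4 (\<lambda>w. bott_chern_local n J g (\<lambda>y. \<Sum>I\<in>UNIV. w I y *s axis I 1))
      (\<lambda>y \<xi> k. bc_factor y \<xi> *s axis k 1)"
    by (rule diffop_bott_chern[OF finite diffop_frame[OF U finite]]) (rule smooth_on_const[OF U])
  then obtain C where "coefficients U UNIV 4 (\<lambda>w. bott_chern_local n J g (\<lambda>y. \<Sum>I\<in>UNIV. w I y *s axis I 1))
      (\<lambda>y \<xi> k. bc_factor y \<xi> *s axis k 1) C"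
    unfolding diffop_def by blast
  note C = coefficientsD(2)[OF this]
  show thesis
  proof (rule that[of C], intro allI impI ballI)
    fix f :: "'d rvec \<Rightarrow> 'd ext" and y assume f: "smooth_on U f" and y: "y \<in> U"
    show "bott_chern_local n J g f y =
        (\<Sum>I\<in>UNIV. \<Sum>\<alpha> | size \<alpha> \<le> 4. mpartial \<alpha> (\<lambda>y. f y $ I) y *s C I \<alpha> y)"
      using C[of "\<lambda>I y. f y $ I", OF smooth_on_vec_nth[OF U f] y] by (simp add: standard_frame)
  qed
qed

lemma bott_chern_add:
  assumes "smooth_on U f" "smooth_on U h" "y \<in> U"
  shows "bott_chern_local n J g (\<lambda>y. f y + h y) y = bott_chern_local n J g f y + bott_chern_local n J g h y"
proof -
  obtain C where "\<forall>f. smooth_on U f \<longrightarrow> (\<forall>y\<in>U. bott_chern_local n J g f y =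
      (\<Sum>I\<in>UNIV. \<Sum>\<alpha> | size \<alpha> \<le> 4. mpartial \<alpha> (\<lambda>y. f y $ I) y *s C I \<alpha> y))"
    by (rule bott_chern_coefficients)
  note C = this[rule_format]
  have "mpartial \<alpha> (\<lambda>y. (f y + h y) $ I) y = mpartial \<alpha> (\<lambda>y. f y $ I) y + mpartial \<alpha> (\<lambda>y. h y $ I) y" for \<alpha> I
    using mpartial_add[OF U smooth_on_vec_nth[OF U assms(1)] smooth_on_vec_nth[OF U assms(2)] assms(3)] by simp
  then show ?thesis
    by (simp only: C[OF assms(1,3)] C[OF assms(2,3)] C[OF smooth_on_add[OF U assms(1,2)] assms(3)]
        vector_sadd_rdistrib sum.distrib)
qed

lemma bott_chern_scale:
  assumes "smooth_on U f" "y \<in> U"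
  shows "bott_chern_local n J g (\<lambda>y. c *s f y) y = c *s bott_chern_local n J g f y"
proof -
  obtain C where "\<forall>f. smooth_on U f \<longrightarrow> (\<forall>y\<in>U. bott_chern_local n J g f y =
      (\<Sum>I\<in>UNIV. \<Sum>\<alpha> | size \<alpha> \<le> 4. mpartial \<alpha> (\<lambda>y. f y $ I) y *s C I \<alpha> y))"
    by (rule bott_chern_coefficients)
  note C = this[rule_format]
  have "mpartial \<alpha> (\<lambda>y. (c *s f y) $ I) y = c * mpartial \<alpha> (\<lambda>y. f y $ I) y" for \<alpha> I
    using mpartial_bounded_linear[OF bounded_linear_mult_right[of c] U smooth_on_vec_nth[OF U assms(1)] assms(2)] by simp
  then show ?thesis
    by (simp only: C[OF assms(1,2)] C[OF smooth_on_scale[OF U smooth_on_const[OF U] assms(1)] assms(2)]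
        vector_smult_assoc[symmetric] vec.scale_sum_right)
qed

abbreviation wt_field :: "int \<Rightarrow> int \<Rightarrow> ('d rvec \<Rightarrow> 'd ext) \<Rightarrow> bool" where
  "wt_field a b f \<equiv> (\<forall>y\<in>U. f y \<in> complex_structure.wt (J y) a b)"

text \<open>On a field of pure bidegree only one summand of \<open>d_comp\<close> survives, as the other components of the
  field vanish identically.\<close>

lemma d_comp_wt_field:
  assumes f: "wt_field a b f" shows "wt_field (a + int i) (b + int j) (d_comp i j J f)"
proof
  fix y assume y: "y \<in> U"
  interpret cs: complex_structure "J y" by (rule complex[OF y])
  have "pq_proj (J y) (p + i) (q + j) (ext_d (\<lambda>z. pq_proj (J z) p q (f z)) y) \<in> cs.wt (a + int i) (b + int j)" for p q
  proof (cases "a = int p \<and> b = int q")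
    case True
    then show ?thesis
      using cs.pq_proj_in[of "p + i" "q + j"] cs.wt_nat[of "p + i" "q + j"] by simp
  next
    case False
    have "pq_proj (J z) p q (f z) = 0" if z: "z \<in> U" for z
    proof -
      interpret cz: complex_structure "J z" by (rule complex[OF z])
      have "f z \<in> cz.wt a b" using f z by blast
      then show ?thesis
      proof (cases rule: cz.wt_cases)
        case (2 r s)
        then show ?thesis using False pq_proj_other[OF 2(3)] by auto
      qed (simp add: clin_zero[OF clin_pq_proj])
    qed
    then have "ext_d (\<lambda>z. pq_proj (J z) p q (f z)) y = ext_d (\<lambda>z. 0) y"
      by (rule ext_d_cong[OF U y])
    also have "\<dots> = 0" by (simp add: ext_d_def clin_zero[OF clin_wedge_right])
    finally show ?thesis by (simp add: clin_zero[OF clin_pq_proj] cs.wt_zero)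
  qed
  then show "d_comp i j J f y \<in> cs.wt (a + int i) (b + int j)"
    unfolding d_comp_eq[OF y] by (intro vec.subspace_sum[OF cs.subspace_wt])
qed

lemma star_wt_field: "wt_field a b f \<Longrightarrow> wt_field (int n - b) (int n - a) (star_field n J g f)"
  by (simp add: star_field_def hermitian_space.hodge_star_eq[OF herm] hermitian_space.star_wt[OF herm])

lemma minus_wt_field: "wt_field a b f \<Longrightarrow> wt_field a b (\<lambda>y. - f y)"
  using vec.subspace_neg[OF complex_structure.subspace_wt[OF complex]] by blast

lemma add_wt_field: "wt_field a b f \<Longrightarrow> wt_field a b h \<Longrightarrow> wt_field a b (\<lambda>y. f y + h y)"
  using vec.subspace_add[OF complex_structure.subspace_wt[OF complex]] by blast

text \<open>The adjoints lower a degree because the star reflects bidegrees: \<open>(a,b) \<mapsto> (n - b, n - a)\<close>. All six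
  summands return to the bidegree they started from.\<close>

lemma bott_chern_wt_field:
  assumes "wt_field a b f" shows "wt_field a b (bott_chern_local n J g f)"
proof -
  have D: "wt_field (a + 1) b (del J f)" if "wt_field a b f" for a b f
    using d_comp_wt_field[OF that, where i = 1 and j = 0] by (simp add: del_eq_d_comp)
  have Db: "wt_field a (b + 1) (delbar J f)" if "wt_field a b f" for a b f
    using d_comp_wt_field[OF that, where i = 0 and j = 1] by (simp add: delbar_eq_d_comp)
  have Da: "wt_field (a - 1) b (del_adj n J g f)" if "wt_field a b f" for a b f
  proof -
    have "wt_field (int n - (int n - a + 1)) (int n - (int n - b)) (del_adj n J g f)"
      unfolding del_adj_def[abs_def] by (intro minus_wt_field star_wt_field Db that)
    then show ?thesis by (simp add: algebra_simps)
  qed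
  have Dba: "wt_field a (b - 1) (delbar_adj n J g f)" if "wt_field a b f" for a b f
  proof -
    have "wt_field (int n - (int n - a)) (int n - (int n - b + 1)) (delbar_adj n J g f)"
      unfolding delbar_adj_def[abs_def] by (intro minus_wt_field star_wt_field D that)
    then show ?thesis by (simp add: algebra_simps)
  qed
  have "wt_field a b (\<lambda>y. bott_chern_local n J g f y)"
    unfolding bott_chern_local_def Let_def
    using D[OF Db[OF Dba[OF Da[OF assms]]]] Dba[OF Da[OF D[OF Db[OF assms]]]] Da[OF Db[OF Dba[OF D[OF assms]]]]
      Dba[OF D[OF Da[OF Db[OF assms]]]] Da[OF D[OF assms]] Dba[OF Db[OF assms]]
    by (intro add_wt_field) simp_all
  then show ?thesis by simp
qed

lemma bott_chern_pq_space:
  assumes "\<And>y. y \<in> U \<Longrightarrow> f y \<in> pq_space (J y) p q" "y \<in> U"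
  shows "bott_chern_local n J g f y \<in> pq_space (J y) p q"
  using bott_chern_wt_field[of f "int p" "int q"] assms
  by (simp add: complex_structure.wt_nat[OF complex])

end

subsection \<open>Naturality under coordinate changes\<close>

lemma mscale_one: "mscale 1 A = A"
  by (simp add: mscale_def vec_eq_iff)

lemma jacobian_nth: "jacobian \<phi> (at y) $ i $ j = partial j \<phi> y $ i"
  by (simp add: jacobian_def matrix_def partial_def)

lemma smooth_on_jacobian:
  fixes \<phi> :: "('d::finite) rvec \<Rightarrow> 'd rvec"
  assumes "open S" "smooth_on S \<phi>" shows "smooth_on S (\<lambda>y. jacobian \<phi> (at y))"
proof -
  have "(\<lambda>y. jacobian \<phi> (at y)) = (\<lambda>y. \<chi> i j. partial j \<phi> y $ i)"
    by (simp add: fun_eq_iff vec_eq_iff jacobian_nth)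
  moreover have "smooth_on S (\<lambda>y. \<chi> i j. partial j \<phi> y $ i)"
    by (intro smooth_on_vec_lambda assms(1) smooth_on_vec_nth smooth_on_partial assms(2))
  ultimately show ?thesis by simp
qed

lemma partial_vec_nth: "f differentiable (at x) \<Longrightarrow> partial i (\<lambda>x. f x $ k) x = partial i f x $ k"
  by (rule partial_bounded_linear[OF bounded_linear_vec_nth])

lemma partial_of_real:
  "f differentiable (at x) \<Longrightarrow> partial i (\<lambda>x. of_real (f x) :: complex) x = of_real (partial i f x)"
  by (rule partial_bounded_linear[OF bounded_linear_of_real])

lemma partial_emult:
  assumes "a differentiable (at x)" "h differentiable (at x)"
  shows "partial i (\<lambda>x. emult (a x) (h x)) x = emult (a x) (partial i h x) + emult (partial i a x) (h x)"
proof -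
  have "bounded_bilinear (emult :: 'b cvec \<Rightarrow> 'b ext \<Rightarrow> 'b ext)"
    by (rule bilinear_conv_bounded_bilinear[THEN iffD1])
       (simp add: bilinear_def clin_imp_linear clin_emult clin_emult_left)
  then show ?thesis by (rule partial_bounded_bilinear[OF _ assms])
qed

text \<open>The pullback of a constant form is closed: it is a wedge product of differentials, and second
  partial derivatives are symmetric.\<close>

lemma ext_d_pullback_axis:
  fixes \<phi> :: "('d::{finite,linorder}) rvec \<Rightarrow> 'd rvec"
  assumes S: "open S" and \<phi>: "smooth_on S \<phi>" and y: "y \<in> S"
  shows "ext_d (\<lambda>y. cpull (cmat (jacobian \<phi> (at y))) (axis I 1)) y = 0"
proof -
  define a where "a i y = (\<chi> k. complex_of_real (partial k \<phi> y $ i))" for i y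
  have a: "cmat (jacobian \<phi> (at y)) $ i = a i y" for i y
    by (simp add: a_def cmat_def vec_eq_iff jacobian_nth)
  have sa: "smooth_on S (a i)" for i
    unfolding a_def[abs_def]
    by (intro smooth_on_vec_lambda S smooth_on_of_real smooth_on_vec_nth smooth_on_partial \<phi>)
  have pa: "partial j (a i) y $ k = of_real (partial j (partial k \<phi>) y $ i)" for i j k
  proof -
    have d: "partial k \<phi> differentiable (at y)"
      by (rule smooth_on_differentiable[OF smooth_on_partial[OF \<phi>] y])
    have "partial j (a i) y $ k = partial j (\<lambda>y. a i y $ k) y"
      by (rule partial_vec_nth[symmetric, OF smooth_on_differentiable[OF sa y]])
    also have "\<dots> = of_real (partial j (\<lambda>y. partial k \<phi> y $ i) y)"
      unfolding a_def vec_lambda_beta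
      by (rule partial_of_real[OF differentiable_bounded_linear[OF bounded_linear_vec_nth d]])
    finally show ?thesis by (simp add: partial_vec_nth[OF d])
  qed
  have closed: "(\<Sum>j\<in>UNIV. emult (axis j 1) (emult (partial j (a i) y) v)) = 0" for i v
  proof -
    define c where "c j k = (of_real (partial j (partial k \<phi>) y $ i) :: complex)" for j k
    define F where "F j k = c j k *s emult (axis j 1) (emult (axis k 1) v)" for j k
    have "c j k = c k j" for j k
      using partial_commute[OF S y \<phi>, of j k] by (simp add: c_def)
    then have anti: "F j k = - F k j" for j k
      unfolding F_def by (subst emult_anticommute) simp
    have "emult (partial j (a i) y) v = (\<Sum>k\<in>UNIV. c j k *s emult (axis k 1) v)" for j
      by (subst clin_expand[OF clin_emult_left]) (simp add: pa c_def)
    then have "(\<Sum>j\<in>UNIV. emult (axis j 1) (emult (partial j (a i) y) v)) = (\<Sum>j\<in>UNIV. \<Sum>k\<in>UNIV. F j k)"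
      by (simp add: clin_sum[OF clin_emult] clin_scale[OF clin_emult] F_def)
    moreover have "(\<Sum>j\<in>UNIV. \<Sum>k\<in>UNIV. F j k) = - (\<Sum>j\<in>UNIV. \<Sum>k\<in>UNIV. F j k)"
    proof -
      have "(\<Sum>j\<in>UNIV. \<Sum>k\<in>UNIV. F j k) = (\<Sum>k\<in>UNIV. \<Sum>j\<in>UNIV. F j k)" by (rule sum.swap)
      also have "\<dots> = (\<Sum>k\<in>UNIV. \<Sum>j\<in>UNIV. - F k j)" by (intro sum.cong refl anti)
      finally show ?thesis by (simp add: sum_negf)
    qed
    moreover have "x = 0" if "x = - x" for x :: "'d ext"
    proof -
      have "x $ K = - (x $ K)" for K using arg_cong[OF that, of "\<lambda>v. v $ K"] by simp
      then show ?thesis by (simp add: vec_eq_iff)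
    qed
    ultimately show ?thesis by simp
  qed
  have "ext_d (\<lambda>y. wedge_list (map (\<lambda>i. covec (a i y)) L)) y = 0
      \<and> smooth_on S (\<lambda>y. wedge_list (map (\<lambda>i. covec (a i y)) L))" for L
  proof (induction L)
    case Nil
    then show ?case by (simp add: ext_d_def clin_zero[OF clin_wedge_right] smooth_on_const[OF S])
  next
    case (Cons i L)
    let ?w = "\<lambda>y. wedge_list (map (\<lambda>i. covec (a i y)) L)"
    have w: "?w differentiable (at y)" using smooth_on_differentiable Cons y by blast
    have "partial j (\<lambda>y. emult (a i y) (?w y)) y = emult (a i y) (partial j ?w y) + emult (partial j (a i) y) (?w y)" for j
      by (rule partial_emult[OF smooth_on_differentiable[OF sa y] w])
    then have "ext_d (\<lambda>y. emult (a i y) (?w y)) y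
        = (\<Sum>j\<in>UNIV. emult (axis j 1) (emult (a i y) (partial j ?w y))) + (\<Sum>j\<in>UNIV. emult (axis j 1) (emult (partial j (a i) y) (?w y)))"
      by (simp add: ext_d_def emult_def[symmetric] clin_add[OF clin_emult] sum.distrib)
    also have "(\<Sum>j\<in>UNIV. emult (axis j 1) (emult (a i y) (partial j ?w y))) = - emult (a i y) (ext_d ?w y)"
      by (simp add: ext_d_def emult_def[symmetric] clin_sum[OF clin_emult] emult_anticommute[of "axis _ 1" "a i y"] sum_negf)
    finally have "ext_d (\<lambda>y. emult (a i y) (?w y)) y = 0"
      using Cons by (simp add: closed clin_zero[OF clin_emult])
    moreover have "smooth_on S (\<lambda>y. emult (a i y) (?w y))"
      unfolding emult_def using Cons by (intro smooth_on_wedge smooth_on_covec S sa) auto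
    ultimately show ?case by (simp add: emult_def)
  qed
  then show ?thesis by (simp add: cpull_axis a)
qed

text \<open>A pulled back form is a combination of pulled back basis forms with pulled back coefficients. The
  former are closed, and the latter are differentiated by the chain rule.\<close>

lemma ext_d_natural:
  fixes \<phi> :: "('d::{finite,linorder}) rvec \<Rightarrow> 'd rvec"
  assumes S: "open S" and \<phi>: "smooth_on S \<phi>" "\<phi> ` S \<subseteq> S'" and f': "smooth_on S' f'" "open S'"
    and f: "\<And>y. y \<in> S \<Longrightarrow> f y = cpull (cmat (jacobian \<phi> (at y))) (f' (\<phi> y))" and y: "y \<in> S"
  shows "ext_d f y = cpull (cmat (jacobian \<phi> (at y))) (ext_d f' (\<phi> y))"
proof -
  let ?D = "\<lambda>y. cmat (jacobian \<phi> (at y))"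
  define \<omega> where "\<omega> I y = cpull (?D y) (axis I 1)" for I y
  have s\<omega>: "smooth_on S (\<omega> I)" for I
    using opfield_cpull[OF S smooth_on_cmat[OF S smooth_on_jacobian[OF S \<phi>(1)]]]
    by (simp add: \<omega>_def[abs_def] opfield_def)
  have sf: "smooth_on S (\<lambda>y. f' (\<phi> y) $ I)" for I
    by (rule smooth_on_vec_nth[OF S smooth_on_compose[OF S \<phi>(1) f'(1) \<phi>(2)]])
  have \<phi>y: "\<phi> y \<in> S'" using \<phi>(2) y by auto
  have "ext_d f y = ext_d (\<lambda>y. \<Sum>I\<in>UNIV. f' (\<phi> y) $ I *s \<omega> I y) y"
  proof (rule ext_d_cong[OF S y])
    show "f z = (\<Sum>I\<in>UNIV. f' (\<phi> z) $ I *s \<omega> I z)" if "z \<in> S" for z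
      unfolding f[OF that] \<omega>_def by (rule clin_expand[OF clin_cpull])
  qed
  also have "\<dots> = (\<Sum>I\<in>UNIV. ext_d (\<lambda>y. f' (\<phi> y) $ I *s \<omega> I y) y)"
  proof -
    have d: "(\<lambda>y. f' (\<phi> y) $ I *s \<omega> I y) differentiable (at y)" for I
      by (rule smooth_on_differentiable[OF smooth_on_scale[OF S sf s\<omega>] y])
    have "ext_d (\<lambda>y. \<Sum>I\<in>UNIV. f' (\<phi> y) $ I *s \<omega> I y) y
       = (\<Sum>j\<in>UNIV. \<Sum>I\<in>UNIV. wedge (covec (axis j 1)) (partial j (\<lambda>y. f' (\<phi> y) $ I *s \<omega> I y) y))"
      by (simp add: ext_d_def partial_sum(1)[OF d] clin_sum[OF clin_wedge_right])
    also have "\<dots> = (\<Sum>I\<in>UNIV. \<Sum>j\<in>UNIV. wedge (covec (axis j 1)) (partial j (\<lambda>y. f' (\<phi> y) $ I *s \<omega> I y) y))"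
      by (rule sum.swap)
    finally show ?thesis by (simp add: ext_d_def)
  qed
  also have "\<dots> = (\<Sum>I\<in>UNIV. \<Sum>i\<in>UNIV. partial i f' (\<phi> y) $ I *s emult (?D y $ i) (\<omega> I y))"
  proof (rule sum.cong[OF refl])
    fix I :: "'d set"
    have d: "(\<lambda>z. f' z $ I) differentiable (at (\<phi> y))"
      by (rule smooth_on_differentiable[OF smooth_on_vec_nth[OF f'(2,1)] \<phi>y])
    have p: "partial j (\<lambda>y. f' (\<phi> y) $ I) y = (\<Sum>i\<in>UNIV. ?D y $ i $ j * partial i f' (\<phi> y) $ I)" for j
      using partial_compose[OF smooth_on_differentiable[OF \<phi>(1) y] d, of j]
        partial_vec_nth[OF smooth_on_differentiable[OF f'(1) \<phi>y]]
      by (simp add: cmat_def jacobian_nth scaleR_conv_of_real)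
    have "ext_d (\<lambda>y. f' (\<phi> y) $ I *s \<omega> I y) y
       = f' (\<phi> y) $ I *s ext_d (\<omega> I) y + (\<Sum>j\<in>UNIV. partial j (\<lambda>y. f' (\<phi> y) $ I) y *s emult (axis j 1) (\<omega> I y))"
      by (simp add: ext_d_def partial_scale[OF smooth_on_differentiable[OF sf y] smooth_on_differentiable[OF s\<omega> y]]
          emult_def[symmetric] clin_add[OF clin_emult] clin_scale[OF clin_emult] sum.distrib vec.scale_sum_right)
    also have "ext_d (\<omega> I) y = 0"
      unfolding \<omega>_def[abs_def] by (rule ext_d_pullback_axis[OF S \<phi>(1) y])
    also have "(\<Sum>j\<in>UNIV. partial j (\<lambda>y. f' (\<phi> y) $ I) y *s emult (axis j 1) (\<omega> I y))
       = (\<Sum>i\<in>UNIV. \<Sum>j\<in>UNIV. (?D y $ i $ j * partial i f' (\<phi> y) $ I) *s emult (axis j 1) (\<omega> I y))"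
      by (subst sum.swap) (simp add: p vec.scale_sum_left)
    also have "\<dots> = (\<Sum>i\<in>UNIV. partial i f' (\<phi> y) $ I *s emult (?D y $ i) (\<omega> I y))"
    proof (rule sum.cong[OF refl])
      fix i
      have "emult (?D y $ i) (\<omega> I y) = (\<Sum>j\<in>UNIV. ?D y $ i $ j *s emult (axis j 1) (\<omega> I y))"
        by (rule clin_expand[OF clin_emult_left])
      then show "(\<Sum>j\<in>UNIV. (?D y $ i $ j * partial i f' (\<phi> y) $ I) *s emult (axis j 1) (\<omega> I y))
         = partial i f' (\<phi> y) $ I *s emult (?D y $ i) (\<omega> I y)"
        by (simp add: vec.scale_sum_right vector_smult_assoc mult.commute)
    qed
    finally show "ext_d (\<lambda>y. f' (\<phi> y) $ I *s \<omega> I y) y = (\<Sum>i\<in>UNIV. partial i f' (\<phi> y) $ I *s emult (?D y $ i) (\<omega> I y))"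
      by simp
  qed
  also have "\<dots> = (\<Sum>i\<in>UNIV. \<Sum>I\<in>UNIV. partial i f' (\<phi> y) $ I *s emult (?D y $ i) (\<omega> I y))" by (rule sum.swap)
  also have "\<dots> = (\<Sum>i\<in>UNIV. emult (?D y $ i) (cpull (?D y) (partial i f' (\<phi> y))))"
  proof (rule sum.cong[OF refl])
    fix i
    have "cpull (?D y) (partial i f' (\<phi> y)) = (\<Sum>I\<in>UNIV. partial i f' (\<phi> y) $ I *s \<omega> I y)"
      unfolding \<omega>_def by (rule clin_expand[OF clin_cpull])
    then show "(\<Sum>I\<in>UNIV. partial i f' (\<phi> y) $ I *s emult (?D y $ i) (\<omega> I y))
       = emult (?D y $ i) (cpull (?D y) (partial i f' (\<phi> y)))"
      by (simp add: clin_sum[OF clin_emult] clin_scale[OF clin_emult])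
  qed
  also have "\<dots> = cpull (?D y) (ext_d f' (\<phi> y))"
    by (simp add: ext_d_def emult_def[symmetric] clin_sum[OF clin_cpull] cpull_emult axis_vector_matrix)
  finally show ?thesis .
qed

text \<open>A coordinate change that respects the structures. Its Jacobian maps the fields in the second domain
  to those in the first.\<close>

locale hermitian_transition =
  h: hermitian_domain U n J g + h': hermitian_domain U' n J' g'
  for U U' :: "(('d::{finite,linorder}) rvec) set" and n J J' g g' +
  fixes \<phi> :: "'d rvec \<Rightarrow> 'd rvec"
  assumes \<phi>: "smooth_on U \<phi>" "\<phi> ` U \<subseteq> U'"
    and J_compat: "\<And>y. y \<in> U \<Longrightarrow> J' (\<phi> y) ** jacobian \<phi> (at y) = jacobian \<phi> (at y) ** J y"
    and g_compat: "\<And>y. y \<in> U \<Longrightarrow> g y = transpose (jacobian \<phi> (at y)) ** g' (\<phi> y) ** jacobian \<phi> (at y)"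
begin

abbreviation D where "D y \<equiv> jacobian \<phi> (at y)"

abbreviation related :: "('d rvec \<Rightarrow> 'd ext) \<Rightarrow> ('d rvec \<Rightarrow> 'd ext) \<Rightarrow> bool" where
  "related f f' \<equiv> smooth_on U' f' \<and> (\<forall>y\<in>U. f y = cpull (cmat (D y)) (f' (\<phi> y)))"

lemma pq_natural: "y \<in> U \<Longrightarrow> cpull (cmat (D y)) (pq_proj (J' (\<phi> y)) p q v) = pq_proj (J y) p q (cpull (cmat (D y)) v)"
  by (rule pq_proj_intertwine) (simp add: cmat_mult[symmetric] J_compat)

lemma star_natural:
  assumes y: "y \<in> U"
  shows "cpull (cmat (D y)) (hodge_star n (J' (\<phi> y)) (g' (\<phi> y)) v) = hodge_star n (J y) (g y) (cpull (cmat (D y)) v)"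
proof -
  have \<phi>y: "\<phi> y \<in> U'" using \<phi>(2) y by auto
  interpret p: hermitian_space n "J y" "g y" by (rule h.herm[OF y])
  interpret p': hermitian_space n "J' (\<phi> y)" "g' (\<phi> y)" by (rule h'.herm[OF \<phi>y])
  have "transpose (D y) ** omega_matrix (J' (\<phi> y)) (g' (\<phi> y)) ** D y
      = transpose (J' (\<phi> y) ** D y) ** g' (\<phi> y) ** D y"
    by (simp only: omega_matrix_def matrix_transpose_mul matrix_mul_assoc)
  also have "\<dots> = transpose (J y) ** (transpose (D y) ** g' (\<phi> y) ** D y)"
    by (simp only: J_compat[OF y] matrix_transpose_mul matrix_mul_assoc)
  also have "\<dots> = omega_matrix (J y) (g y)" by (simp only: g_compat[OF y, symmetric] omega_matrix_def)
  finally have \<omega>: "transpose (cmat (D y)) ** cmat (omega_matrix (J' (\<phi> y)) (g' (\<phi> y))) ** cmat (D y)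
     = mscale 1 (cmat (omega_matrix (J y) (g y)))"
    by (simp add: cmat_mult[symmetric] cmat_transpose[symmetric] mscale_one)
  \<comment> \<open>The compatibility of the metrics makes the Jacobian invertible, with this inverse.\<close>
  have "(p.ginv ** transpose (D y) ** g' (\<phi> y)) ** D y = mat 1"
    using p.ginv(2) by (simp only: matrix_mul_assoc[symmetric]) (simp only: g_compat[OF y] matrix_mul_assoc)
  then have "D y ** (p.ginv ** transpose (D y) ** g' (\<phi> y)) = mat 1"
    by (simp add: matrix_left_right_inverse)
  then have "D y ** (p.ginv ** transpose (D y) ** g' (\<phi> y)) ** p'.ginv = p'.ginv" by simp
  moreover have "D y ** (p.ginv ** transpose (D y) ** g' (\<phi> y)) ** p'.ginv = D y ** p.ginv ** transpose (D y) ** (g' (\<phi> y) ** p'.ginv)"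
    by (simp only: matrix_mul_assoc)
  ultimately have "D y ** p.ginv ** transpose (D y) = p'.ginv" by (simp add: p'.ginv)
  then have gi: "cmat (D y) ** p.G ** transpose (cmat (D y)) = mscale 1 p'.G"
    by (simp add: cmat_mult[symmetric] cmat_transpose[symmetric] mscale_one)
  have "cpull (cmat (D y)) (p'.star v) = p.star (cpull (cmat (D y)) v)"
  proof (rule clin_eqI[of "\<lambda>v. cpull (cmat (D y)) (p'.star v)" "\<lambda>v. p.star (cpull (cmat (D y)) v)"])
    show "cpull (cmat (D y)) (p'.star (axis I 1)) = p.star (cpull (cmat (D y)) (axis I 1))" for I
      using star_scaling[OF p.hermitian_space_axioms p'.hermitian_space_axioms \<omega> gi axis_in_ext_degree[of I 1]] by simp
  qed (rule clin_compose[OF clin_cpull p'.clin_star] clin_compose[OF p.clin_star clin_cpull])+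
  then show ?thesis by (simp add: p.hodge_star_eq p'.hodge_star_eq)
qed

lemma d_comp_related:
  assumes "related f f'" shows "related (d_comp a b J f) (d_comp a b J' f')"
proof (intro conjI ballI)
  show "smooth_on U' (d_comp a b J' f')" using h'.smooth_on_d_comp assms by blast
  fix y assume y: "y \<in> U"
  have \<phi>y: "\<phi> y \<in> U'" using \<phi>(2) y by auto
  have "ext_d (\<lambda>z. pq_proj (J z) p q (f z)) y = cpull (cmat (D y)) (ext_d (\<lambda>z. pq_proj (J' z) p q (f' z)) (\<phi> y))" for p q
  proof (rule ext_d_natural[OF h.U \<phi> _ h'.U _ y])
    show "smooth_on U' (\<lambda>z. pq_proj (J' z) p q (f' z))"
      using smooth_on_opfield[OF h'.U opfield_pq_proj[OF h'.U h'.smooth_J]] assms by blast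
    show "pq_proj (J z) p q (f z) = cpull (cmat (D z)) (pq_proj (J' (\<phi> z)) p q (f' (\<phi> z)))" if "z \<in> U" for z
      using assms that by (simp add: pq_natural)
  qed
  then show "d_comp a b J f y = cpull (cmat (D y)) (d_comp a b J' f' (\<phi> y))"
    by (simp add: h.d_comp_eq[OF y] h'.d_comp_eq[OF \<phi>y] clin_sum[OF clin_cpull] pq_natural[OF y])
qed

lemma star_related: "related f f' \<Longrightarrow> related (star_field n J g f) (star_field n J' g' f')"
  using h'.smooth_on_star_field by (simp add: star_field_def star_natural)

lemma minus_related: "related f f' \<Longrightarrow> related (\<lambda>y. - f y) (\<lambda>y. - f' y)"
  by (simp add: clin_minus[OF clin_cpull] smooth_on_minus[OF h'.U])

lemma add_related: "related f f' \<Longrightarrow> related h h' \<Longrightarrow> related (\<lambda>y. f y + h y) (\<lambda>y. f' y + h' y)"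
  by (simp add: clin_add[OF clin_cpull] smooth_on_add[OF h'.U])

lemma bott_chern_related:
  assumes "related f f'" shows "related (bott_chern_local n J g f) (bott_chern_local n J' g' f')"
proof -
  have D: "related (del J f) (del J' f')" and Db: "related (delbar J f) (delbar J' f')" if "related f f'" for f f'
    using d_comp_related[OF that] by (simp_all add: del_eq_d_comp delbar_eq_d_comp)
  have Da: "related (del_adj n J g f) (del_adj n J' g' f')" if "related f f'" for f f'
    unfolding del_adj_def[abs_def] by (rule minus_related[OF star_related[OF Db[OF star_related[OF that]]]])
  have Dba: "related (delbar_adj n J g f) (delbar_adj n J' g' f')" if "related f f'" for f f'
    unfolding delbar_adj_def[abs_def] by (rule minus_related[OF star_related[OF D[OF star_related[OF that]]]])
  have "related (\<lambda>y. bott_chern_local n J g f y) (\<lambda>y. bott_chern_local n J' g' f' y)"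
    unfolding bott_chern_local_def Let_def
    by (rule add_related[OF add_related[OF add_related[OF add_related[OF add_related[OF
        D[OF Db[OF Dba[OF Da[OF assms]]]] Dba[OF Da[OF D[OF Db[OF assms]]]]] Da[OF Db[OF Dba[OF D[OF assms]]]]]
        Dba[OF D[OF Da[OF Db[OF assms]]]]] Da[OF D[OF assms]]] Dba[OF Db[OF assms]]])
  then show ?thesis by simp
qed

end

section \<open>Operators on almost Hermitian manifolds\<close>

lemma hermitian_domain_subset:
  assumes "hermitian_domain U n J g" "open V" "V \<subseteq> U" shows "hermitian_domain V n J g"
  using assms smooth_on_subset unfolding hermitian_domain_def by blast

locale almost_hermitian =
  fixes n :: nat and A :: "('m::{t2_space,second_countable_topology}, 'd::{finite,linorder}) chart set"
    and J g :: "('m, 'd) chart \<Rightarrow> 'd rvec \<Rightarrow> 'd rmat"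
  assumes ahm: "almost_hermitian_manifold n A J g"
begin

lemma atlas: "smooth_atlas A" and acs: "almost_complex_structure A J" and metric: "riemannian_metric A g"
  using ahm by (auto simp: almost_hermitian_manifold_def)

lemma chart:
  assumes "c \<in> A"
  shows "open (fst c)" "open (chart_image c)"
    "homeomorphism (fst c) (chart_image c) (snd c) (inv_into (fst c) (snd c))"
  using atlas assms by (auto simp: smooth_atlas_def)

lemma chart_inv:
  assumes "c \<in> A" "x \<in> fst c" shows "inv_into (fst c) (snd c) (snd c x) = x"
  using chart(3)[OF assms(1)] assms(2) by (simp add: homeomorphism_def)

lemma chart_inj: "c \<in> A \<Longrightarrow> x \<in> fst c \<Longrightarrow> x' \<in> fst c \<Longrightarrow> snd c x = snd c x' \<Longrightarrow> x = x'"
  by (metis chart_inv)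

lemma transition_apply:
  "c \<in> A \<Longrightarrow> x \<in> fst c \<Longrightarrow> transition c c' (snd c x) = snd c' x"
  by (simp add: transition_def chart_inv)

lemma open_chart_image_subset:
  assumes "c \<in> A" "open W" "W \<subseteq> fst c" shows "open (snd c ` W)"
proof -
  have "openin (top_of_set (fst c)) W" using assms(2,3) by (simp add: open_subset)
  from homeomorphism_imp_open_map[OF chart(3)[OF assms(1)] this] show ?thesis
    using chart(2)[OF assms(1)] openin_open_trans by blast
qed

lemma open_overlap: "c \<in> A \<Longrightarrow> c' \<in> A \<Longrightarrow> open (chart_overlap c c')"
  unfolding chart_overlap_def by (rule open_chart_image_subset) (auto intro: chart(1) open_Int)

lemma overlap_subset: "chart_overlap c c' \<subseteq> chart_image c"
  by (auto simp: chart_overlap_def chart_image_def)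

lemma smooth_transition: "c \<in> A \<Longrightarrow> c' \<in> A \<Longrightarrow> smooth_on (chart_overlap c c') (transition c c')"
  using atlas by (auto simp: smooth_atlas_def)

lemma transition_image: "c \<in> A \<Longrightarrow> transition c c' ` chart_overlap c c' \<subseteq> chart_image c'"
  by (auto simp: chart_overlap_def chart_image_def transition_apply)

lemma domain:
  assumes c: "c \<in> A" shows "hermitian_domain (chart_image c) n (J c) (g c)"
proof (rule hermitian_domain.intro)
  show "open (chart_image c)" by (rule chart(2)[OF c])
  show "smooth_on (chart_image c) (J c)" using acs c by (simp add: almost_complex_structure_def)
  show "smooth_on (chart_image c) (g c)" using metric c by (simp add: riemannian_metric_def)
  fix y assume "y \<in> chart_image c"
  then show "hermitian_space n (J c y) (g c y)"
    using ahm c unfolding almost_hermitian_manifold_def almost_complex_structure_def riemannian_metric_def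
    by (intro hermitian_space.intro) auto
qed

lemma transition_domain:
  assumes c: "c \<in> A" "c' \<in> A"
  shows "hermitian_transition (chart_overlap c c') (chart_image c') n (J c) (J c') (g c) (g c') (transition c c')"
proof -
  interpret a: hermitian_domain "chart_overlap c c'" n "J c" "g c"
    by (rule hermitian_domain_subset[OF domain[OF c(1)] open_overlap[OF c] overlap_subset])
  interpret b: hermitian_domain "chart_image c'" n "J c'" "g c'" by (rule domain[OF c(2)])
  show ?thesis
    using acs metric c smooth_transition[OF c] transition_image[OF c(1), of c']
    unfolding almost_complex_structure_def riemannian_metric_def
    by unfold_locales blast+
qed

lemma jacobian_cocycle:
  assumes c: "c \<in> A" "c' \<in> A" "c'' \<in> A" and x: "x \<in> fst c" "x \<in> fst c'" "x \<in> fst c''"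
  shows "transition_jacobian c c'' (snd c x)
    = transition_jacobian c' c'' (snd c' x) ** transition_jacobian c c' (snd c x)"
proof -
  let ?W = "snd c ` (fst c \<inter> fst c' \<inter> fst c'')" and ?y = "snd c x"
  have W: "open ?W" by (rule open_chart_image_subset[OF c(1)]) (auto intro: chart(1) c open_Int)
  have y: "?y \<in> ?W" using x by auto
  have eq: "transition c c'' z = transition c' c'' (transition c c' z)" if "z \<in> ?W" for z
    using that c by (auto simp: transition_apply)
  have d1: "transition c c' differentiable (at ?y)"
    by (rule smooth_on_differentiable[OF smooth_transition[OF c(1,2)]]) (use x in \<open>auto simp: chart_overlap_def\<close>)
  have "transition c' c'' differentiable (at (snd c' x))"
    by (rule smooth_on_differentiable[OF smooth_transition[OF c(2,3)]]) (use x in \<open>auto simp: chart_overlap_def\<close>)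
  then have d2: "transition c' c'' differentiable (at (transition c c' ?y))"
    by (simp add: transition_apply c x)
  have "partial i (transition c c'') ?y
      = (\<Sum>j\<in>UNIV. partial i (transition c c') ?y $ j *\<^sub>R partial j (transition c' c'') (snd c' x))" for i
    using partial_cong[OF W y eq] partial_compose[OF d1 d2] by (simp add: transition_apply c x)
  then show ?thesis
    by (simp add: vec_eq_iff jacobian_nth matrix_matrix_mult_def mult.commute)
qed

lemma transition_self:
  assumes "c \<in> A" "y \<in> chart_image c"
  shows "transition c c y = y" "transition_jacobian c c y = mat 1"
proof -
  have id: "transition c c z = z" if "z \<in> chart_image c" for z
    using that assms(1) by (auto simp: chart_image_def transition_apply)
  then show "transition c c y = y" using assms(2) by blast
  have "partial j (transition c c) y = axis j 1" for j
    using partial_cong[OF chart(2)[OF assms(1)] assms(2) id] partial_eqI[OF has_derivative_ident, of j y] by simp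
  then show "transition_jacobian c c y = mat 1"
    by (simp add: vec_eq_iff jacobian_nth mat_def axis_apply)
qed

lemma overlap_self: "chart_overlap c c = chart_image c"
  by (simp add: chart_overlap_def chart_image_def)

lemma pullback_pq_space:
  assumes c: "c \<in> A" "c' \<in> A" and y: "y \<in> chart_overlap c c'" and v: "v \<in> pq_space (J c' (transition c c' y)) p q"
  shows "cpull (cmat (transition_jacobian c c' y)) v \<in> pq_space (J c y) p q"
proof -
  interpret hermitian_transition "chart_overlap c c'" "chart_image c'" n "J c" "J c'" "g c" "g c'" "transition c c'"
    by (rule transition_domain[OF c])
  interpret cs: complex_structure "J c y" by (rule h.complex[OF y])
  show ?thesis using pq_natural[OF y, of p q v] pq_proj_same[OF v] cs.pq_proj_in by metis
qed

subsection \<open>Sections with prescribed values in a chart\<close>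

definition extend_section :: "('m, 'd) chart \<Rightarrow> ('d rvec \<Rightarrow> 'd ext) \<Rightarrow> ('m, 'd) form_field" where
  "extend_section c s c' y = (if y \<in> chart_overlap c' c
     then cpull (cmat (transition_jacobian c' c y)) (s (transition c' c y)) else 0)"

lemma extend_section_same: "c \<in> A \<Longrightarrow> y \<in> chart_image c \<Longrightarrow> extend_section c s c y = s y"
  by (simp add: extend_section_def overlap_self transition_self cmat_one cpull_id)

text \<open>A form with compact support in a chart domain extends by zero. Smoothness at the points outside
  the chart domain uses that a compact subset of a Hausdorff space is closed.\<close>

lemma extend_section_in_sections:
  assumes c: "c \<in> A" and s: "smooth_on (chart_image c) s" "\<And>y. y \<in> chart_image c \<Longrightarrow> s y \<in> pq_space (J c y) p q"
    and K: "compact K" "K \<subseteq> chart_image c" "\<And>y. y \<notin> K \<Longrightarrow> s y = 0"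
  shows "extend_section c s \<in> sections A (pq_bundle J p q)"
proof -
  let ?u = "extend_section c s"
  have smooth: "smooth_on (chart_image c') (?u c')" if c': "c' \<in> A" for c'
  proof (rule smooth_on_local)
    fix y assume y: "y \<in> chart_image c'"
    show "\<exists>T. y \<in> T \<and> smooth_on T (?u c')"
    proof (cases "y \<in> chart_overlap c' c")
      case True
      let ?T = "chart_overlap c' c"
      have T: "open ?T" by (rule open_overlap[OF c' c])
      have "smooth_on ?T (\<lambda>y. cpull (cmat (transition_jacobian c' c y)) (s (transition c' c y)))"
        by (rule smooth_on_opfield[OF T
              opfield_cpull[OF T smooth_on_cmat[OF T smooth_on_jacobian[OF T smooth_transition[OF c' c]]]]
              smooth_on_compose[OF T smooth_transition[OF c' c] s(1) transition_image[OF c']]])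
      then have "smooth_on ?T (?u c')"
        by (rule smooth_on_cong[OF T, rotated]) (simp add: extend_section_def)
      then show ?thesis using True by blast
    next
      case False
      define L where "L = inv_into (fst c) (snd c) ` K"
      \<comment> \<open>The support in the manifold is compact, hence closed, and lies in the chart domain.\<close>
      have "continuous_on K (inv_into (fst c) (snd c))"
        using chart(3)[OF c] K(2) by (meson continuous_on_subset homeomorphism_def)
      then have "closed L" unfolding L_def using K(1) compact_continuous_image compact_imp_closed by blast
      have "L \<subseteq> inv_into (fst c) (snd c) ` chart_image c" using K(2) by (auto simp: L_def)
      then have L: "L \<subseteq> fst c" using chart(3)[OF c] by (simp add: homeomorphism_def)
      let ?T = "snd c' ` (fst c' - L)"
      have T: "open ?T"
        by (rule open_chart_image_subset[OF c']) (auto intro: open_Diff chart(1) c' \<open>closed L\<close>)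
      have zero: "?u c' z = 0" if z: "z \<in> ?T" for z
      proof (cases "z \<in> chart_overlap c' c")
        case True
        obtain x where x: "x \<in> fst c'" "x \<notin> L" "z = snd c' x" using z by auto
        have "x \<in> fst c" using True x chart_inj[OF c'] by (auto simp: chart_overlap_def)
        then have "snd c x \<notin> K" using x(2) chart_inv[OF c] by (auto simp: L_def image_iff)
        then show ?thesis using x by (simp add: extend_section_def transition_apply[OF c'] K(3) clin_zero[OF clin_cpull])
      qed (simp add: extend_section_def)
      have T_smooth: "smooth_on ?T (?u c')"
        by (rule smooth_on_cong[OF T _ smooth_on_const[OF T, of 0]]) (rule zero[symmetric])
      have "y \<in> ?T" using y False L by (auto simp: chart_image_def chart_overlap_def)
      from this T_smooth have "y \<in> ?T \<and> smooth_on ?T (?u c')" by (rule conjI)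
      then show ?thesis by (rule exI[of _ ?T])
    qed
  qed
  have pq: "?u c' y \<in> pq_space (J c' y) p q" if c': "c' \<in> A" "y \<in> chart_image c'" for c' y
  proof (cases "y \<in> chart_overlap c' c")
    case True
    have "transition c' c y \<in> chart_image c" using transition_image[OF c'(1)] True by blast
    then show ?thesis using pullback_pq_space[OF c'(1) c True s(2)] True by (simp add: extend_section_def)
  qed (simp add: extend_section_def vec.subspace_0[OF subspace_pq_space])
  have compat: "?u c1 y = pullback (transition_jacobian c1 c2 y) (?u c2 (transition c1 c2 y))"
    if c12: "c1 \<in> A" "c2 \<in> A" "y \<in> chart_overlap c1 c2" for c1 c2 y
  proof -
    obtain x where x: "x \<in> fst c1" "x \<in> fst c2" "y = snd c1 x" using c12(3) by (auto simp: chart_overlap_def)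
    have in_iff: "snd c' x \<in> chart_overlap c' c \<longleftrightarrow> x \<in> fst c" if "c' \<in> A" "x \<in> fst c'" for c'
      using that by (auto simp: chart_overlap_def dest: chart_inj[OF that])
    show ?thesis
    proof (cases "x \<in> fst c")
      case True
      then show ?thesis
        using jacobian_cocycle[OF c12(1,2) c x(1,2) True]
        by (simp add: extend_section_def in_iff c12 c x transition_apply pullback_eq_cpull cpull_compose cmat_mult[symmetric])
    next
      case False
      then show ?thesis
        by (simp add: extend_section_def in_iff c12 c x transition_apply pullback_eq_cpull clin_zero[OF clin_cpull])
    qed
  qed
  show ?thesis unfolding sections_def pq_bundle_def using smooth pq compat by blast
qed

subsection \<open>The Bott-Chern Laplacian is a differential operator\<close>

abbreviation "P \<equiv> bott_chern_laplacian n J g"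

text \<open>In each chart the operator preserves smoothness and bidegree, and by naturality the results in
  different charts fit together.\<close>

lemma bott_chern_sections:
  assumes u: "u \<in> sections A (pq_bundle J p q)" shows "P u \<in> sections A (pq_bundle J p q)"
proof -
  have u1: "smooth_on (chart_image c) (u c)" "y \<in> chart_image c \<Longrightarrow> u c y \<in> pq_space (J c y) p q" if "c \<in> A" for c y
    using u that by (auto simp: sections_def pq_bundle_def)
  have u2: "u c y = cpull (cmat (transition_jacobian c c' y)) (u c' (transition c c' y))"
    if "c \<in> A" "c' \<in> A" "y \<in> chart_overlap c c'" for c c' y
    using u that by (simp add: sections_def pullback_eq_cpull)
  have "smooth_on (chart_image c) (P u c)" if c: "c \<in> A" for c
    unfolding bott_chern_laplacian_def by (rule hermitian_domain.smooth_on_bott_chern[OF domain[OF c] u1(1)[OF c]])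
  moreover have "P u c y \<in> pq_space (J c y) p q" if c: "c \<in> A" "y \<in> chart_image c" for c y
    unfolding bott_chern_laplacian_def
    by (rule hermitian_domain.bott_chern_pq_space[OF domain[OF c(1)] u1(2)[OF c(1)] c(2)])
  moreover have "P u c y = pullback (transition_jacobian c c' y) (P u c' (transition c c' y))"
    if c: "c \<in> A" "c' \<in> A" "y \<in> chart_overlap c c'" for c c' y
    using hermitian_transition.bott_chern_related[OF transition_domain[OF c(1,2)], where f = "u c" and f' = "u c'"] u1(1)[OF c(2)] u2[OF c(1,2)] c(3)
    by (simp add: bott_chern_laplacian_def pullback_eq_cpull)
  ultimately show ?thesis by (simp add: sections_def pq_bundle_def)
qed

lemma bott_chern_linear: "linear_on_sections A (pq_bundle J p q) (pq_bundle J p q) P"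
  unfolding linear_on_sections_def
proof (intro conjI ballI allI)
  show "u \<in> sections A (pq_bundle J p q) \<Longrightarrow> P u \<in> sections A (pq_bundle J p q)" for u
    by (rule bott_chern_sections)
  fix u c y assume u: "u \<in> sections A (pq_bundle J p q)" and c: "c \<in> A" "y \<in> chart_image c"
  have su: "smooth_on (chart_image c) (u c)" using u c by (simp add: sections_def)
  show "P (\<lambda>c y. s *s u c y) c y = s *s P u c y" for s
    unfolding bott_chern_laplacian_def by (rule hermitian_domain.bott_chern_scale[OF domain[OF c(1)] su c(2)])
  fix v assume v: "v \<in> sections A (pq_bundle J p q)"
  have sv: "smooth_on (chart_image c) (v c)" using v c by (simp add: sections_def)
  show "P (\<lambda>c y. u c y + v c y) c y = P u c y + P v c y"
    unfolding bott_chern_laplacian_def by (rule hermitian_domain.bott_chern_add[OF domain[OF c(1)] su sv c(2)])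
qed

text \<open>The average of the identity and \<open>- J(y\<^sub>0) J(y)\<close> intertwines \<open>J(y)\<close> with \<open>J(y\<^sub>0)\<close> and is the identity
  at \<open>y\<^sub>0\<close>, so it carries a basis at \<open>y\<^sub>0\<close> to a frame nearby.\<close>

lemma local_frame_exists:
  assumes c: "c \<in> A" and y0: "y0 \<in> chart_image c"
  shows "\<exists>V r e. y0 \<in> V \<and> local_frame (pq_bundle J p q) c V r e"
proof -
  interpret hermitian_domain "chart_image c" n "J c" "g c" by (rule domain[OF c])
  let ?J0 = "J c y0"
  have JJ: "J c y ** J c y = - mat 1" if "y \<in> chart_image c" for y
    using complex[OF that] by (rule complex_structure.JJ)
  define S where "S y = (1 / 2) *\<^sub>R (mat 1 - ?J0 ** J c y)" for y
  have S_J: "?J0 ** S y = S y ** J c y" if y: "y \<in> chart_image c" for y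
  proof -
    have "?J0 ** (?J0 ** J c y) = - J c y" "(?J0 ** J c y) ** J c y = - ?J0"
      using JJ[OF y] JJ[OF y0]
      by (simp_all add: matrix_mul_assoc matrix_minus_left, simp add: matrix_mul_assoc[symmetric] matrix_minus_right)
    moreover have "A ** (r *\<^sub>R B) = r *\<^sub>R (A ** B)" "(r *\<^sub>R B) ** A = r *\<^sub>R (B ** A)"
      "A ** (B - C) = A ** B - A ** C" "(B - C) ** A = B ** A - C ** A" for r and A B C :: "'d rmat"
      by (simp_all add: matrix_matrix_mult_def vec_eq_iff sum_distrib_left sum_subtractf algebra_simps)
    ultimately show ?thesis by (simp add: S_def add.commute)
  qed
  have S0: "S y0 = mat 1"
    by (simp add: S_def JJ[OF y0] scaleR_2[symmetric])
  have sS: "smooth_on (chart_image c) S"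
    unfolding S_def[abs_def]
    by (intro smooth_on_scaleR smooth_on_diff smooth_on_const smooth_on_matrix_mult U smooth_J)
  define V where "V = {y \<in> chart_image c. det (S y) \<noteq> 0}"
  have "open V"
  proof -
    have "continuous_on (chart_image c) (\<lambda>y. det (S y))"
      by (rule differentiable_imp_continuous_on)
         (auto simp: differentiable_on_def intro: differentiable_at_withinI smooth_on_differentiable[OF smooth_on_det[OF U sS]])
    then have "open (chart_image c \<inter> (\<lambda>y. det (S y)) -` (- {0}))"
      by (rule continuous_open_preimage[OF _ U]) auto
    moreover have "V = chart_image c \<inter> (\<lambda>y. det (S y)) -` (- {0})" by (auto simp: V_def)
    ultimately show ?thesis by simp
  qed
  obtain B where B: "B \<subseteq> pq_space ?J0 p q" "vec.independent B" "pq_space ?J0 p q \<subseteq> vec.span B"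
    by (rule vec.basis_exists)
  have spanB: "vec.span B = pq_space ?J0 p q"
    using B(1,3) vec.span_minimal[OF B(1) subspace_pq_space] by blast
  have "finite B" by (rule vec.finiteI_independent[OF B(2)])
  then obtain h where h: "bij_betw h {..<card B} B"
    using ex_bij_betw_nat_finite by (metis atLeast0LessThan)
  define e where "e i y = cpull (cmat (S y)) (h i)" for i y
  have frame: "inj_on (\<lambda>i. e i y) {..<card B} \<and> vec.independent ((\<lambda>i. e i y) ` {..<card B})
      \<and> vec.span ((\<lambda>i. e i y) ` {..<card B}) = pq_space (J c y) p q" if y: "y \<in> V" for y
  proof -
    let ?F = "cpull (cmat (S y))"
    have yc: "y \<in> chart_image c" and "invertible (S y)" using y by (auto simp: V_def invertible_det_nz)
    then obtain R where R: "S y ** R = mat 1" "R ** S y = mat 1" by (auto simp: invertible_def)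
    have inv1: "cpull (cmat R) (?F v) = v" and inv2: "?F (cpull (cmat R) v) = v" for v
      by (simp_all add: cpull_compose cmat_mult[symmetric] R cmat_one cpull_id)
    have RJ: "J c y ** R = R ** ?J0"
    proof -
      have "J c y ** R = R ** (S y ** J c y) ** R" by (simp add: matrix_mul_assoc R)
      also have "\<dots> = R ** ?J0 ** (S y ** R)" by (simp only: S_J[OF yc, symmetric] matrix_mul_assoc)
      finally show ?thesis by (simp add: R)
    qed
    have injF: "inj ?F" by (rule inj_on_inverseI[of _ "cpull (cmat R)"]) (rule inv1)
    interpret c0: complex_structure ?J0 by (rule complex[OF y0])
    interpret cy: complex_structure "J c y" by (rule complex[OF yc])
    have imgF: "?F ` pq_space ?J0 p q = pq_space (J c y) p q"
    proof
      have "?F v \<in> pq_space (J c y) p q" if "v \<in> pq_space ?J0 p q" for v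
        using pq_proj_intertwine[of ?J0 "cmat (S y)" "J c y" p q v] S_J[OF yc] pq_proj_same[OF that] cy.pq_proj_in
        by (metis cmat_mult)
      then show "?F ` pq_space ?J0 p q \<subseteq> pq_space (J c y) p q" by auto
      show "pq_space (J c y) p q \<subseteq> ?F ` pq_space ?J0 p q"
      proof
        fix w assume w: "w \<in> pq_space (J c y) p q"
        have "cpull (cmat R) w \<in> pq_space ?J0 p q"
          using pq_proj_intertwine[of "J c y" "cmat R" ?J0 p q w] RJ pq_proj_same[OF w] c0.pq_proj_in
          by (metis cmat_mult)
        then show "w \<in> ?F ` pq_space ?J0 p q" using inv2[of w] by (metis imageI)
      qed
    qed
    have img: "(\<lambda>i. e i y) ` {..<card B} = ?F ` B"
    proof -
      have "(\<lambda>i. e i y) ` {..<card B} = ?F ` (h ` {..<card B})" by (simp add: e_def image_image)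
      then show ?thesis by (simp only: bij_betw_imp_surj_on[OF h])
    qed
    have "inj_on (\<lambda>i. e i y) {..<card B}"
      using h injF by (auto simp: e_def bij_betw_def inj_on_def)
    moreover have "vec.independent (?F ` B)"
      by (rule vec.linear_independent_injective_image[OF clin_cpull B(2)]) (rule inj_on_subset[OF injF subset_UNIV])
    moreover have "vec.span (?F ` B) = pq_space (J c y) p q"
      using vec.linear_span_image[OF clin_cpull, of "cmat (S y)" B] by (simp add: spanB imgF)
    ultimately show ?thesis by (simp add: img)
  qed
  have "local_frame (pq_bundle J p q) c V (card B) e"
    unfolding local_frame_def pq_bundle_def
  proof (intro conjI allI impI ballI)
    show "V \<subseteq> chart_image c" by (auto simp: V_def)
    have op: "opfield (chart_image c) (\<lambda>y. cpull (cmat (S y)))"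
      by (rule opfield_cpull[OF U smooth_on_cmat[OF U sS]])
    show "smooth_on V (e i)" for i
      unfolding e_def[abs_def]
      by (rule smooth_on_subset[OF smooth_on_opfield[OF U op smooth_on_const[OF U]]]) (auto simp: V_def)
  qed (use frame \<open>open V\<close> in auto)
  moreover have "y0 \<in> V" using y0 by (simp add: V_def S0)
  ultimately show ?thesis by blast
qed

abbreviation frame_laplacian :: "('m, 'd) chart \<Rightarrow> nat \<Rightarrow> (nat \<Rightarrow> 'd rvec \<Rightarrow> 'd ext) \<Rightarrow>
    (nat \<Rightarrow> 'd rvec \<Rightarrow> complex) \<Rightarrow> 'd rvec \<Rightarrow> 'd ext" where
  "frame_laplacian c r e w \<equiv> bott_chern_local n (J c) (g c) (\<lambda>y. \<Sum>i<r. w i y *s e i y)"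

lemma bott_chern_eq_frame_laplacian:
  assumes "open V" "y \<in> V" "\<And>y. y \<in> V \<Longrightarrow> u c y = (\<Sum>i<r. w i y *s e i y)"
  shows "P u c y = frame_laplacian c r e w y"
  unfolding bott_chern_laplacian_def by (rule bott_chern_local_cong[OF assms])

text \<open>In a frame, the Laplacian is an operator of order 4 on the coefficient functions, and its symbol at
  \<open>\<xi> \<noteq> 0\<close> multiplies every frame element by the same nonzero scalar.\<close>

lemma frame_coefficients:
  assumes c: "c \<in> A" and F: "local_frame (pq_bundle J p q) c V r e"
  obtains C s where "coefficients V {..<r} 4 (frame_laplacian c r e) s C"
    "\<forall>y\<in>V. \<forall>\<xi>. \<xi> \<noteq> 0 \<longrightarrow> (\<exists>k. k \<noteq> 0 \<and> (\<forall>i. s y \<xi> i = k *s e i y))"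
proof -
  have V: "open V" "V \<subseteq> chart_image c" and se: "\<And>i. i < r \<Longrightarrow> smooth_on V (e i)"
    using F by (auto simp: local_frame_def)
  interpret hermitian_domain V n "J c" "g c" by (rule hermitian_domain_subset[OF domain[OF c] V])
  have "diffop V {..<r} 4 (frame_laplacian c r e) (\<lambda>y \<xi> i. bc_factor y \<xi> *s e i y)"
    by (rule diffop_bott_chern[OF finite_lessThan diffop_frame[OF V(1) finite_lessThan]]) (use se in auto)
  then obtain C where "coefficients V {..<r} 4 (frame_laplacian c r e) (\<lambda>y \<xi> i. bc_factor y \<xi> *s e i y) C"
    unfolding diffop_def by blast
  then show thesis by (rule that) (use bc_factor_nonzero in blast)
qed

text \<open>The coefficients are prescribed on the frame and extended linearly. Projecting them to bidegree
  \<open>(p,q)\<close> makes them endomorphisms of the bundle; on sections the projection changes nothing, since the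
  values of the operator are of that bidegree already.\<close>

lemma local_expression_exists:
  assumes c: "c \<in> A" and F: "local_frame (pq_bundle J p q) c V r e"
  shows "\<exists>a. local_expression A (pq_bundle J p q) (pq_bundle J p q) 4 P c V r e a"
proof -
  obtain C s where "coefficients V {..<r} 4 (frame_laplacian c r e) s C"
    by (rule frame_coefficients[OF c F]) blast
  note C = coefficientsD[OF this]
  have V: "open V" "V \<subseteq> chart_image c" using F by (auto simp: local_frame_def)
  interpret hermitian_domain V n "J c" "g c" by (rule hermitian_domain_subset[OF domain[OF c] V])
  let ?E = "\<lambda>y. (\<lambda>i. e i y) ` {..<r}"
  define a where "a \<alpha> y v = pq_proj (J c y) p q
      (vec.construct (?E y) (\<lambda>v. C (inv_into {..<r} (\<lambda>i. e i y) v) \<alpha> y) v)" for \<alpha> y and v :: "'d ext"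
  have fr: "inj_on (\<lambda>i. e i y) {..<r}" "vec.independent (?E y)" if "y \<in> V" for y
    using F that by (auto simp: local_frame_def)
  have lin: "clin (a \<alpha> y)" if "y \<in> V" for \<alpha> y
    unfolding a_def by (rule clin_compose[OF clin_pq_proj vec.linear_construct[OF fr(2)[OF that]]])
  have ae: "a \<alpha> y (e i y) = pq_proj (J c y) p q (C i \<alpha> y)" if "y \<in> V" "i < r" for \<alpha> y i
  proof -
    have "inv_into {..<r} (\<lambda>i. e i y) (e i y) = i" using inv_into_f_f[OF fr(1)[OF that(1)], of i] that(2) by simp
    then show ?thesis
      unfolding a_def using that(2) by (subst vec.construct_basis[OF fr(2)[OF that(1)]]) simp_all
  qed
  have "local_expression A (pq_bundle J p q) (pq_bundle J p q) 4 P c V r e a"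
    unfolding local_expression_def
  proof (intro conjI F allI impI ballI)
    fix \<alpha> :: "'d multiset" and y assume y: "y \<in> V"
    show "a \<alpha> y v \<in> pq_bundle J p q c y" for v
      using complex_structure.pq_proj_in[OF complex[OF y]] by (simp add: a_def pq_bundle_def)
    show "a \<alpha> y (v + w) = a \<alpha> y v + a \<alpha> y w" "a \<alpha> y (s *s v) = s *s a \<alpha> y v" for v w s
      by (rule clin_add[OF lin[OF y]], rule clin_scale[OF lin[OF y]])
  next
    fix \<alpha> :: "'d multiset" and i assume i: "i < r"
    have "smooth_on V (\<lambda>y. pq_proj (J c y) p q (C i \<alpha> y))"
      by (rule smooth_on_opfield[OF V(1) opfield_pq_proj[OF V(1) smooth_J] C(1)]) (simp add: i)
    then show "smooth_on V (\<lambda>y. a \<alpha> y (e i y))"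
      by (rule smooth_on_cong[OF V(1), rotated]) (simp add: ae i)
  next
    fix u and w :: "nat \<Rightarrow> 'd rvec \<Rightarrow> complex" and y
    assume u: "u \<in> sections A (pq_bundle J p q)" and w: "\<forall>i<r. smooth_on V (w i)"
      and uw: "\<forall>y\<in>V. u c y = (\<Sum>i<r. w i y *s e i y)" and y: "y \<in> V"
    have "P u c y \<in> pq_space (J c y) p q"
      using bott_chern_sections[OF u] c y V(2) by (auto simp: sections_def pq_bundle_def)
    then have proj: "pq_proj (J c y) p q (P u c y) = P u c y" by (rule pq_proj_same)
    have "P u c y = (\<Sum>i<r. \<Sum>\<alpha> | size \<alpha> \<le> 4. mpartial \<alpha> (w i) y *s C i \<alpha> y)"
      using bott_chern_eq_frame_laplacian[OF V(1) y] C(2)[OF _ y, of w] w uw by simp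
    also have "\<dots> = (\<Sum>\<alpha> | size \<alpha> \<le> 4. \<Sum>i<r. mpartial \<alpha> (w i) y *s C i \<alpha> y)" (is "_ = ?R") by (rule sum.swap)
    finally have "P u c y = pq_proj (J c y) p q ?R" using proj by simp
    also have "\<dots> = (\<Sum>\<alpha> | size \<alpha> \<le> 4. a \<alpha> y (\<Sum>i<r. mpartial \<alpha> (w i) y *s e i y))"
      by (simp add: clin_sum[OF clin_pq_proj] clin_scale[OF clin_pq_proj] clin_sum[OF lin[OF y]] clin_scale[OF lin[OF y]] ae y)
    finally show "P u c y = (\<Sum>\<alpha> | size \<alpha> \<le> 4. a \<alpha> y (\<Sum>i<r. mpartial \<alpha> (w i) y *s e i y))" .
  qed
  then show ?thesis by blast
qed

lemma bott_chern_differential_operator: "differential_operator A (pq_bundle J p q) (pq_bundle J p q) 4 P"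
  unfolding differential_operator_def
proof (intro conjI bott_chern_linear ballI)
  fix c y assume "c \<in> A" "y \<in> chart_image c"
  then show "\<exists>V r e a. y \<in> V \<and> local_expression A (pq_bundle J p q) (pq_bundle J p q) 4 P c V r e a"
    using local_frame_exists local_expression_exists by meson
qed

subsection \<open>The principal symbol\<close>

text \<open>A local expression is only constrained by its values on global sections. Testing it on the
  sections that equal \<open>(\<xi> \<bullet> (z - y))\<^sup>4 / 24\<close> times a frame element near \<open>y\<close> isolates the symbol at \<open>\<xi>\<close>,
  which therefore agrees with the one computed in the frame.\<close>

lemma symbol_scalar:
  assumes c: "c \<in> A" and L: "local_expression A (pq_bundle J p q) (pq_bundle J p q) 4 P c V r e a"
    and y: "y \<in> V" and \<xi>: "\<xi> \<noteq> 0"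
  shows "\<exists>k. k \<noteq> 0 \<and> (\<forall>v\<in>pq_space (J c y) p q. symbol 4 a y \<xi> v = k *s v)"
proof -
  have F: "local_frame (pq_bundle J p q) c V r e" using L by (simp add: local_expression_def)
  have V: "open V" "V \<subseteq> chart_image c" and se: "\<And>i. i < r \<Longrightarrow> smooth_on V (e i)"
    and span: "\<And>z. z \<in> V \<Longrightarrow> vec.span ((\<lambda>i. e i z) ` {..<r}) = pq_space (J c z) p q"
    using F by (auto simp: local_frame_def pq_bundle_def)
  have e_in: "e i z \<in> pq_space (J c z) p q" if "i < r" "z \<in> V" for i z
    using span[OF that(2)] vec.span_base[of "e i z" "(\<lambda>i. e i z) ` {..<r}"] that(1) by blast
  have a_add: "a \<alpha> y (v + w) = a \<alpha> y v + a \<alpha> y w" and a_scale: "a \<alpha> y (s *s v) = s *s a \<alpha> y v"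
    if "size \<alpha> \<le> 4" "v \<in> pq_space (J c y) p q" "w \<in> pq_space (J c y) p q" for \<alpha> v w s
    using L y that by (auto simp: local_expression_def pq_bundle_def)
  have zero_in: "0 \<in> pq_space (J c y) p q" by (rule vec.subspace_0[OF subspace_pq_space])
  have a_zero: "a \<alpha> y 0 = 0" if "size \<alpha> \<le> 4" for \<alpha>
    using a_scale[OF that zero_in zero_in, of 0] by simp
  obtain C s' where "coefficients V {..<r} 4 (frame_laplacian c r e) s' C"
    and s': "\<forall>y\<in>V. \<forall>\<xi>. \<xi> \<noteq> 0 \<longrightarrow> (\<exists>k. k \<noteq> 0 \<and> (\<forall>i. s' y \<xi> i = k *s e i y))"
    by (rule frame_coefficients[OF c F]) blast
  note C = coefficientsD[OF this(1)]
  obtain k where k: "k \<noteq> 0" "\<And>i. i < r \<Longrightarrow> (\<Sum>\<alpha> | size \<alpha> = 4. of_real (mpower \<xi> \<alpha>) *s C i \<alpha> y) = k *s e i y"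
    using s'[rule_format, OF y \<xi>] C(3)[OF y, of _ \<xi>] by auto
  obtain \<beta> :: "'d rvec \<Rightarrow> real" and N K where \<beta>: "smooth_on UNIV \<beta>" "compact K" "K \<subseteq> V" "\<And>z. z \<notin> K \<Longrightarrow> \<beta> z = 0"
      "open N" "y \<in> N" "\<And>z. z \<in> N \<Longrightarrow> \<beta> z = 1"
    by (rule smooth_cutoff[OF V(1) y]) blast
  define \<phi> :: "'d rvec \<Rightarrow> complex" where "\<phi> z = of_real (\<beta> z * ((\<xi> \<bullet> (z - y)) ^ 4 / fact 4))" for z
  have s_poly: "smooth_on UNIV (\<lambda>z. (\<xi> \<bullet> (z - y)) ^ 4 / fact 4)"
  proof -
    have "smooth_on UNIV (\<lambda>z. \<Sum>i\<in>UNIV. \<xi> $ i * (z $ i - y $ i))"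
      by (intro smooth_on_sum smooth_on_mult smooth_on_const smooth_on_diff smooth_on_vec_nth smooth_on_ident open_UNIV)
    then have "smooth_on UNIV (\<lambda>z. \<xi> \<bullet> (z - y))" by (simp add: inner_vec_def)
    then show ?thesis by (intro smooth_on_divide smooth_on_power smooth_on_const open_UNIV) auto
  qed
  have s\<phi>: "smooth_on UNIV \<phi>"
    unfolding \<phi>_def[abs_def] by (intro smooth_on_of_real smooth_on_mult open_UNIV \<beta>(1) s_poly)
  have d\<phi>: "mpartial \<alpha> \<phi> y = (if size \<alpha> = 4 then of_real (mpower \<xi> \<alpha>) else 0)" if "size \<alpha> \<le> 4" for \<alpha>
  proof -
    have "mpartial \<alpha> \<phi> y = mpartial \<alpha> (\<lambda>z. complex_of_real ((\<xi> \<bullet> (z - y)) ^ 4 / fact 4)) y"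
      by (rule mpartial_cong[OF \<beta>(5) _ \<beta>(6)]) (simp add: \<phi>_def \<beta>(7))
    also have "\<dots> = of_real (mpartial \<alpha> (\<lambda>z. (\<xi> \<bullet> (z - y)) ^ 4 / fact 4) y)"
      by (rule mpartial_bounded_linear[OF bounded_linear_of_real open_UNIV s_poly UNIV_I])
    finally show ?thesis using mpartial_linear_power[OF that, of \<xi> y] by simp
  qed
  have sym_e: "symbol 4 a y \<xi> (e j y) = k *s e j y" if j: "j < r" for j
  proof -
    define s where "s z = (if z \<in> V then \<phi> z *s e j z else 0)" for z
    have sV: "smooth_on V s"
      by (rule smooth_on_cong[OF V(1) _ smooth_on_scale[OF V(1) smooth_on_subset[OF s\<phi> subset_UNIV] se[OF j]]]) (simp add: s_def)
    have s0: "s z = 0" if "z \<notin> K" for z using \<beta>(4)[OF that] by (simp add: s_def \<phi>_def)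
    have "smooth_on (chart_image c) s"
    proof (rule smooth_on_local)
      fix z
      show "\<exists>T. z \<in> T \<and> smooth_on T s"
      proof (cases "z \<in> V")
        case False
        have oK: "open (- K)" using compact_imp_closed[OF \<beta>(2)] by auto
        have "smooth_on (- K) s" by (rule smooth_on_cong[OF oK _ smooth_on_const[OF oK, of 0]]) (simp add: s0)
        then show ?thesis using False \<beta>(3) by (intro exI[of _ "- K"]) auto
      qed (use sV in blast)
    qed
    moreover have "s z \<in> pq_space (J c z) p q" for z
      by (cases "z \<in> V") (simp_all add: s_def e_in[OF j] vec.subspace_scale[OF subspace_pq_space]
          vec.subspace_0[OF subspace_pq_space])
    ultimately have u: "extend_section c s \<in> sections A (pq_bundle J p q)"
      by (intro extend_section_in_sections[OF c _ _ \<beta>(2)]) (use \<beta>(3) V(2) s0 in auto)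
    define w where "w i = (if i = j then \<phi> else (\<lambda>z. 0))" for i
    have sw: "smooth_on V (w i)" for i
      by (cases "i = j") (simp_all add: w_def smooth_on_subset[OF s\<phi>] smooth_on_const[OF V(1)])
    have uw: "extend_section c s c z = (\<Sum>i<r. w i z *s e i z)" if z: "z \<in> V" for z
    proof -
      have "(\<Sum>i<r. w i z *s e i z) = (\<Sum>i<r. if i = j then \<phi> z *s e j z else 0)"
        by (rule sum.cong) (auto simp: w_def)
      then show ?thesis using z V(2) j by (simp add: extend_section_same[OF c] subset_iff s_def)
    qed
    have dw: "mpartial \<alpha> (w i) y = (if i = j \<and> size \<alpha> = 4 then of_real (mpower \<xi> \<alpha>) else 0)" if "size \<alpha> \<le> 4" for \<alpha> i
    proof (cases "i = j")
      case False
      have "mpartial \<alpha> (\<lambda>z. 0 :: complex) y = 0"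
        using mpartial_bounded_linear[OF bounded_linear_zero open_UNIV smooth_on_const[OF open_UNIV, of 0] UNIV_I, of \<alpha> y] by simp
      then show ?thesis using False by (simp add: w_def)
    qed (simp add: w_def d\<phi>[OF that])
    have "P (extend_section c s) c y = (\<Sum>i<r. \<Sum>\<alpha> | size \<alpha> \<le> 4. mpartial \<alpha> (w i) y *s C i \<alpha> y)"
      using bott_chern_eq_frame_laplacian[OF V(1) y, where u = "extend_section c s" and c = c and r = r and e = e and w = w, OF uw] C(2)[OF sw y] by simp
    also have "\<dots> = (\<Sum>i<r. if i = j then k *s e j y else 0)"
    proof (rule sum.cong[OF refl])
      fix i assume i: "i \<in> {..<r}"
      have "(\<Sum>\<alpha> | size \<alpha> \<le> 4. mpartial \<alpha> (w i) y *s C i \<alpha> y) = (\<Sum>\<alpha> | size \<alpha> = 4. (if i = j then of_real (mpower \<xi> \<alpha>) else 0) *s C i \<alpha> y)"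
        by (rule sum.mono_neutral_cong_right) (auto simp: dw finite_multisets_size_le)
      also have "\<dots> = (if i = j then k *s e j y else 0)" using k(2)[OF j] by simp
      finally show "(\<Sum>\<alpha> | size \<alpha> \<le> 4. mpartial \<alpha> (w i) y *s C i \<alpha> y) = (if i = j then k *s e j y else 0)" .
    qed
    finally have 1: "P (extend_section c s) c y = k *s e j y" using j by simp
    have "P (extend_section c s) c y = (\<Sum>\<alpha> | size \<alpha> \<le> 4. a \<alpha> y (\<Sum>i<r. mpartial \<alpha> (w i) y *s e i y))"
      using L u sw uw y unfolding local_expression_def by blast
    also have "\<dots> = (\<Sum>\<alpha> | size \<alpha> = 4. of_real (mpower \<xi> \<alpha>) *s a \<alpha> y (e j y))"
    proof (rule sum.mono_neutral_cong_right)
      have s: "(\<Sum>i<r. mpartial \<alpha> (w i) y *s e i y) = (if size \<alpha> = 4 then of_real (mpower \<xi> \<alpha>) *s e j y else 0)"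
        if "size \<alpha> \<le> 4" for \<alpha>
      proof -
        have "(\<Sum>i<r. mpartial \<alpha> (w i) y *s e i y)
            = (\<Sum>i<r. if i = j then (if size \<alpha> = 4 then of_real (mpower \<xi> \<alpha>) *s e j y else 0) else 0)"
          by (rule sum.cong) (auto simp: dw[OF that])
        then show ?thesis using j by simp
      qed
      show "\<forall>\<alpha>\<in>{\<alpha>. size \<alpha> \<le> 4} - {\<alpha>. size \<alpha> = 4}. a \<alpha> y (\<Sum>i<r. mpartial \<alpha> (w i) y *s e i y) = 0"
        by (auto simp: s a_zero)
      show "a \<alpha> y (\<Sum>i<r. mpartial \<alpha> (w i) y *s e i y) = of_real (mpower \<xi> \<alpha>) *s a \<alpha> y (e j y)"
        if "\<alpha> \<in> {\<alpha>. size \<alpha> = 4}" for \<alpha>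
        using that a_scale[OF _ e_in[OF j y] zero_in, of \<alpha>] by (simp add: s)
    qed (auto simp: finite_multisets_size_le)
    also have "\<dots> = symbol 4 a y \<xi> (e j y)" by (simp add: symbol_def)
    finally show ?thesis using 1 by simp
  qed
  have "v \<in> pq_space (J c y) p q \<and> symbol 4 a y \<xi> v = k *s v" if "v \<in> pq_space (J c y) p q" for v
    using that unfolding span[OF y, symmetric]
  proof (induction rule: span_linear_induct)
    case (base v)
    then show ?case using sym_e e_in y span by auto
  next
    case subspace
    have sp: "vec.span ((\<lambda>i. e i y) ` {..<r}) = pq_space (J c y) p q" by (rule span[OF y])
    show ?case unfolding sp
    proof (rule vec.subspaceI; clarify)
      show "0 \<in> pq_space (J c y) p q \<and> symbol 4 a y \<xi> 0 = k *s 0"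
        using zero_in by (simp add: symbol_def a_zero)
    next
      fix v w assume vw: "v \<in> pq_space (J c y) p q" "symbol 4 a y \<xi> v = k *s v" "w \<in> pq_space (J c y) p q" "symbol 4 a y \<xi> w = k *s w"
      have "symbol 4 a y \<xi> (v + w) = symbol 4 a y \<xi> v + symbol 4 a y \<xi> w"
        by (simp add: symbol_def a_add vw vector_add_ldistrib sum.distrib)
      then show "v + w \<in> pq_space (J c y) p q \<and> symbol 4 a y \<xi> (v + w) = k *s (v + w)"
        using vw vec.subspace_add[OF subspace_pq_space] by (simp add: vector_add_ldistrib)
    next
      fix s v assume v: "v \<in> pq_space (J c y) p q" "symbol 4 a y \<xi> v = k *s v"
      have "symbol 4 a y \<xi> (s *s v) = s *s symbol 4 a y \<xi> v"
        by (simp add: symbol_def a_scale[OF _ v(1) v(1)] vec.scale_sum_right vector_smult_assoc mult.commute)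
      then show "s *s v \<in> pq_space (J c y) p q \<and> symbol 4 a y \<xi> (s *s v) = k *s (s *s v)"
        using v vec.subspace_scale[OF subspace_pq_space] by (simp add: vector_smult_assoc mult.commute)
    qed
  qed
  then show ?thesis using k(1) by blast
qed

end

theorem proposition3p2:
  fixes A :: "('m::{t2_space,second_countable_topology}, 'd::{finite,linorder}) chart set"
    and J g :: "('m, 'd) chart \<Rightarrow> 'd rvec \<Rightarrow> 'd rmat"
    and n p q :: nat
  assumes "almost_hermitian_manifold n A J g"
  shows "elliptic A (pq_bundle J p q) (pq_bundle J p q) 4 (bott_chern_laplacian n J g)"
proof -
  interpret almost_hermitian n A J g by unfold_locales (rule assms)
  show ?thesis unfolding elliptic_def
  proof (intro conjI ballI allI impI)
    show "differential_operator A (pq_bundle J p q) (pq_bundle J p q) 4 (bott_chern_laplacian n J g)"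
      by (rule bott_chern_differential_operator)
  next
    fix c V r e a y and \<xi> :: "'d rvec"
    assume c: "c \<in> A" and L: "local_expression A (pq_bundle J p q) (pq_bundle J p q) 4 (bott_chern_laplacian n J g) c V r e a"
      and y: "y \<in> V" and \<xi>: "\<xi> \<noteq> 0"
    obtain k where k: "k \<noteq> 0" "\<And>v. v \<in> pq_space (J c y) p q \<Longrightarrow> symbol 4 a y \<xi> v = k *s v"
      using symbol_scalar[OF c L y \<xi>] by blast
    have sub: "s *s v \<in> pq_space (J c y) p q" if "v \<in> pq_space (J c y) p q" for s v
      by (rule vec.subspace_scale[OF subspace_pq_space that])
    show "bij_betw (symbol 4 a y \<xi>) (pq_bundle J p q c y) (pq_bundle J p q c y)"
      unfolding pq_bundle_def
      by (rule bij_betw_byWitness[of _ "\<lambda>v. (1 / k) *s v"])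
         (auto simp: k sub vector_smult_assoc)
  qed
qed

end
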